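(* Let $(X_i, i\in\mathbb{T}^* )$ be a super-critical spatially homogeneous $P^*$-bifurcating Markov chain on a Galton-Watson tree, and let $W=\lim_{q\to\infty} m^{-q}|\mathbb{G}_q^*|$ (limit a.s. and in $L^2$). Assume that the auxiliary Markov chain $Y$ is ergodic in the following sense: there exists a probability measure $\mu$ on $S$ such that for all $h\in C_b(S)$ and all $x\in S$, $\lim_{k\to\infty}\mathbb{E}_x[h(Y_k)]=\langle\mu,h\rangle$. Assume also that $x\mapsto P^*g(x)$ belongs to $C_b(\bar S)$ for all $g\in C_b(\bar S^3)$. Let $d\ge1$, and for $\ell\in\{1,\dots,d\}$ let $f_\ell\in C_b(\bar S^3)$ and $\sigma_\ell^2=\langle\mu,P^*(f_\ell^2)-(P^*f_\ell)^2\rangle$. For $f\in C_b(\bar S^3)$ set $$N_n(f)=\frac{1}{\sqrt{|\mathbb{G}_n^*|}}\sum_{i\in\mathbb{G}_n^*}\big(f(\Delta_i)-P^*f(X_i)\big).$$ Then, as $n\to\infty$, the following convergence holds in distribution: $$\big(N_n(f_1),\dots,N_{n-d+1}(f_d)\big)\mathbf{1}_{\{|\mathbb{G}_n^*|>0\}}\longrightarrow \mathbf{1}_{\{W\ne0\}}(\sigma_1G_1,\dots,\sigma_dG_d),$$ where the $\ell$-th coordinate on the left is $N_{n-\ell+1}(f_\ell)$ and $G_1,\dots,G_d$ are independent Gaussian random variables with mean zero and variance $1$, and are independent of $W$.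
   Context: Tree: $\mathbb{G}_0=\{\emptyset\}$, $\mathbb{G}_k=\{0,1\}^k$ for $k\ge1$, $\mathbb{T}_r=\bigcup_{0\le k\le r}\mathbb{G}_k$, $\mathbb{T}=\bigcup_{k\ge0}\mathbb{G}_k$; the two daughters of $i\in\mathbb{T}$ are $i0$ and $i1$ (with $\emptyset0=0$, $\emptyset1=1$). State space: $S$ is a metric space with its Borel $\sigma$-field $\mathcal{S}$; $\bar S=S\cup\{\partial\}$, where $\partial$ is an added (isolated) cemetery point, and $\bar{\mathcal S}$ is the $\sigma$-field generated by $\mathcal S$ and $\{\partial\}$. $C_b(E)$ denotes the bounded continuous real functions on $E$. Kernel: $P^*$ is a probability kernel from $\bar S$ to $\bar S^2$ with $P^*(\partial,\{(\partial,\partial)\})=1$. For measurable $g$ on $\bar S^3$, $P^*g(x)=\int_{\bar S^2} g(x,y,z)\,P^*(x,dy,dz)$ when this exists. $P^*$-bifurcating Markov chain ($P^*$-BMC): a process $(X_i,i\in\mathbb{T})$ with values in $\bar S$ such that $X_\emptyset$ has law $\nu$ and, for all bounded measurable real $(g_i,i\in\mathbb{T})$ on $\bar S^3$ and all $k\ge0$, $\mathbb{E}[\prod_{i\in\mathbb{G}_k}g_i(X_i,X_{i0},X_{i1})\mid\sigma(X_j;j\in\mathbb{T}_k)]=\prod_{i\in\mathbb{G}_k}P^*g_i(X_i)$. The law $\nu$ is carried by $S$. Let $\mathbb{T}^*=\{i\in\mathbb{T}:X_i\ne\partial\}$ and $J^*=J\cap\mathbb{T}^*$ for $J\subset\mathbb{T}$;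 $(X_i,i\in\mathbb{T}^* )$ is called a $P^*$-BMC on a Galton-Watson tree. It is spatially homogeneous if $p_{1,0}=P^*(x,S\times S)$, $p_0=P^*(x,S\times\{\partial\})$, $p_1=P^*(x,\{\partial\}\times S)$ do not depend on $x\in S$, and then super-critical if $m:=2p_{1,0}+p_0+p_1>1$. $|J|$ is the cardinality of $J$. $\Delta_i=(X_i,X_{i0},X_{i1})$. Auxiliary chain: for $x\in S$ and $A\in\mathcal S$, $P_0^*(x,A)=P^*(x,A\times\bar S)$, $P_1^*(x,A)=P^*(x,\bar S\times A)$, $Q=\frac1m(P_0^*+P_1^* )$. $Y=(Y_n,n\in\mathbb{N})$ is a Markov chain on $S$ with transition kernel $Q$ and $Y_0$ distributed as $X_\emptyset$; $\mathbb{E}_x$ means the initial state is $x$. $\langle\mu,h\rangle=\int_S h\,d\mu$ (for $h$ defined on $\bar S$, the restriction to $S$ is integrated). An expression multiplied by the indicator of an event is $0$ off that event. *)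

theory Defs
  imports "HOL-Probability.Probability"
begin

section \<open>The state space with a cemetery\<close>

text \<open>
  For a state space \<open>S\<close> given by a type \<open>'a\<close>, the space \<open>S \<union> {\<partial>}\<close> is \<open>'a option\<close> with
  \<open>\<partial> = None\<close>. It carries the disjoint-sum topology, so that \<open>None\<close> is isolated.
\<close>

instantiation option :: (topological_space) topological_space
begin

definition open_option :: "'a option set \<Rightarrow> bool"
  where "open_option U \<longleftrightarrow> open (Some -` U)"

instance
proof
  show "open (UNIV :: 'a option set)"
    by (simp add: open_option_def)
  show "open (U \<inter> V)" if "open U" "open V" for U V :: "'a option set"
    using that by (auto simp: open_option_def)
  show "open (\<Union>K)" if "\<forall>U\<in>K. open U" for K :: "'a option set set"
  proof -
    have "Some -` \<Union>K = (\<Union>U\<in>K. Some -` U)" by auto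
    with that show ?thesis by (auto simp: open_option_def)
  qed
qed

end

lemma open_range_Some: "open (range (Some :: 'a::topological_space \<Rightarrow> 'a option))"
proof -
  have "Some -` range (Some :: 'a \<Rightarrow> 'a option) = UNIV" by auto
  then show ?thesis by (simp add: open_option_def)
qed

lemma open_None: "open {None :: 'a::topological_space option}"
proof -
  have "Some -` {None :: 'a option} = {}" by auto
  then show ?thesis by (simp add: open_option_def)
qed

lemma continuous_on_Some: "continuous_on UNIV (Some :: 'a::topological_space \<Rightarrow> 'a option)"
  by (simp add: continuous_on_open_vimage open_option_def)

lemma measurable_Some_borel [measurable]:
  "(Some :: 'a::topological_space \<Rightarrow> 'a option) \<in> borel \<rightarrow>\<^sub>M borel"
  by (rule borel_measurable_continuous_onI[OF continuous_on_Some])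

lemma Some_image_borel:
  assumes "A \<in> sets (borel :: 'a::topological_space measure)"
  shows "Some ` A \<in> sets (borel :: 'a option measure)"
proof -
  have eq: "sets (borel :: 'a measure) = sigma_sets UNIV {S. open S}"
    by (simp add: borel_def)
  have range: "range Some \<in> sets (borel :: 'a option measure)"
    by (rule borel_open[OF open_range_Some])
  have "A \<in> sigma_sets UNIV {S. open S}" using assms eq by simp
  then show ?thesis
  proof induction
    case (Basic S)
    have "Some -` (Some ` S) = S" by auto
    with Basic show ?case by (intro borel_open) (simp add: open_option_def)
  next
    case Empty
    then show ?case by simp
  next
    case (Compl S)
    have "Some ` (UNIV - S) = range Some - Some ` S" by auto
    with Compl range show ?case by auto
  next
    case (Union S)
    have "Some ` (\<Union>i. S i) = (\<Union>i. Some ` S i)" by auto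
    with Union show ?case by auto
  qed
qed

text \<open>The Borel sets of \<open>'a option\<close> are generated by those of \<open>'a\<close> and the cemetery.\<close>

lemma sets_borel_option:
  "sets (borel :: 'a::topological_space option measure) =
     sigma_sets UNIV (insert {None} ((`) Some ` sets borel))"
  (is "_ = sigma_sets UNIV ?G")
proof
  have "{S. open S} \<subseteq> sigma_sets UNIV ?G"
  proof clarify
    fix U :: "'a option set"
    assume "open U"
    then have "Some -` U \<in> sets borel" by (auto simp: open_option_def)
    then have 1: "Some ` (Some -` U) \<in> sigma_sets UNIV ?G"
      by (intro sigma_sets.Basic insertI2 imageI)
    have 2: "U \<inter> {None} \<in> sigma_sets UNIV ?G"
      by (cases "None \<in> U") (auto intro: sigma_sets.Empty)
    have "U = Some ` (Some -` U) \<union> (U \<inter> {None})"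
    proof
      show "U \<subseteq> Some ` (Some -` U) \<union> (U \<inter> {None})"
      proof
        fix u assume "u \<in> U"
        then show "u \<in> Some ` (Some -` U) \<union> (U \<inter> {None})" by (cases u) auto
      qed
    qed auto
    with 1 2 show "U \<in> sigma_sets UNIV ?G" by (metis sigma_sets_Un)
  qed
  then show "sets borel \<subseteq> sigma_sets UNIV ?G"
    by (simp add: borel_def sigma_sets_mono)
  show "sigma_sets UNIV ?G \<subseteq> sets borel"
    using Some_image_borel borel_open[OF open_None]
    by (intro sets.sigma_sets_subset') auto
qed


section \<open>Binary tree\<close>

definition generation :: "nat \<Rightarrow> bool list set"
  where "generation k = {i. length i = k}"

definition tree_upto :: "nat \<Rightarrow> bool list set"
  where "tree_upto r = (\<Union>k\<le>r. generation k)"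


section \<open>Kernels and bifurcating Markov chains\<close>

text \<open>
  Products carry the product \<open>\<sigma>\<close>-algebra. For a non-separable \<open>S\<close> this may be strictly smaller
  than the Borel \<open>\<sigma>\<close>-algebra of the product topology.
\<close>

abbreviation triple_borel :: "('a::topological_space option \<times> 'a option \<times> 'a option) measure"
  where "triple_borel \<equiv> borel \<Otimes>\<^sub>M (borel \<Otimes>\<^sub>M borel)"

definition bifurcating_kernel ::
    "('a::topological_space option \<Rightarrow> ('a option \<times> 'a option) measure) \<Rightarrow> bool"
  where "bifurcating_kernel P \<longleftrightarrow>
    P \<in> borel \<rightarrow>\<^sub>M prob_algebra (borel \<Otimes>\<^sub>M borel) \<and>
    measure (P None) {(None, None)} = 1"

text \<open>\<open>kernel_op P g\<close> is the function \<open>P\<^sup>*g\<close>; the bound variable \<open>w\<close> stands for the pair \<open>(y, z)\<close>.\<close>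

definition kernel_op ::
    "('a option \<Rightarrow> ('a option \<times> 'a option) measure) \<Rightarrow>
     ('a option \<times> 'a option \<times> 'a option \<Rightarrow> real) \<Rightarrow> 'a option \<Rightarrow> real"
  where "kernel_op P g x = (\<integral>w. g (x, w) \<partial>P x)"

text \<open>The \<open>\<sigma>\<close>-algebra generated by the variables \<open>X\<^sub>j\<close>, \<open>j \<in> J\<close>.\<close>

definition generated_algebra ::
    "'w measure \<Rightarrow> ('i \<Rightarrow> 'w \<Rightarrow> 'b::topological_space) \<Rightarrow> 'i set \<Rightarrow> 'w measure"
  where "generated_algebra M X J =
    sigma (space M) (\<Union>j\<in>J. {X j -` A \<inter> space M | A. A \<in> sets borel})"

definition triple :: "(bool list \<Rightarrow> 'w \<Rightarrow> 'b) \<Rightarrow> bool list \<Rightarrow> 'w \<Rightarrow> 'b \<times> 'b \<times> 'b"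
  where "triple X i \<omega> = (X i \<omega>, X (i @ [False]) \<omega>, X (i @ [True]) \<omega>)"

definition bifurcating_Markov_chain ::
    "'w measure \<Rightarrow> 'a::topological_space option measure \<Rightarrow>
     ('a option \<Rightarrow> ('a option \<times> 'a option) measure) \<Rightarrow>
     (bool list \<Rightarrow> 'w \<Rightarrow> 'a option) \<Rightarrow> bool"
  where "bifurcating_Markov_chain M \<nu> P X \<longleftrightarrow>
    prob_space M \<and>
    (\<forall>i. X i \<in> M \<rightarrow>\<^sub>M borel) \<and>
    distr M borel (X []) = \<nu> \<and>
    (\<forall>g. (\<forall>i. g i \<in> borel_measurable triple_borel \<and> bounded (range (g i))) \<longrightarrow>
      (\<forall>k. AE \<omega> in M.
        real_cond_exp M (generated_algebra M X (tree_upto k))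
          (\<lambda>\<omega>. \<Prod>i\<in>generation k. g i (triple X i \<omega>)) \<omega> =
        (\<Prod>i\<in>generation k. kernel_op P (g i) (X i \<omega>))))"

definition living :: "(bool list \<Rightarrow> 'w \<Rightarrow> 'a option) \<Rightarrow> 'w \<Rightarrow> bool list set"
  where "living X \<omega> = {i. X i \<omega> \<noteq> None}"

definition living_generation ::
    "(bool list \<Rightarrow> 'w \<Rightarrow> 'a option) \<Rightarrow> nat \<Rightarrow> 'w \<Rightarrow> bool list set"
  where "living_generation X k \<omega> = generation k \<inter> living X \<omega>"

definition spatially_homogeneous ::
    "('a option \<Rightarrow> ('a option \<times> 'a option) measure) \<Rightarrow> real \<Rightarrow> real \<Rightarrow> real \<Rightarrow> bool"
  where "spatially_homogeneous P p10 p0 p1 \<longleftrightarrow>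
    (\<forall>x. measure (P (Some x)) (range Some \<times> range Some) = p10 \<and>
         measure (P (Some x)) (range Some \<times> {None}) = p0 \<and>
         measure (P (Some x)) ({None} \<times> range Some) = p1)"


section \<open>Auxiliary Markov chain\<close>

definition first_marginal ::
    "('a::topological_space option \<Rightarrow> ('a option \<times> 'a option) measure) \<Rightarrow> 'a \<Rightarrow> 'a set \<Rightarrow> ennreal"
  where "first_marginal P x A = emeasure (P (Some x)) (Some ` A \<times> UNIV)"

definition second_marginal ::
    "('a::topological_space option \<Rightarrow> ('a option \<times> 'a option) measure) \<Rightarrow> 'a \<Rightarrow> 'a set \<Rightarrow> ennreal"
  where "second_marginal P x A = emeasure (P (Some x)) (UNIV \<times> Some ` A)"

definition auxiliary_kernel ::
    "real \<Rightarrow> ('a::topological_space option \<Rightarrow> ('a option \<times> 'a option) measure) \<Rightarrow> 'a \<Rightarrow> 'a measure"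
  where "auxiliary_kernel m P x =
    measure_of UNIV (sets borel)
      (\<lambda>A. ennreal (1 / m) * (first_marginal P x A + second_marginal P x A))"

lemma sets_auxiliary_kernel [simp]: "sets (auxiliary_kernel m P x) = sets borel"
  unfolding auxiliary_kernel_def
  using sets.sigma_sets_eq[of "borel :: 'a measure"] by (subst sets_measure_of) auto

text \<open>The set function above is countably additive, so \<open>auxiliary_kernel\<close> takes its values.\<close>

lemma emeasure_auxiliary_kernel:
  fixes P :: "'a::topological_space option \<Rightarrow> ('a option \<times> 'a option) measure"
  assumes P: "bifurcating_kernel P" and A: "A \<in> sets borel"
  shows "emeasure (auxiliary_kernel m P x) A =
    ennreal (1 / m) * (first_marginal P x A + second_marginal P x A)"
proof (rule emeasure_measure_of[OF auxiliary_kernel_def])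
  have sets: "sets (P (Some x)) = sets (borel \<Otimes>\<^sub>M borel)"
    using P measurable_space[of P borel "prob_algebra (borel \<Otimes>\<^sub>M borel)" "Some x"]
    by (auto simp: bifurcating_kernel_def space_prob_algebra)
  have 1: "Some ` B \<times> UNIV \<in> sets (P (Some x))" "UNIV \<times> Some ` B \<in> sets (P (Some x))"
    if "B \<in> sets borel" for B :: "'a set"
    using Some_image_borel[OF that] by (auto simp: sets)
  show "countably_additive (sets (auxiliary_kernel m P x))
    (\<lambda>A. ennreal (1 / m) * (first_marginal P x A + second_marginal P x A))"
  proof (rule countably_additiveI)
    fix B :: "nat \<Rightarrow> 'a set"
    assume B: "range B \<subseteq> sets (auxiliary_kernel m P x)" and disj: "disjoint_family B"
    have "(\<Sum>n. first_marginal P x (B n)) = emeasure (P (Some x)) (\<Union>n. Some ` B n \<times> UNIV)"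
      unfolding first_marginal_def using B disj 1(1)
      by (intro suminf_emeasure) (auto simp: disjoint_family_on_def)
    moreover have "(\<Sum>n. second_marginal P x (B n)) = emeasure (P (Some x)) (\<Union>n. UNIV \<times> Some ` B n)"
      unfolding second_marginal_def using B disj 1(2)
      by (intro suminf_emeasure) (auto simp: disjoint_family_on_def)
    moreover have "(\<Union>n. Some ` B n \<times> UNIV) = Some ` (\<Union>n. B n) \<times> (UNIV :: 'a option set)"
      "(\<Union>n. UNIV \<times> Some ` B n) = (UNIV :: 'a option set) \<times> Some ` (\<Union>n. B n)" by auto
    ultimately show "(\<Sum>n. ennreal (1 / m) * (first_marginal P x (B n) + second_marginal P x (B n))) =
      ennreal (1 / m) * (first_marginal P x (\<Union>n. B n) + second_marginal P x (\<Union>n. B n))"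
      by (simp add: first_marginal_def second_marginal_def suminf_add[symmetric])
  qed
qed (use A in \<open>auto simp: positive_def first_marginal_def second_marginal_def\<close>)

definition Markov_chain ::
    "'w measure \<Rightarrow> 'a::topological_space measure \<Rightarrow> ('a \<Rightarrow> 'a measure) \<Rightarrow> (nat \<Rightarrow> 'w \<Rightarrow> 'a) \<Rightarrow> bool"
  where "Markov_chain M \<nu> K Y \<longleftrightarrow>
    prob_space M \<and>
    (\<forall>n. Y n \<in> M \<rightarrow>\<^sub>M borel) \<and>
    distr M borel (Y 0) = \<nu> \<and>
    (\<forall>h \<in> borel_measurable borel. bounded (range h) \<longrightarrow>
      (\<forall>n. AE \<omega> in M.
        real_cond_exp M (generated_algebra M Y {..n}) (\<lambda>\<omega>. h (Y (Suc n) \<omega>)) \<omega> =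
        (\<integral>y. h y \<partial>K (Y n \<omega>))))"


section \<open>Fluctuations and convergence in distribution\<close>

definition fluctuation ::
    "('a option \<Rightarrow> ('a option \<times> 'a option) measure) \<Rightarrow> (bool list \<Rightarrow> 'w \<Rightarrow> 'a option) \<Rightarrow>
     nat \<Rightarrow> ('a option \<times> 'a option \<times> 'a option \<Rightarrow> real) \<Rightarrow> 'w \<Rightarrow> real"
  where "fluctuation P X n f \<omega> =
    1 / sqrt (real (card (living_generation X n \<omega>))) *
    (\<Sum>i\<in>living_generation X n \<omega>. f (triple X i \<omega>) - kernel_op P f (X i \<omega>))"

definition limit_variance ::
    "('a option \<Rightarrow> ('a option \<times> 'a option) measure) \<Rightarrow> 'a measure \<Rightarrow>
     ('a option \<times> 'a option \<times> 'a option \<Rightarrow> real) \<Rightarrow> real"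
  where "limit_variance P \<mu> f =
    (\<integral>x. kernel_op P (\<lambda>u. (f u)\<^sup>2) (Some x) - (kernel_op P f (Some x))\<^sup>2 \<partial>\<mu>)"

text \<open>
  Convergence in distribution of \<open>V\<^sub>n\<close> (on \<open>M\<close>) to \<open>Z\<close> (on \<open>M'\<close>), as random elements of a
  topological space \<open>T\<close>.
\<close>

definition converges_in_distribution ::
    "'b topology \<Rightarrow> 'w measure \<Rightarrow> (nat \<Rightarrow> 'w \<Rightarrow> 'b) \<Rightarrow> 'v measure \<Rightarrow> ('v \<Rightarrow> 'b) \<Rightarrow> bool"
  where "converges_in_distribution T M V M' Z \<longleftrightarrow>
    (\<forall>\<phi>. continuous_map T euclideanreal \<phi> \<and> bounded (\<phi> ` topspace T) \<longrightarrow>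
      (\<lambda>n. \<integral>\<omega>. \<phi> (V n \<omega>) \<partial>M) \<longlonglongrightarrow> (\<integral>\<omega>. \<phi> (Z \<omega>) \<partial>M'))"

text \<open>\<open>\<real>\<^sup>d\<close>: the functions on \<open>{1..d}\<close>, extended by \<open>undefined\<close>, with the product topology.\<close>

abbreviation Rn :: "nat \<Rightarrow> (nat \<Rightarrow> real) topology"
  where "Rn d \<equiv> product_topology (\<lambda>_. euclideanreal) {1..d}"

end

theory Submission
  imports Defs
begin

text \<open>
  Given the first \<open>k\<close> generations, the triples of generation \<open>k\<close> are independent, so the conditional
  characteristic function of \<open>N\<^sub>k(f)\<close> is a product which differs from
  \<open>exp (- t\<^sup>2 V\<^sub>k / 2)\<close> by \<open>O(1 / sqrt Z\<^sub>k)\<close>, where \<open>Z\<^sub>k\<close> is the number of living individuals of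
  generation \<open>k\<close> and \<open>V\<^sub>k\<close> the average over them of the conditional variance of \<open>f\<close>. A law of large numbers
  gives \<open>V\<^sub>k \<longlonglongrightarrow> \<sigma>\<^sup>2\<close> on \<open>W \<noteq> 0\<close>: the sum of \<open>h\<close> over generation \<open>k + r\<close> is close to \<open>m\<^sup>r\<close> times
  the sum of \<open>Q\<^sup>r h\<close> over generation \<open>k\<close>, and \<open>Q\<^sup>r h\<close> converges by ergodicity. Survival up to
  generation \<open>k\<close> is asymptotically the event \<open>W \<noteq> 0\<close>, because \<open>P(W = 0)\<close> is the fixed point in \<open>[0, 1)\<close>
  of the offspring generating function. Since \<open>N\<^sub>n\<^sub>-\<^sub>1, \<dots>, N\<^sub>n\<^sub>-\<^sub>d\<^sub>+\<^sub>1\<close> are functions of the first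
  \<open>n\<close> generations, the coordinates are replaced by independent Gaussian variables one at a time.
\<close>

text \<open>The obstacle is that the limit is a mixture: the event \<open>W \<noteq> 0\<close> is
  not determined by any single \<open>\<F> k\<close>, while a conditional computation must be
  weighted by something \<open>\<F> k\<close>-measurable. Two indicators are therefore used side by
  side: survival up to generation k in the computations, and \<open>W \<noteq> 0\<close> as the
  event common to all generations; \<open>survival_swap\<close> exchanges them at a vanishing cost.
  Levy's theorem is applied to one real coordinate at a time: the test functions are products over
  the coordinates, the factors of older generations act as a bounded weight on the next one, and the
  weight is made part of a probability density. The error O(1 / sqrt Z_k) and the convergence of V_k
  are useful only where Z_k is of order m^k; populations with Z_k / m^k below a level \<delta> are
  bounded trivially, and \<delta> tends to 0 after k has tended to infinity. Pointwise convergence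
  of Q^r h suffices for the law of large numbers because k stays fixed while r grows, and generation
  k is a finite set.\<close>

section \<open>Convergence in distribution from products of coordinate functions\<close>

text \<open>Factors are continuous but may be unbounded, so that the coordinates themselves belong
  and separate points. Boundedness is restored later by multiplying with
  \<open>cutoff\<close>.\<close>

inductive_set product_sums :: "'i set \<Rightarrow> (('i \<Rightarrow> real) \<Rightarrow> real) set" for I where
  prod: "(\<And>i. i \<in> I \<Longrightarrow> continuous_on UNIV (e i)) \<Longrightarrow> (\<lambda>x. \<Prod>i\<in>I. e i (x i)) \<in> product_sums I"
| scale: "p \<in> product_sums I \<Longrightarrow> (\<lambda>x. c * p x) \<in> product_sums I"
| add: "p \<in> product_sums I \<Longrightarrow> q \<in> product_sums I \<Longrightarrow> (\<lambda>x. p x + q x) \<in> product_sums I"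

lemma product_sums_mult:
  assumes p: "p \<in> product_sums I" and q: "q \<in> product_sums I"
  shows "(\<lambda>x. p x * q x) \<in> product_sums I"
  using p
proof induction
  case (prod e)
  note e = prod
  show ?case using q
  proof induction
    case (prod e')
    have "(\<lambda>x. \<Prod>i\<in>I. e i (x i) * e' i (x i)) \<in> product_sums I"
      by (rule product_sums.prod[of I "\<lambda>i x. e i x * e' i x"])
        (intro continuous_on_mult e prod)
    then show ?case by (simp add: prod.distrib)
  next
    case (scale p c)
    then show ?case using product_sums.scale[of _ I c] by (simp add: mult.left_commute)
  next
    case (add p q)
    then show ?case using product_sums.add by (fastforce simp: distrib_left)
  qed
next
  case (scale p c)
  then show ?case using product_sums.scale[of _ I c] by (simp add: mult.assoc)
next
  case (add p q)
  then show ?case using product_sums.add by (fastforce simp: distrib_right)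
qed

lemma product_sums_const: "(\<lambda>_. c) \<in> product_sums I"
  using product_sums.scale[OF product_sums.prod[of I "\<lambda>_ _. 1"], of c] by simp

lemma product_sums_coordinate:
  assumes "finite I" "i \<in> I"
  shows "(\<lambda>x. x i) \<in> product_sums I"
proof -
  have "(\<lambda>x. \<Prod>j\<in>I. (if j = i then x j else 1)) \<in> product_sums I"
  proof (rule product_sums.prod[of I "\<lambda>j y. if j = i then y else 1"])
    show "continuous_on UNIV (\<lambda>y. if j = i then y else 1)" for j
      by (cases "j = i") auto
  qed
  moreover have "(\<Prod>j\<in>I. (if j = i then x j else 1)) = x i" for x :: "'a \<Rightarrow> real"
    using assms by (simp add: prod.delta)
  ultimately show ?thesis by simp
qed

lemma continuous_on_product_sums:
  assumes "p \<in> product_sums I"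
  shows "continuous_on UNIV p"
  using assms
proof induction
  case (prod e)
  have "continuous_on UNIV (\<lambda>x. e i (x i))" if "i \<in> I" for i
    by (intro continuous_on_compose2[OF prod[OF that]] continuous_on_product_coordinates) auto
  then show ?case by (intro continuous_on_prod)
qed (auto intro: continuous_intros)

lemma product_sums_approximate:
  fixes \<phi> :: "('i::countable \<Rightarrow> real) \<Rightarrow> real"
  assumes I: "finite I" and \<phi>: "continuous_on UNIV \<phi>" and \<epsilon>: "\<epsilon> > 0"
  shows "\<exists>p \<in> product_sums I. \<forall>x \<in> extensional I. (\<forall>i\<in>I. \<bar>x i\<bar> \<le> r) \<longrightarrow> \<bar>\<phi> x - p x\<bar> < \<epsilon>"
proof -
  \<comment> \<open>Coordinates outside \<open>I\<close> are pinned to \<open>undefined\<close>: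
    \<open>S\<close> is still a product of compact sets, it contains every extensional point whose
    coordinates are bounded by \<open>r\<close>, and two distinct points of it differ at an index in
    \<open>I\<close>.\<close>
  define S where "S = (\<Pi>\<^sub>E i\<in>UNIV. if i \<in> I then {-r..r} else {undefined :: real})"
  have S: "compact S"
  proof -
    have "compactin (product_topology (\<lambda>i. euclidean) UNIV) S"
      unfolding S_def compactin_PiE by auto
    then show ?thesis by (simp add: euclidean_product_topology)
  qed
  have "\<exists>p. p \<in> product_sums I \<and> (\<forall>x \<in> S. \<bar>\<phi> x - p x\<bar> < \<epsilon>)"
  proof (rule Stone_Weierstrass_HOL[where P="\<lambda>p. p \<in> product_sums I" and S=S and e=\<epsilon>])
    fix x y :: "'i \<Rightarrow> real"
    assume xy: "x \<in> S \<and> y \<in> S \<and> x \<noteq> y"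
    then obtain i where i: "x i \<noteq> y i" by auto
    have "z i = undefined" if "z \<in> S" "i \<notin> I" for z
      using that by (auto simp: S_def PiE_iff dest!: spec[of _ i])
    with xy i have "i \<in> I" by metis
    then show "\<exists>p. p \<in> product_sums I \<and> p x \<noteq> p y"
      using product_sums_coordinate[OF I] i by blast
  next
    show "continuous_on S \<phi>" using \<phi> continuous_on_subset by blast
  qed (auto intro: S \<epsilon> product_sums_const product_sums_mult product_sums.add
      continuous_on_subset[OF continuous_on_product_sums])
  moreover have "x \<in> S" if "x \<in> extensional I" "\<forall>i\<in>I. \<bar>x i\<bar> \<le> r" for x
    using that by (auto simp: S_def PiE_iff extensional_def abs_le_iff minus_le_iff)
  ultimately show ?thesis by blast
qed

text \<open>Writing \<phi> - p \<kappa> as \<phi> (1 - \<kappa>) + (\<phi> - p) \<kappa> separates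
  the mass lost by the truncation from the approximation error, which counts only where \<kappa>
  does not vanish.\<close>

lemma abs_integral_approximation:
  fixes \<phi> p \<kappa> :: "'b \<Rightarrow> real" and U :: "'w \<Rightarrow> 'b"
  assumes N: "prob_space N"
    and meas: "(\<lambda>w. \<phi> (U w)) \<in> borel_measurable N" "(\<lambda>w. p (U w)) \<in> borel_measurable N"
      "(\<lambda>w. \<kappa> (U w)) \<in> borel_measurable N"
    and \<phi>: "\<And>w. \<bar>\<phi> (U w)\<bar> \<le> B" and \<kappa>: "\<And>w. 0 \<le> \<kappa> (U w)" "\<And>w. \<kappa> (U w) \<le> 1"
    and approx: "\<And>w. \<kappa> (U w) \<noteq> 0 \<Longrightarrow> \<bar>\<phi> (U w) - p (U w)\<bar> \<le> \<epsilon>" and \<epsilon>: "\<epsilon> \<ge> 0"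
  shows "\<bar>(\<integral>w. \<phi> (U w) \<partial>N) - (\<integral>w. p (U w) * \<kappa> (U w) \<partial>N)\<bar> \<le> B * (1 - (\<integral>w. \<kappa> (U w) \<partial>N)) + \<epsilon>"
proof -
  let ?d = "\<lambda>w. \<phi> (U w) - p (U w) * \<kappa> (U w)"
  interpret prob_space N by fact
  note [measurable] = meas
  have B: "B \<ge> 0" using \<phi> abs_ge_zero order_trans by blast
  have *: "\<bar>?d w\<bar> \<le> B * (1 - \<kappa> (U w)) + \<epsilon>" for w
  proof -
    have "?d w = \<phi> (U w) * (1 - \<kappa> (U w)) + (\<phi> (U w) - p (U w)) * \<kappa> (U w)"
      by (simp add: algebra_simps)
    also have "\<bar>\<dots>\<bar> \<le> \<bar>\<phi> (U w)\<bar> * (1 - \<kappa> (U w)) + \<bar>\<phi> (U w) - p (U w)\<bar> * \<kappa> (U w)"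
      using \<kappa>[of w] by (intro order_trans[OF abs_triangle_ineq]) (simp add: abs_mult)
    also have "\<dots> \<le> B * (1 - \<kappa> (U w)) + \<epsilon>"
    proof (rule add_mono)
      show "\<bar>\<phi> (U w)\<bar> * (1 - \<kappa> (U w)) \<le> B * (1 - \<kappa> (U w))"
        using \<phi> \<kappa> by (intro mult_right_mono) auto
      show "\<bar>\<phi> (U w) - p (U w)\<bar> * \<kappa> (U w) \<le> \<epsilon>"
      proof (cases "\<kappa> (U w) = 0")
        case False
        then have "\<bar>\<phi> (U w) - p (U w)\<bar> * \<kappa> (U w) \<le> \<epsilon> * 1"
          using approx[of w] \<kappa>[of w] \<epsilon> by (intro mult_mono) auto
        then show ?thesis by simp
      qed (use \<epsilon> in simp)
    qed
    finally show ?thesis .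
  qed
  have i\<kappa>: "integrable N (\<lambda>w. \<kappa> (U w))"
    by (rule integrable_const_bound[of _ 1]) (use \<kappa> in auto)
  have i\<phi>: "integrable N (\<lambda>w. \<phi> (U w))"
    by (rule integrable_const_bound[of _ B]) (use \<phi> in auto)
  have ip: "integrable N (\<lambda>w. p (U w) * \<kappa> (U w))"
  \<comment> \<open>No bound on \<open>p\<close> is assumed; one for the truncated \<open>p\<close>
    follows from the bounds on \<phi> and on the difference \<open>?d\<close>.\<close>
  proof (rule integrable_const_bound[of _ "2 * B + \<epsilon>"])
    show "AE w in N. norm (p (U w) * \<kappa> (U w)) \<le> 2 * B + \<epsilon>"
    proof (rule AE_I2)
      fix w
      have "B * (1 - \<kappa> (U w)) \<le> B * 1" using \<kappa>[of w] B by (intro mult_left_mono) auto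
      with *[of w] \<phi>[of w] show "norm (p (U w) * \<kappa> (U w)) \<le> 2 * B + \<epsilon>" by simp
    qed
  qed simp
  have "\<bar>(\<integral>w. \<phi> (U w) \<partial>N) - (\<integral>w. p (U w) * \<kappa> (U w) \<partial>N)\<bar>
      = \<bar>\<integral>w. ?d w \<partial>N\<bar>"
    using i\<phi> ip by simp
  also have "\<dots> \<le> (\<integral>w. \<bar>?d w\<bar> \<partial>N)"
    by (rule integral_abs_bound)
  also have "\<dots> \<le> (\<integral>w. B * (1 - \<kappa> (U w)) + \<epsilon> \<partial>N)"
    using * i\<phi> ip i\<kappa> by (intro integral_mono) auto
  also have "\<dots> = B * (1 - (\<integral>w. \<kappa> (U w) \<partial>N)) + \<epsilon>"
    using i\<kappa> by (simp add: prob_space algebra_simps)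
  finally show ?thesis .
qed

text \<open>Continuous instead of an indicator, so that multiplying by it turns a continuous factor
  into a bounded continuous one. It equals 1 where \<open>\<bar>x\<bar> \<le> r - 1\<close>, whence
  the pointwise limit 1 as \<open>r\<close> grows.\<close>

definition cutoff :: "real \<Rightarrow> real \<Rightarrow> real"
  where "cutoff r x = max 0 (min 1 (r - \<bar>x\<bar>))"

lemma continuous_on_cutoff: "continuous_on A (cutoff r)"
  unfolding cutoff_def by (intro continuous_intros)

lemma cutoff_bounds: "0 \<le> cutoff r x" "cutoff r x \<le> 1"
  by (auto simp: cutoff_def)

lemma cutoff_nonzeroD: "cutoff r x \<noteq> 0 \<Longrightarrow> \<bar>x\<bar> \<le> r"
  by (auto simp: cutoff_def max_def min_def split: if_splits)

lemma cutoff_tendsto_1: "(\<lambda>k. cutoff (real k) x) \<longlonglongrightarrow> 1"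
proof (rule tendsto_eventually)
  obtain N :: nat where "\<bar>x\<bar> + 1 \<le> real N" using real_arch_simple by blast
  then show "\<forall>\<^sub>F k in sequentially. cutoff (real k) x = 1"
    by (intro eventually_sequentiallyI[of N]) (auto simp: cutoff_def)
qed

lemma bounded_range_mult_cutoff:
  fixes e :: "real \<Rightarrow> real"
  assumes "continuous_on UNIV e"
  shows "bounded (range (\<lambda>x. e x * cutoff r x))"
proof -
  have "compact (e ` {-r..r})"
    using assms by (intro compact_continuous_image continuous_on_subset[OF assms]) auto
  then have "bounded (e ` {-r..r})" by (rule compact_imp_bounded)
  then obtain b where b: "\<And>x. x \<in> {-r..r} \<Longrightarrow> \<bar>e x\<bar> \<le> b"
    by (auto simp: bounded_iff simp del: atLeastAtMost_iff)
  have "\<bar>e x * cutoff r x\<bar> \<le> max b 0" for x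
  proof (cases "cutoff r x = 0")
    case False
    then have "\<bar>e x\<bar> \<le> b" using cutoff_nonzeroD[OF False] by (intro b) auto
    then have "\<bar>e x\<bar> * cutoff r x \<le> b * 1"
      using cutoff_bounds[of r x] by (intro mult_mono) auto
    then show ?thesis using cutoff_bounds[of r x] by (simp add: abs_mult)
  qed simp
  then show ?thesis by (auto simp: bounded_iff)
qed

text \<open>Products of cutoffs give tightness, and by Stone--Weierstrass the sums of products are dense
  on boxes.\<close>

lemma converges_in_distribution_products:
  fixes V :: "nat \<Rightarrow> 'w \<Rightarrow> 'i::countable \<Rightarrow> real" and Z :: "'v \<Rightarrow> 'i \<Rightarrow> real"
  assumes M: "prob_space M" and M': "prob_space M'" and I: "finite I"
    and V: "\<And>n i. i \<in> I \<Longrightarrow> (\<lambda>w. V n w i) \<in> borel_measurable M" "\<And>n w. V n w \<in> extensional I"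
    and Z: "\<And>i. i \<in> I \<Longrightarrow> (\<lambda>w. Z w i) \<in> borel_measurable M'" "\<And>w. Z w \<in> extensional I"
    and conv: "\<And>e :: 'i \<Rightarrow> real \<Rightarrow> real. (\<And>i. i \<in> I \<Longrightarrow> continuous_on UNIV (e i)) \<Longrightarrow> (\<And>i. i \<in> I \<Longrightarrow> bounded (range (e i))) \<Longrightarrow>
      (\<lambda>n. \<integral>w. (\<Prod>i\<in>I. e i (V n w i)) \<partial>M) \<longlonglongrightarrow> (\<integral>w. (\<Prod>i\<in>I. e i (Z w i)) \<partial>M')"
  shows "converges_in_distribution (product_topology (\<lambda>_. euclideanreal) I) M V M' Z"
  unfolding converges_in_distribution_def
proof (intro allI impI, elim conjE)
  fix \<phi> :: "('i \<Rightarrow> real) \<Rightarrow> real"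
  assume \<phi>: "continuous_map (product_topology (\<lambda>_. euclideanreal) I) euclideanreal \<phi>"
    and bdd: "bounded (\<phi> ` topspace (product_topology (\<lambda>_. euclideanreal) I))"
  obtain B where B: "\<And>x. x \<in> extensional I \<Longrightarrow> \<bar>\<phi> x\<bar> \<le> B"
    using bdd by (auto simp: bounded_iff PiE_def)
  have "(\<lambda>_. undefined) \<in> extensional I" by (simp add: extensional_def)
  from B[OF this] have B0: "B \<ge> 0" by linarith
  \<comment> \<open>The test function is continuous on extensional functions only. Composing with
    \<open>restrict\<close> extends it to the whole function space, where continuity yields Borel
    measurability.\<close>
  define \<phi>' where "\<phi>' x = \<phi> (restrict x I)" for x
  have \<phi>': "\<phi>' x = \<phi> x" if "x \<in> extensional I" for x
    using that by (simp add: \<phi>'_def extensional_restrict)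
  have \<phi>'_bound: "\<bar>\<phi>' x\<bar> \<le> B" for x
    using B by (simp add: \<phi>'_def)
  have cont: "continuous_on UNIV \<phi>'"
  proof -
    have "continuous_map (product_topology (\<lambda>_. euclideanreal) UNIV)
        (product_topology (\<lambda>_. euclideanreal) I) (\<lambda>x. restrict x I)"
      by (auto simp: continuous_map_componentwise intro: continuous_map_product_projection)
    from continuous_map_compose[OF this \<phi>] show ?thesis
      by (simp add: \<phi>'_def[abs_def] comp_def euclidean_product_topology)
  qed
  have [measurable]: "\<phi>' \<in> borel_measurable borel"
    by (rule borel_measurable_continuous_onI[OF cont])
  have [measurable]: "V n \<in> measurable M borel" for n
  proof (rule measurable_coordinatewise_then_product)
    fix i show "(\<lambda>w. V n w i) \<in> borel_measurable M"
      using V by (cases "i \<in> I") (auto simp: extensional_def)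
  qed
  have [measurable]: "Z \<in> measurable M' borel"
  proof (rule measurable_coordinatewise_then_product)
    fix i show "(\<lambda>w. Z w i) \<in> borel_measurable M'"
      using Z by (cases "i \<in> I") (auto simp: extensional_def)
  qed
  interpret M: prob_space M by fact
  interpret M': prob_space M' by fact
  define \<kappa> where "\<kappa> r x = (\<Prod>i\<in>I. cutoff r (x i))" for r and x :: "'i \<Rightarrow> real"
  have \<kappa>_ps: "\<kappa> r \<in> product_sums I" for r
    unfolding \<kappa>_def[abs_def] by (intro product_sums.prod continuous_on_cutoff)
  have meas: "p \<in> borel_measurable borel" if "p \<in> product_sums I" for p :: "('i \<Rightarrow> real) \<Rightarrow> real"
    by (rule borel_measurable_continuous_onI[OF continuous_on_product_sums[OF that]])
  note [measurable] = meas[OF \<kappa>_ps]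
  have \<kappa>01: "0 \<le> \<kappa> r x" "\<kappa> r x \<le> 1" for r x
    by (auto simp: \<kappa>_def cutoff_bounds intro!: prod_nonneg prod_le_1)
  have \<kappa>_nz: "\<bar>x i\<bar> \<le> r" if "\<kappa> r x \<noteq> 0" "i \<in> I" for r x i
    using that cutoff_nonzeroD I by (auto simp: \<kappa>_def)
  let ?v = "\<lambda>p r n. \<integral>w. p (V n w) * \<kappa> r (V n w) \<partial>M"
  let ?z = "\<lambda>p r. \<integral>w. p (Z w) * \<kappa> r (Z w) \<partial>M'"
  have conv_p: "(\<exists>b. \<forall>x. \<bar>p x * \<kappa> r x\<bar> \<le> b) \<and>
      (\<lambda>n. ?v p r n) \<longlonglongrightarrow> ?z p r"
    if "p \<in> product_sums I" for p r
    using that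
  proof induction
    case (prod e)
    have eq: "(\<Prod>i\<in>I. e i (x i)) * \<kappa> r x = (\<Prod>i\<in>I. e i (x i) * cutoff r (x i))" for x
      by (simp add: \<kappa>_def prod.distrib)
    have bd: "bounded (range (\<lambda>x. e i x * cutoff r x))" if "i \<in> I" for i
      using bounded_range_mult_cutoff[OF prod[OF that]] .
    have "\<forall>i\<in>I. \<exists>b. \<forall>x. \<bar>e i x * cutoff r x\<bar> \<le> b"
      using bd by (auto simp: bounded_iff)
    then obtain b where b: "\<And>i x. i \<in> I \<Longrightarrow> \<bar>e i x * cutoff r x\<bar> \<le> b i" by metis
    have "\<bar>\<Prod>i\<in>I. e i (x i) * cutoff r (x i)\<bar> \<le> (\<Prod>i\<in>I. b i)" for x
      unfolding abs_prod using b by (intro prod_mono) auto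
    moreover have "(\<lambda>n. \<integral>w. (\<Prod>i\<in>I. e i (V n w i) * cutoff r (V n w i)) \<partial>M)
      \<longlonglongrightarrow> (\<integral>w. (\<Prod>i\<in>I. e i (Z w i) * cutoff r (Z w i)) \<partial>M')"
      by (rule conv[of "\<lambda>i x. e i x * cutoff r x"])
        (auto intro!: continuous_on_mult prod continuous_on_cutoff bd)
    ultimately show ?case unfolding eq by blast
  next
    case (scale p c)
    then obtain b where b: "\<forall>x. \<bar>p x * \<kappa> r x\<bar> \<le> b" by blast
    have "\<bar>c * p x * \<kappa> r x\<bar> \<le> \<bar>c\<bar> * b" for x
      using b[rule_format, of x] by (simp add: mult.assoc abs_mult mult_left_mono)
    then show ?case using scale by (auto simp: mult.assoc intro!: tendsto_intros)
  next
    case (add p q)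
    then obtain b b' where b: "\<forall>x. \<bar>p x * \<kappa> r x\<bar> \<le> b" "\<forall>x. \<bar>q x * \<kappa> r x\<bar> \<le> b'" by blast
    note [measurable] = meas[OF add(1)] meas[OF add(2)]
    have "\<bar>(p x + q x) * \<kappa> r x\<bar> \<le> b + b'" for x
      unfolding distrib_right using b by (intro order_trans[OF abs_triangle_ineq] add_mono) auto
    moreover have "integrable M (\<lambda>w. p (V n w) * \<kappa> r (V n w))" for n
      using b(1) by (intro M.integrable_const_bound[of _ b]) auto
    moreover have "integrable M (\<lambda>w. q (V n w) * \<kappa> r (V n w))" for n
      using b(2) by (intro M.integrable_const_bound[of _ b']) auto
    moreover have "integrable M' (\<lambda>w. p (Z w) * \<kappa> r (Z w))"
      using b(1) by (intro M'.integrable_const_bound[of _ b]) auto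
    moreover have "integrable M' (\<lambda>w. q (Z w) * \<kappa> r (Z w))"
      using b(2) by (intro M'.integrable_const_bound[of _ b']) auto
    ultimately show ?case
      using add.IH by (auto simp: distrib_right intro!: tendsto_add)
  qed
  have conv_\<kappa>: "(\<lambda>n. \<integral>w. \<kappa> r (V n w) \<partial>M) \<longlonglongrightarrow> (\<integral>w. \<kappa> r (Z w) \<partial>M')" for r
    using conv_p[of "\<lambda>_. 1" r] product_sums_const[of 1 I] by simp
  have tight: "(\<lambda>k. \<integral>w. \<kappa> (real k) (Z w) \<partial>M') \<longlonglongrightarrow> (\<integral>w. 1 \<partial>M')"
  proof (rule integral_dominated_convergence[where w="\<lambda>_. 1"])
    show "AE w in M'. (\<lambda>k. \<kappa> (real k) (Z w)) \<longlonglongrightarrow> 1"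
    proof (rule AE_I2)
      fix w
      have "(\<lambda>k. \<kappa> (real k) (Z w)) \<longlonglongrightarrow> (\<Prod>i\<in>I. 1)"
        unfolding \<kappa>_def by (intro tendsto_prod cutoff_tendsto_1)
      then show "(\<lambda>k. \<kappa> (real k) (Z w)) \<longlonglongrightarrow> 1" by simp
    qed
  qed (use \<kappa>01 in auto)
  show "(\<lambda>n. \<integral>w. \<phi> (V n w) \<partial>M) \<longlonglongrightarrow> (\<integral>w. \<phi> (Z w) \<partial>M')"
  proof (rule LIMSEQ_I)
    fix \<epsilon> :: real assume \<epsilon>: "\<epsilon> > 0"
    \<comment> \<open>The two approximations cost \<open>B * \<delta> + \<delta>\<close> each and
      the convergence of the truncated integrals another \<delta>:
      \<open>(2 * B + 3) * \<delta>\<close> in all. The 4 makes the inequality strict.\<close>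
    define \<delta> where "\<delta> = \<epsilon> / (2 * B + 4)"
    have \<delta>: "\<delta> > 0" "\<delta> * (2 * B + 4) = \<epsilon>" using \<epsilon> B0 by (auto simp: \<delta>_def)
    \<comment> \<open>The limit loses less than \<open>\<delta>/2\<close> through the truncation,
      which leaves room for the \<open>V n\<close> to lose less than \<delta> eventually.\<close>
    have "\<forall>\<^sub>F k in sequentially. 1 - \<delta>/2 < (\<integral>w. \<kappa> (real k) (Z w) \<partial>M')"
      using tight \<delta> by (intro order_tendstoD) (auto simp: M'.prob_space)
    then obtain k where "1 - \<delta>/2 < (\<integral>w. \<kappa> (real k) (Z w) \<partial>M')"
      using eventually_happens'[OF sequentially_bot] by auto
    then obtain r where r: "1 - \<delta>/2 < (\<integral>w. \<kappa> r (Z w) \<partial>M')" by blast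
    obtain p where p: "p \<in> product_sums I"
      and approx: "\<And>x. x \<in> extensional I \<Longrightarrow> (\<forall>i\<in>I. \<bar>x i\<bar> \<le> r) \<Longrightarrow> \<bar>\<phi>' x - p x\<bar> < \<delta>"
      using product_sums_approximate[OF I cont \<delta>(1)] by blast
    note [measurable] = meas[OF p]
    have "\<bar>(\<integral>w. \<phi>' (V n w) \<partial>M) - ?v p r n\<bar> \<le> B * (1 - (\<integral>w. \<kappa> r (V n w) \<partial>M)) + \<delta>" for n
      using \<kappa>_nz \<delta>(1) by (intro abs_integral_approximation M \<kappa>01 \<phi>'_bound less_imp_le[OF approx] V(2)) auto
    then have 1: "\<bar>(\<integral>w. \<phi> (V n w) \<partial>M) - ?v p r n\<bar> \<le> B * (1 - (\<integral>w. \<kappa> r (V n w) \<partial>M)) + \<delta>" for n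
      by (simp add: \<phi>' V(2))
    have "\<bar>(\<integral>w. \<phi>' (Z w) \<partial>M') - ?z p r\<bar> \<le> B * (1 - (\<integral>w. \<kappa> r (Z w) \<partial>M')) + \<delta>"
      using \<kappa>_nz \<delta>(1) by (intro abs_integral_approximation M' \<kappa>01 \<phi>'_bound less_imp_le[OF approx] Z(2)) auto
    also have "\<dots> \<le> B * \<delta> + \<delta>"
      using r B0 \<delta> by (intro add_mono mult_left_mono) auto
    finally have 2: "\<bar>(\<integral>w. \<phi> (Z w) \<partial>M') - ?z p r\<bar> \<le> B * \<delta> + \<delta>"
      by (simp add: \<phi>' Z(2))
    have "\<forall>\<^sub>F n in sequentially. 1 - \<delta> < (\<integral>w. \<kappa> r (V n w) \<partial>M)"
      using r \<delta> by (intro order_tendstoD(1)[OF conv_\<kappa>[of r]]) auto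
    moreover have "\<forall>\<^sub>F n in sequentially. dist (?v p r n) (?z p r) < \<delta>"
      using conv_p[OF p, of r] \<delta> by (intro tendstoD) auto
    ultimately have "\<forall>\<^sub>F n in sequentially. norm ((\<integral>w. \<phi> (V n w) \<partial>M) - (\<integral>w. \<phi> (Z w) \<partial>M')) < \<epsilon>"
    proof eventually_elim
      case (elim n)
      have "B * (1 - (\<integral>w. \<kappa> r (V n w) \<partial>M)) \<le> B * \<delta>"
        using elim B0 by (intro mult_left_mono) auto
      moreover have "B * \<delta> + \<delta> + (B * \<delta> + \<delta>) + \<delta> < \<epsilon>"
        using \<delta> by (simp add: algebra_simps)
      ultimately show ?case using elim 1[of n] 2 by (auto simp: dist_real_def)
    qed
    then show "\<exists>N. \<forall>n\<ge>N. norm ((\<integral>w. \<phi> (V n w) \<partial>M) - (\<integral>w. \<phi> (Z w) \<partial>M')) < \<epsilon>"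
      by (simp add: eventually_sequentially)
  qed
qed

section \<open>The branching property\<close>

type_synonym 'a family = "'a option \<times> 'a option \<times> 'a option"

lemma finite_generation [simp]: "finite (generation k)"
  using finite_lists_length_eq[of "UNIV :: bool set" k] by (simp add: generation_def)

lemma generation_0: "generation 0 = {[]}"
  by (auto simp: generation_def)

lemma space_generated_algebra [simp]: "space (generated_algebra M X J) = space M"
  by (simp add: generated_algebra_def space_measure_of_conv)

lemma sets_generated_algebra:
  "sets (generated_algebra M X J) = sigma_sets (space M) (\<Union>j\<in>J. {X j -` A \<inter> space M |A. A \<in> sets borel})"
  unfolding generated_algebra_def by (rule sets_measure_of) auto

lemma subalgebra_generated_algebra:
  assumes "\<And>j. j \<in> J \<Longrightarrow> X j \<in> M \<rightarrow>\<^sub>M borel"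
  shows "subalgebra M (generated_algebra M X J)"
proof -
  have "(\<Union>j\<in>J. {X j -` A \<inter> space M |A. A \<in> sets borel}) \<subseteq> sets M"
    using assms by (auto intro: measurable_sets)
  from sets.sigma_sets_subset[OF this] show ?thesis
    unfolding subalgebra_def sets_generated_algebra by simp
qed

lemma measurable_generated_algebra:
  fixes X :: "'i \<Rightarrow> 'w \<Rightarrow> 'b::topological_space"
  assumes "j \<in> J"
  shows "X j \<in> generated_algebra M X J \<rightarrow>\<^sub>M borel"
proof (rule measurableI)
  fix A :: "'b set" assume "A \<in> sets borel"
  then show "X j -` A \<inter> space (generated_algebra M X J) \<in> sets (generated_algebra M X J)"
    using assms unfolding sets_generated_algebra space_generated_algebra
    by (intro sigma_sets.Basic) auto
qed simp

locale BMC =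
  fixes M :: "'w measure" and \<nu> :: "'a::topological_space option measure"
    and P :: "'a option \<Rightarrow> ('a option \<times> 'a option) measure"
    and X :: "bool list \<Rightarrow> 'w \<Rightarrow> 'a option"
  assumes kernel: "bifurcating_kernel P"
    and BMC: "bifurcating_Markov_chain M \<nu> P X"
begin

sublocale prob_space M
  using BMC by (simp add: bifurcating_Markov_chain_def)

abbreviation \<F> :: "nat \<Rightarrow> 'w measure"
  where "\<F> k \<equiv> generated_algebra M X (tree_upto k)"

lemma measurable_X [measurable]: "X i \<in> M \<rightarrow>\<^sub>M borel"
  using BMC by (simp add: bifurcating_Markov_chain_def)

lemma measurable_triple [measurable]: "triple X i \<in> M \<rightarrow>\<^sub>M triple_borel"
  unfolding triple_def[abs_def] by measurable

lemma measurable_kernel [measurable]: "P \<in> borel \<rightarrow>\<^sub>M subprob_algebra (borel \<Otimes>\<^sub>M borel)"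
  using kernel by (auto simp: bifurcating_kernel_def intro: measurable_prob_algebraD)

text \<open>The integral of \<open>kernel_op\<close> for values in a Banach space: characteristic
  functions are complex.\<close>

abbreviation kernel_int :: "('a family \<Rightarrow> 'b::{banach, second_countable_topology}) \<Rightarrow> 'a option \<Rightarrow> 'b"
  where "kernel_int g x \<equiv> \<integral>v. g (x, v) \<partial>P x"

lemma prob_space_kernel: "prob_space (P x)"
  and sets_kernel [measurable_cong, simp]: "sets (P x) = sets (borel \<Otimes>\<^sub>M borel)"
  using kernel measurable_space[of P borel "prob_algebra (borel \<Otimes>\<^sub>M borel)" x]
  by (auto simp: bifurcating_kernel_def space_prob_algebra)

lemma space_kernel [simp]: "space (P x) = UNIV"
  using sets_eq_imp_space_eq[OF sets_kernel[of x]] by (simp add: space_pair_measure)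

text \<open>The image of \<open>P x\<close> under \<open>\<lambda>v. (x, v)\<close> is a kernel into
  the triple space, and integrals against a kernel are measurable in its parameter.\<close>

lemma measurable_kernel_integral:
  fixes g :: "'a family \<Rightarrow> 'b::{banach, second_countable_topology}"
  assumes [measurable]: "g \<in> borel_measurable triple_borel"
  shows "kernel_int g \<in> borel_measurable borel"
proof -
  have "(\<lambda>x. distr (P x) triple_borel (\<lambda>v. (x, v))) \<in> borel \<rightarrow>\<^sub>M subprob_algebra triple_borel"
    by (rule measurable_distr2[of _ _ "borel \<Otimes>\<^sub>M borel"]) auto
  from measurable_compose[OF this integral_measurable_subprob_algebra[of g]]
  have "(\<lambda>x. integral\<^sup>L (distr (P x) triple_borel (\<lambda>v. (x, v))) g) \<in> borel_measurable borel"
    by simp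
  moreover have "integral\<^sup>L (distr (P x) triple_borel (\<lambda>v. (x, v))) g = kernel_int g x" for x
    by (subst integral_distr) auto
  ultimately show ?thesis by simp
qed

lemma measurable_kernel_op [measurable]:
  "g \<in> borel_measurable triple_borel \<Longrightarrow> kernel_op P g \<in> borel_measurable borel"
  unfolding kernel_op_def[abs_def] by (rule measurable_kernel_integral)

lemma integrable_kernel:
  fixes g :: "'a family \<Rightarrow> 'b::{banach, second_countable_topology}"
  assumes [measurable]: "g \<in> borel_measurable triple_borel" and b: "\<And>u. norm (g u) \<le> b"
  shows "integrable (P x) (\<lambda>v. g (x, v))"
  by (rule finite_measure.integrable_const_bound[of _ _ b])
    (use prob_space_kernel prob_space.axioms(1) b in \<open>auto\<close>)

lemma norm_kernel_integral_le:
  fixes g :: "'a family \<Rightarrow> 'b::{banach, second_countable_topology}"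
  assumes g [measurable]: "g \<in> borel_measurable triple_borel" and b: "\<And>u. norm (g u) \<le> b"
  shows "norm (kernel_int g x) \<le> b"
proof -
  interpret P: prob_space "P x" by (rule prob_space_kernel)
  have "norm (kernel_int g x) \<le> (\<integral>v. norm (g (x, v)) \<partial>P x)"
    by (rule integral_norm_bound)
  also have "\<dots> \<le> (\<integral>v. b \<partial>P x)"
    using integrable_kernel[OF g b] b by (intro integral_mono) auto
  finally show ?thesis using P.prob_space by simp
qed

lemma abs_kernel_op_le:
  "g \<in> borel_measurable triple_borel \<Longrightarrow> (\<And>u. \<bar>g u\<bar> \<le> b) \<Longrightarrow> \<bar>kernel_op P g x\<bar> \<le> b"
  using norm_kernel_integral_le[of g b x] by (simp add: kernel_op_def)

lemma AE_kernel_None: "AE v in P None. v = (None, None)"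
proof -
  interpret P: prob_space "P None" by (rule prob_space_kernel)
  have "{(None, None)} = {None :: 'a option} \<times> {None :: 'a option}" by auto
  also have "\<dots> \<in> sets (borel \<Otimes>\<^sub>M borel)"
    using borel_open[OF open_None] by (intro pair_measureI)
  finally have "{(None, None)} \<in> sets (P None)" by simp
  from P.prob_eq_1[OF this] kernel show ?thesis
    by (simp add: bifurcating_kernel_def)
qed

lemma kernel_op_None:
  assumes [measurable]: "g \<in> borel_measurable triple_borel"
  shows "kernel_op P g None = g (None, None, None)"
proof -
  interpret P: prob_space "P None" by (rule prob_space_kernel)
  have "kernel_op P g None = (\<integral>v. g (None, None, None) \<partial>P None)"
    unfolding kernel_op_def using AE_kernel_None by (intro integral_cong_AE) auto
  then show ?thesis using P.prob_space by simp
qed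

lemma subalgebra_\<F>: "subalgebra M (\<F> k)"
  by (rule subalgebra_generated_algebra) simp

lemma measurable_X_\<F>:
  assumes "length i \<le> k"
  shows "X i \<in> \<F> k \<rightarrow>\<^sub>M borel"
  using assms by (intro measurable_generated_algebra) (auto simp: tree_upto_def generation_def)

lemma measurable_triple_\<F>:
  "length i < k \<Longrightarrow> triple X i \<in> \<F> k \<rightarrow>\<^sub>M triple_borel"
  unfolding triple_def[abs_def] by (intro measurable_Pair measurable_X_\<F>) auto

lemma measurable_from_\<F>: "f \<in> \<F> k \<rightarrow>\<^sub>M N \<Longrightarrow> f \<in> M \<rightarrow>\<^sub>M N"
  by (rule measurable_from_subalg[OF subalgebra_\<F>])

text \<open>The conditional identity tested against a bounded \<open>\<F> k\<close>-measurable
  weight. In this form the Markov property of \<open>X\<close> is used throughout, free of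
  conditional expectations.\<close>

lemma Markov_product:
  assumes \<Psi>: "\<Psi> \<in> borel_measurable (\<F> k)" "\<And>w. \<bar>\<Psi> w\<bar> \<le> b"
    and g: "\<And>i. g i \<in> borel_measurable triple_borel" "\<And>i. bounded (range (g i))"
  shows "(\<integral>w. \<Psi> w * (\<Prod>i\<in>generation k. g i (triple X i w)) \<partial>M) =
    (\<integral>w. \<Psi> w * (\<Prod>i\<in>generation k. kernel_op P (g i) (X i w)) \<partial>M)"
proof -
  interpret finite_measure_subalgebra M "\<F> k"
    by unfold_locales (rule subalgebra_\<F>)
  note [measurable] = g(1) measurable_from_\<F>[OF \<Psi>(1)]
  obtain c where c: "\<And>i u. \<bar>g i u\<bar> \<le> c i"
    using g(2) unfolding bounded_iff by (metis UNIV_I image_eqI real_norm_def)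
  have "\<bar>\<Psi> w * (\<Prod>i\<in>generation k. g i (triple X i w))\<bar> \<le> b * (\<Prod>i\<in>generation k. c i)" for w
    unfolding abs_mult abs_prod
  proof (rule mult_mono)
    show "0 \<le> b" using \<Psi>(2)[of w] by linarith
  qed (auto intro!: prod_mono prod_nonneg \<Psi> c)
  then have "integrable M (\<lambda>w. \<Psi> w * (\<Prod>i\<in>generation k. g i (triple X i w)))"
    by (intro integrable_const_bound) auto
  then have "(\<integral>w. \<Psi> w * (\<Prod>i\<in>generation k. g i (triple X i w)) \<partial>M) =
    (\<integral>w. \<Psi> w * real_cond_exp M (\<F> k) (\<lambda>w. \<Prod>i\<in>generation k. g i (triple X i w)) w \<partial>M)"
    by (intro real_cond_exp_intg(2)[symmetric] \<Psi>) auto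
  also have "\<dots> = (\<integral>w. \<Psi> w * (\<Prod>i\<in>generation k. kernel_op P (g i) (X i w)) \<partial>M)"
  proof (rule integral_cong_AE)
    have "AE w in M. real_cond_exp M (\<F> k) (\<lambda>w. \<Prod>i\<in>generation k. g i (triple X i w)) w =
        (\<Prod>i\<in>generation k. kernel_op P (g i) (X i w))"
      using BMC g by (simp add: bifurcating_Markov_chain_def)
    then show "AE w in M. \<Psi> w * real_cond_exp M (\<F> k) (\<lambda>w. \<Prod>i\<in>generation k. g i (triple X i w)) w =
        \<Psi> w * (\<Prod>i\<in>generation k. kernel_op P (g i) (X i w))"
      by eventually_elim simp
  qed (use measurable_from_\<F>[OF borel_measurable_cond_exp] in auto)
  finally show ?thesis .
qed

text \<open>The defining property speaks of real functions. Both sides are linear in each factor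
  separately, so the factors are split into real and imaginary parts one at a time, by induction on
  the set \<open>B\<close> of indices where complex values are allowed.\<close>

lemma Markov_product_complex:
  fixes g :: "bool list \<Rightarrow> 'a family \<Rightarrow> complex"
  assumes \<Psi>: "\<Psi> \<in> borel_measurable (\<F> k)" "\<And>w. \<bar>\<Psi> w\<bar> \<le> b"
    and g: "\<And>i. g i \<in> borel_measurable triple_borel" "\<And>i u. norm (g i u) \<le> c"
  shows "(\<integral>w. complex_of_real (\<Psi> w) * (\<Prod>i\<in>generation k. g i (triple X i w)) \<partial>M) =
    (\<integral>w. complex_of_real (\<Psi> w) * (\<Prod>i\<in>generation k. kernel_int (g i) (X i w)) \<partial>M)"
proof -
  let ?L = "\<lambda>g w. complex_of_real (\<Psi> w) * (\<Prod>i\<in>generation k. g i (triple X i w))"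
  let ?R = "\<lambda>g w. complex_of_real (\<Psi> w) * (\<Prod>i\<in>generation k. kernel_int (g i) (X i w))"
  note [measurable] = measurable_from_\<F>[OF \<Psi>(1)]
  have b0: "b \<ge> 0" using \<Psi>(2) abs_ge_zero order_trans by blast
  have intg: "integrable M (\<lambda>w. complex_of_real (\<Psi> w) * (\<Prod>i\<in>generation k. h i w))"
    if h [measurable]: "\<And>i. h i \<in> borel_measurable M" and hc: "\<And>i w. norm (h i w) \<le> c"
    for h :: "bool list \<Rightarrow> 'w \<Rightarrow> complex"
  proof (rule integrable_const_bound)
    have "norm (complex_of_real (\<Psi> w) * (\<Prod>i\<in>generation k. h i w)) \<le> b * (\<Prod>i\<in>generation k. c)" for w
      unfolding norm_mult norm_of_real prod_norm[symmetric]
      by (intro mult_mono prod_mono prod_nonneg \<Psi> hc b0 conjI) auto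
    then show "AE w in M. norm (complex_of_real (\<Psi> w) * (\<Prod>i\<in>generation k. h i w)) \<le> b * (\<Prod>i\<in>generation k. c)"
      by simp
  qed simp
  have "\<And>g :: bool list \<Rightarrow> 'a family \<Rightarrow> complex.
      (\<And>i. g i \<in> borel_measurable triple_borel) \<Longrightarrow> (\<And>i u. norm (g i u) \<le> c) \<Longrightarrow>
      (\<And>i u. i \<in> generation k - B \<Longrightarrow> Im (g i u) = 0) \<Longrightarrow>
      (\<integral>w. ?L g w \<partial>M) =
      (\<integral>w. ?R g w \<partial>M)"
    if "B \<subseteq> generation k" for B
    using finite_subset[OF that finite_generation] that
  proof (induction B rule: finite_induct)
    case empty
    note [measurable] = empty(1)
    have g: "g i u = complex_of_real (Re (g i u))" if "i \<in> generation k" for i u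
      using empty(3) that by (simp add: complex_eq_iff)
    have "bounded (range (\<lambda>u. Re (g i u)))" for i
      unfolding bounded_iff using order_trans[OF abs_Re_le_cmod empty(2)] by (auto intro!: exI[of _ c])
    then have *: "(\<integral>w. \<Psi> w * (\<Prod>i\<in>generation k. Re (g i (triple X i w))) \<partial>M) =
      (\<integral>w. \<Psi> w * (\<Prod>i\<in>generation k. kernel_op P (\<lambda>u. Re (g i u)) (X i w)) \<partial>M)"
      using Markov_product[OF \<Psi>, of "\<lambda>i u. Re (g i u)"] by simp
    have 1: "(\<Prod>i\<in>generation k. g i (triple X i w)) =
        complex_of_real (\<Prod>i\<in>generation k. Re (g i (triple X i w)))" for w
      unfolding of_real_prod by (intro prod.cong refl g)
    have 2: "(\<Prod>i\<in>generation k. kernel_int (g i) (X i w)) =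
        complex_of_real (\<Prod>i\<in>generation k. kernel_op P (\<lambda>u. Re (g i u)) (X i w))" for w
      unfolding of_real_prod kernel_op_def integral_complex_of_real[symmetric]
      using g by (intro prod.cong refl Bochner_Integration.integral_cong)
    show ?case
      unfolding 1 2 of_real_mult[symmetric] integral_complex_of_real * ..
  next
    case (insert j B)
    note [measurable] = insert(4)
    have j: "j \<in> generation k" and B: "B \<subseteq> generation k" using insert by auto
    define g1 where "g1 = g(j := \<lambda>u. complex_of_real (Re (g j u)))"
    define g2 where "g2 = g(j := \<lambda>u. complex_of_real (Im (g j u)))"
    have m: "g1 i \<in> borel_measurable triple_borel" "g2 i \<in> borel_measurable triple_borel" for i
      by (auto simp: g1_def g2_def)
    note [measurable] = m
    have bd: "norm (g1 i u) \<le> c" "norm (g2 i u) \<le> c" for i u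
      using insert(5)[of i u] abs_Re_le_cmod[of "g j u"] abs_Im_le_cmod[of "g j u"]
      by (auto simp: g1_def g2_def)
    have split: "(\<Prod>i\<in>generation k. h i) = (\<Prod>i\<in>generation k. h1 i) + \<i> * (\<Prod>i\<in>generation k. h2 i)"
      if "\<And>i. i \<noteq> j \<Longrightarrow> h1 i = h i" "\<And>i. i \<noteq> j \<Longrightarrow> h2 i = h i" "h j = h1 j + \<i> * h2 j"
      for h h1 h2 :: "bool list \<Rightarrow> complex"
    proof -
      have "(\<Prod>i\<in>generation k - {j}. h1 i) = (\<Prod>i\<in>generation k - {j}. h i)"
        "(\<Prod>i\<in>generation k - {j}. h2 i) = (\<Prod>i\<in>generation k - {j}. h i)"
        using that by (auto intro: prod.cong)
      then show ?thesis
        using that(3) by (simp add: prod.remove[OF finite_generation j] algebra_simps)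
    qed
    have s1: "(\<Prod>i\<in>generation k. g i (triple X i w)) =
      (\<Prod>i\<in>generation k. g1 i (triple X i w)) + \<i> * (\<Prod>i\<in>generation k. g2 i (triple X i w))" for w
      by (rule split) (auto simp: g1_def g2_def complex_eq_iff)
    have s2: "(\<Prod>i\<in>generation k. kernel_int (g i) (X i w)) =
      (\<Prod>i\<in>generation k. kernel_int (g1 i) (X i w)) +
      \<i> * (\<Prod>i\<in>generation k. kernel_int (g2 i) (X i w))" for w
    proof (rule split)
      have "g j u = g1 j u + \<i> * g2 j u" for u by (simp add: g1_def g2_def complex_eq_iff)
      then show "kernel_int (g j) (X j w) =
          (kernel_int (g1 j) (X j w)) + \<i> * (kernel_int (g2 j) (X j w))"
        using integrable_kernel[OF m(1) bd(1)] integrable_kernel[OF m(2) bd(2)] by simp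
    qed (auto simp: g1_def g2_def)
    have mk: "(\<lambda>w. kernel_int h (X i w)) \<in> borel_measurable M"
      if "h \<in> borel_measurable triple_borel"
      for i and h :: "'a family \<Rightarrow> complex"
      by (rule measurable_compose[OF measurable_X measurable_kernel_integral[OF that]])
    have IH: "(\<integral>w. ?L h w \<partial>M) =
      (\<integral>w. ?R h w \<partial>M)"
      if "h = g1 \<or> h = g2" for h
      by (rule insert.IH) (use that m bd B insert(6) in \<open>auto simp: g1_def g2_def split: if_splits\<close>)
    have int1: "integrable M (\<lambda>w. ?L h w)"
      and int2: "integrable M (\<lambda>w. ?R h w)"
      if "h = g1 \<or> h = g2" for h
    proof -
      have h: "\<And>i. h i \<in> borel_measurable triple_borel" "\<And>i u. norm (h i u) \<le> c"
        using that m bd by blast+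
      show "integrable M (\<lambda>w. ?L h w)"
        by (rule intg[OF measurable_compose[OF measurable_triple h(1)] h(2)])
      show "integrable M (\<lambda>w. ?R h w)"
        by (rule intg[OF mk[OF h(1)] norm_kernel_integral_le[OF h]])
    qed
    show ?case
      unfolding s1 s2 distrib_left mult.left_commute[of _ \<i>]
      using int1[of g1] int1[of g2] int2[of g1] int2[of g2] IH[of g1] IH[of g2]
      by (subst (1 2) Bochner_Integration.integral_add) auto
  qed
  from this[OF order_refl] g show ?thesis by simp
qed

end

section \<open>Generation sums and the law of large numbers\<close>

lemma generation_Suc:
  "generation (Suc k) = (\<lambda>i. i @ [False]) ` generation k \<union> (\<lambda>i. i @ [True]) ` generation k"
proof (intro equalityI subsetI)
  fix i assume "i \<in> generation (Suc k)"
  then obtain j b where "i = j @ [b]" "j \<in> generation k"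
    by (cases i rule: rev_cases) (auto simp: generation_def)
  then show "i \<in> (\<lambda>i. i @ [False]) ` generation k \<union> (\<lambda>i. i @ [True]) ` generation k"
    by (cases b) auto
qed (auto simp: generation_def)

context comm_monoid_set
begin

text \<open>Stated for commutative monoids because sums serve the moments and products the
  generating function.\<close>

lemma generation_Suc_eq:
  "F h (generation (Suc k)) = F (\<lambda>i. h (i @ [False]) \<^bold>* h (i @ [True])) (generation k)"
proof -
  have "(\<lambda>i. i @ [False]) ` generation k \<inter> (\<lambda>i. i @ [True]) ` generation k = {}"
    by auto
  then show ?thesis
    by (simp add: generation_Suc union_disjoint reindex inj_on_def distrib)
qed

end

lemmas sum_generation_Suc = sum.generation_Suc_eq
lemmas prod_generation_Suc = prod.generation_Suc_eq

text \<open>Functions on S enter as functions on \<open>'a option\<close> that vanish at the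
  cemetery; a bound \<open>\<bar>h x\<bar> \<le> b * alive x\<close> expresses this and boundedness
  at once.\<close>

definition alive :: "'a option \<Rightarrow> real"
  where "alive x = of_bool (x \<noteq> None)"

lemma alive_simps [simp]: "alive None = 0" "alive (Some x) = 1"
  by (auto simp: alive_def)

lemma alive_bounds [simp]: "0 \<le> alive x" "alive x \<le> 1" "\<bar>alive x\<bar> \<le> 1"
  by (auto simp: alive_def)

lemma sets_None [measurable]: "{None} \<in> sets (borel :: 'a::topological_space option measure)"
  by (rule borel_open[OF open_None])

lemma sets_range_Some [measurable]: "range Some \<in> sets (borel :: 'a::topological_space option measure)"
  by (rule borel_open[OF open_range_Some])

lemma alive_indicator: "alive = indicator (range Some)"
proof
  show "alive x = indicator (range Some) x" for x :: "'a option"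
    by (cases x) (auto simp: indicator_def)
qed

lemma measurable_alive [measurable]:
  "alive \<in> borel_measurable (borel :: 'a::topological_space option measure)"
  unfolding alive_indicator by measurable

definition daughters :: "('a option \<Rightarrow> real) \<Rightarrow> 'a family \<Rightarrow> real"
  where "daughters h = (\<lambda>(x, y, z). h y + h z)"

lemma measurable_daughters [measurable]:
  assumes [measurable]: "h \<in> borel_measurable borel"
  shows "daughters h \<in> borel_measurable triple_borel"
  unfolding daughters_def by measurable

lemma bounded_of_alive_bound:
  fixes h :: "'c option \<Rightarrow> real"
  assumes "\<And>x. \<bar>h x\<bar> \<le> b * alive x"
  shows "b \<ge> 0" "\<bar>h x\<bar> \<le> b" "h None = 0"
proof -
  show b: "b \<ge> 0" using assms[of "Some undefined"] by simp
  show "\<bar>h x\<bar> \<le> b" using assms[of x] b by (cases x) auto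
  show "h None = 0" using assms[of None] by simp
qed

lemma abs_daughters_le:
  assumes "\<And>x. \<bar>h x\<bar> \<le> b"
  shows "\<bar>daughters h u\<bar> \<le> 2 * b"
  using add_mono[OF assms[of "fst (snd u)"] assms[of "snd (snd u)"]]
  by (auto simp: daughters_def case_prod_beta intro: order_trans[OF abs_triangle_ineq])

lemma (in finite_measure) integrable_of_bool [simp]:
  "Measurable.pred M Q \<Longrightarrow> integrable M (\<lambda>x. of_bool (Q x) :: real)"
  by (intro integrable_const_bound[of _ 1]) auto

section \<open>Second moments of sums over a generation\<close>

context BMC
begin

text \<open>The index set is the whole generation, deterministic and finite; for \<open>h\<close>
  vanishing at \<open>None\<close> only the living contribute.\<close>

definition total :: "('a option \<Rightarrow> real) \<Rightarrow> nat \<Rightarrow> 'w \<Rightarrow> real"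
  where "total h n w = (\<Sum>i\<in>generation n. h (X i w))"

lemma measurable_total_\<F>:
  "h \<in> borel_measurable borel \<Longrightarrow> total h n \<in> borel_measurable (\<F> n)"
  unfolding total_def[abs_def]
  by (intro borel_measurable_sum measurable_compose[OF measurable_X_\<F>]) (auto simp: generation_def)

lemma measurable_total [measurable]:
  "h \<in> borel_measurable borel \<Longrightarrow> total h n \<in> borel_measurable M"
  by (rule measurable_from_\<F>[OF measurable_total_\<F>])

lemma abs_total_le: "(\<And>x. \<bar>h x\<bar> \<le> b) \<Longrightarrow> \<bar>total h n w\<bar> \<le> real (card (generation n)) * b"
  unfolding total_def by (intro order_trans[OF sum_abs] sum_bounded_above) auto

lemma total_cmult: "total (\<lambda>x. c * h x) n w = c * total h n w"
  by (simp add: total_def sum_distrib_left)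

lemma total_diff: "total (\<lambda>x. h x - h' x) n w = total h n w - total h' n w"
  by (simp add: total_def sum_subtractf)

lemma integrable_total:
  assumes [measurable]: "h \<in> borel_measurable borel" and "\<And>x. \<bar>h x\<bar> \<le> b"
  shows "integrable M (total h n)"
  using abs_total_le[of h b n, OF assms(2)]
  by (intro integrable_const_bound[of _ "real (card (generation n)) * b"]) auto

lemma total_alive: "total alive n w = card (living_generation X n w)"
proof -
  have "total alive n w = (\<Sum>i\<in>generation n. if X i w \<noteq> None then 1 else 0)"
    by (simp add: total_def alive_def of_bool_def del: not_None_eq)
  also have "\<dots> = (\<Sum>i\<in>{i\<in>generation n. X i w \<noteq> None}. 1)"
    by (rule sum.inter_filter[symmetric]) simp
  also have "{i\<in>generation n. X i w \<noteq> None} = living_generation X n w"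
    by (auto simp: living_generation_def living_def)
  finally show ?thesis by simp
qed

lemma total_Suc: "total h (Suc n) w = (\<Sum>i\<in>generation n. daughters h (triple X i w))"
  unfolding total_def sum_generation_Suc by (simp add: daughters_def triple_def)

text \<open>The product formula with every factor but one equal to 1.\<close>

lemma expectation_triple:
  assumes g: "g \<in> borel_measurable triple_borel" "\<And>u. \<bar>g u\<bar> \<le> b"
  shows "(\<integral>w. g (triple X i w) \<partial>M) = (\<integral>w. kernel_op P g (X i w) \<partial>M)"
proof -
  define k where "k = length i"
  have i: "i \<in> generation k" by (simp add: k_def generation_def)
  define g' where "g' = (\<lambda>j. if j = i then g else (\<lambda>_. 1))"
  have g': "g' j \<in> borel_measurable triple_borel" "bounded (range (g' j))" for j
    using g by (auto simp: g'_def bounded_iff)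
  have one: "kernel_op P (\<lambda>_. 1) x = 1" for x
    using prob_space.prob_space[OF prob_space_kernel[of x]] by (simp add: kernel_op_def)
  have "(\<Prod>j\<in>generation k. h j) = h i" if "\<And>j. j \<noteq> i \<Longrightarrow> h j = 1" for h :: "bool list \<Rightarrow> real"
    using that by (subst prod.remove[OF finite_generation i]) (auto intro!: prod.neutral)
  then have "(\<Prod>j\<in>generation k. g' j (triple X j w)) = g (triple X i w)"
    "(\<Prod>j\<in>generation k. kernel_op P (g' j) (X j w)) = kernel_op P g (X i w)" for w
    by (auto simp: g'_def one)
  then show ?thesis
    using Markov_product[of "\<lambda>_. 1" k 1 g'] g' by simp
qed

lemma kernel_op_diff_const:
  assumes g: "g \<in> borel_measurable triple_borel" "\<And>u. \<bar>g u\<bar> \<le> b"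
  shows "kernel_op P (\<lambda>(x, v). g (x, v) - c x) x = kernel_op P g x - c x"
proof -
  interpret P: prob_space "P x" by (rule prob_space_kernel)
  have "integrable (P x) (\<lambda>v. g (x, v))"
    using integrable_kernel[OF g(1), of b] g(2) by simp
  then show ?thesis using P.prob_space by (simp add: kernel_op_def)
qed

text \<open>All factors but two are 1, and a single centred factor already annihilates the product
  of the kernel integrals.\<close>

lemma uncorrelated_triples:
  assumes g: "g \<in> borel_measurable triple_borel" "\<And>u. \<bar>g u\<bar> \<le> b" and g0: "\<And>x. kernel_op P g x = 0"
    and ij: "i \<in> generation k" "j \<in> generation k" "i \<noteq> j"
  shows "(\<integral>w. g (triple X i w) * g (triple X j w) \<partial>M) = 0"
proof -
  define g' where "g' = (\<lambda>l. if l = i \<or> l = j then g else (\<lambda>_. 1))"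
  have g': "g' l \<in> borel_measurable triple_borel" "bounded (range (g' l))" for l
    using g by (auto simp: g'_def bounded_iff)
  have "(\<Prod>l\<in>generation k. g' l (triple X l w)) = g (triple X i w) * g (triple X j w)" for w
  proof -
    have "(\<Prod>l\<in>generation k - {i} - {j}. g' l (triple X l w)) = 1"
      by (rule prod.neutral) (auto simp: g'_def)
    then show ?thesis
      using ij by (simp add: prod.remove[of "generation k" i] prod.remove[of "generation k - {i}" j] g'_def)
  qed
  then have "(\<integral>w. g (triple X i w) * g (triple X j w) \<partial>M) =
      (\<integral>w. (\<Prod>l\<in>generation k. kernel_op P (g' l) (X l w)) \<partial>M)"
    using Markov_product[of "\<lambda>_. 1" k 1 g'] g' by simp
  moreover have zero: "(\<Prod>l\<in>generation k. kernel_op P (g' l) (X l w)) = 0" for w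
    using ij g0 by (auto simp: g'_def)
  ultimately show ?thesis by (simp only: zero) simp
qed

text \<open>Off-diagonal terms vanish by \<open>uncorrelated_triples\<close>. A dead mother
  contributes nothing to the diagonal, so the bound involves the mean number of the living, later
  \<open>m ^ k\<close>, and not the size \<open>2 ^ k\<close> of the full generation.\<close>

lemma second_moment_le:
  assumes g [measurable]: "g \<in> borel_measurable triple_borel" and b: "\<And>u. \<bar>g u\<bar> \<le> b"
  shows "(\<integral>w. (\<Sum>i\<in>generation k. g (triple X i w) - kernel_op P g (X i w))\<^sup>2 \<partial>M)
    \<le> (2 * b)\<^sup>2 * (\<integral>w. total alive k w \<partial>M)"
proof -
  define g' where "g' = (\<lambda>(x, v). g (x, v) - kernel_op P g x)"
  let ?c = "\<lambda>i j. \<integral>w. g' (triple X i w) * g' (triple X j w) \<partial>M"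
  have [measurable]: "g' \<in> borel_measurable triple_borel"
    unfolding g'_def by measurable
  have b': "\<bar>g' u\<bar> \<le> 2 * b" for u
    using b[of u] abs_kernel_op_le[OF g b, of "fst u"] by (auto simp: g'_def split: prod.split)
  have g'_0: "kernel_op P g' x = 0" for x
    unfolding g'_def using kernel_op_diff_const[OF g b] by simp
  have sq: "(\<lambda>u. (g' u)\<^sup>2) \<in> borel_measurable triple_borel" by measurable
  have sq_b: "\<bar>(g' u)\<^sup>2\<bar> \<le> (2 * b)\<^sup>2" for u
    using power_mono[OF b'[of u], of 2] by simp
  have eq: "(\<Sum>i\<in>generation k. g (triple X i w) - kernel_op P g (X i w)) = (\<Sum>i\<in>generation k. g' (triple X i w))" for w
    by (simp add: g'_def triple_def)
  have intg: "integrable M (\<lambda>w. g' (triple X i w) * g' (triple X j w))" for i j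
  proof (rule integrable_const_bound[of _ "2 * b * (2 * b)"])
    have "\<bar>g' u * g' v\<bar> \<le> 2 * b * (2 * b)" for u v
      unfolding abs_mult using order_trans[OF abs_ge_zero b'] by (intro mult_mono b') auto
    then show "AE w in M. norm (g' (triple X i w) * g' (triple X j w)) \<le> 2 * b * (2 * b)"
      by simp
  qed measurable
  have diag: "?c i i \<le> (2 * b)\<^sup>2 * (\<integral>w. alive (X i w) \<partial>M)" for i
  proof -
    have "?c i i = (\<integral>w. kernel_op P (\<lambda>u. (g' u)\<^sup>2) (X i w) \<partial>M)"
      using expectation_triple[OF sq sq_b] by (simp add: power2_eq_square)
    also have "\<dots> \<le> (\<integral>w. (2 * b)\<^sup>2 * alive (X i w) \<partial>M)"
    proof (rule integral_mono)
      have "\<bar>kernel_op P (\<lambda>u. (g' u)\<^sup>2) x\<bar> \<le> (2 * b)\<^sup>2" for x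
        by (rule abs_kernel_op_le[OF sq sq_b])
      then show "integrable M (\<lambda>w. kernel_op P (\<lambda>u. (g' u)\<^sup>2) (X i w))"
        using measurable_compose[OF measurable_X measurable_kernel_op[OF sq]]
        by (intro integrable_const_bound[of _ "(2 * b)\<^sup>2"]) auto
      show "integrable M (\<lambda>w. (2 * b)\<^sup>2 * alive (X i w))"
        using alive_bounds by (intro integrable_mult_right integrable_const_bound[of _ 1]) auto
      show "kernel_op P (\<lambda>u. (g' u)\<^sup>2) (X i w) \<le> (2 * b)\<^sup>2 * alive (X i w)" for w
      proof (cases "X i w")
        case None
        \<comment> \<open>At the cemetery the kernel is a point mass, so centring removes the whole
          value.\<close>
        have "g' (None, None, None) = 0" using kernel_op_None[OF g] by (simp add: g'_def)
        then show ?thesis using None kernel_op_None[OF sq] by simp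
      next
        case (Some x)
        then show ?thesis using abs_kernel_op_le[OF sq sq_b, of "Some x"] by simp
      qed
    qed
    finally show ?thesis by simp
  qed
  have "(\<integral>w. (\<Sum>i\<in>generation k. g' (triple X i w))\<^sup>2 \<partial>M) =
      (\<Sum>i\<in>generation k. \<Sum>j\<in>generation k. ?c i j)"
    unfolding power2_eq_square sum_product using intg by (simp add: Bochner_Integration.integral_sum)
  also have "\<dots> = (\<Sum>i\<in>generation k. ?c i i)"
  proof (rule sum.cong[OF refl])
    fix i assume i: "i \<in> generation k"
    have "(\<Sum>j\<in>generation k - {i}. ?c i j) = 0"
      using i by (intro sum.neutral ballI uncorrelated_triples[OF _ b' g'_0]) auto
    then show "(\<Sum>j\<in>generation k. ?c i j) =
        ?c i i"
      using i by (subst sum.remove[OF finite_generation]) auto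
  qed
  also have "\<dots> \<le> (\<Sum>i\<in>generation k. (2 * b)\<^sup>2 * (\<integral>w. alive (X i w) \<partial>M))"
    by (intro sum_mono diag)
  also have "\<dots> = (2 * b)\<^sup>2 * (\<integral>w. total alive k w \<partial>M)"
  proof -
    have "integrable M (\<lambda>w. alive (X i w))" for i
      using alive_bounds by (intro integrable_const_bound[of _ 1]) auto
    then show ?thesis unfolding total_def
      by (subst Bochner_Integration.integral_sum) (auto simp: sum_distrib_left)
  qed
  finally show ?thesis unfolding eq .
qed

end

section \<open>The mean offspring operator and the law of large numbers\<close>

locale supercritical_BMC = BMC M \<nu> P X
  for M :: "'w measure" and \<nu> :: "'a::topological_space option measure" and P X +
  fixes p10 p0 p1 m :: real
  assumes initial_law: "emeasure \<nu> {None} = 0"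
    and homogeneous: "spatially_homogeneous P p10 p0 p1"
    and m_def: "m = 2 * p10 + p0 + p1"
    and super_critical: "m > 1"
begin

text \<open>The usable form of spatial homogeneity: which of the two daughters live has the same law
  at every living mother. It yields the mean offspring number, the generating function and the
  nonnegativity of the fourth probability.\<close>

lemma kernel_op_status:
  "kernel_op P (\<lambda>(x, y, z). c (y \<noteq> None) (z \<noteq> None)) (Some x) =
    p10 * c True True + p0 * c True False + p1 * c False True + (1 - p10 - p0 - p1) * c False False"
proof -
  interpret P: prob_space "P (Some x)" by (rule prob_space_kernel)
  define A where "A = (range Some \<times> range Some :: ('a option \<times> 'a option) set)"
  define B where "B = (range Some \<times> {None} :: ('a option \<times> 'a option) set)"
  define C where "C = ({None} \<times> range Some :: ('a option \<times> 'a option) set)"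
  have sets: "A \<in> sets (P (Some x))" "B \<in> sets (P (Some x))" "C \<in> sets (P (Some x))"
    by (auto simp: A_def B_def C_def)
  have meas: "measure (P (Some x)) A = p10" "measure (P (Some x)) B = p0" "measure (P (Some x)) C = p1"
    using homogeneous by (auto simp: A_def B_def C_def spatially_homogeneous_def)
  have "(case v of (y, z) \<Rightarrow> c (y \<noteq> None) (z \<noteq> None)) = c False False + (c True True - c False False) * indicator A v
      + (c True False - c False False) * indicator B v + (c False True - c False False) * indicator C v"
    for v :: "'a option \<times> 'a option"
  proof -
    obtain y z where v: "v = (y, z)" by fastforce
    show ?thesis unfolding v by (cases y; cases z) (auto simp: A_def B_def C_def indicator_def)
  qed
  then have "kernel_op P (\<lambda>(x, y, z). c (y \<noteq> None) (z \<noteq> None)) (Some x) =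
    (\<integral>v. c False False + (c True True - c False False) * indicator A v
      + (c True False - c False False) * indicator B v + (c False True - c False False) * indicator C v \<partial>P (Some x))"
    by (simp add: kernel_op_def)
  also have "\<dots> = c False False + (c True True - c False False) * p10
      + (c True False - c False False) * p0 + (c False True - c False False) * p1"
    using sets P.prob_space by (simp add: meas integrable_real_indicator P.emeasure_eq_measure)
  finally show ?thesis by (simp add: algebra_simps)
qed

text \<open>This eigenvalue relation makes \<open>m ^ n\<close> the right normalisation and lets
  \<open>offspring_op\<close> preserve bounds by multiples of \<open>alive\<close>.\<close>

lemma kernel_op_alive: "kernel_op P (daughters alive) x = m * alive x"
proof (cases x)
  case None
  then show ?thesis by (simp add: kernel_op_None) (simp add: daughters_def)
next
  case (Some y)
  then show ?thesis using kernel_op_status[of "\<lambda>u v. of_bool u + of_bool v" y]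
    by (simp add: daughters_def alive_def m_def case_prod_beta')
qed

lemma AE_root_alive: "AE w in M. X [] w \<noteq> None"
proof -
  have "distr M borel (X []) = \<nu>" using BMC by (simp add: bifurcating_Markov_chain_def)
  then have "emeasure M (X [] -` {None} \<inter> space M) = 0"
    using initial_law emeasure_distr[OF measurable_X sets_None, of "[]"] by simp
  then have "X [] -` {None} \<inter> space M \<in> null_sets M"
    by (auto simp: null_sets_def intro: measurable_sets)
  from AE_not_in[OF this] show ?thesis by (auto simp: vimage_def)
qed

lemma expectation_total_alive: "(\<integral>w. total alive n w \<partial>M) = m ^ n"
proof (induction n)
  case 0
  have "(\<integral>w. total alive 0 w \<partial>M) = (\<integral>w. 1 \<partial>M)"
  proof (rule integral_cong_AE)
    show "AE w in M. total alive 0 w = 1"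
      using AE_root_alive by eventually_elim (simp add: total_def generation_0 alive_def)
  qed simp_all
  then show ?case by (simp add: prob_space)
next
  case (Suc n)
  have b: "\<bar>daughters alive u\<bar> \<le> 2" for u :: "'a family"
    using alive_bounds by (auto simp: daughters_def alive_def split: prod.split)
  have "(\<integral>w. total alive (Suc n) w \<partial>M) = (\<Sum>i\<in>generation n. \<integral>w. daughters alive (triple X i w) \<partial>M)"
    unfolding total_Suc using b
    by (intro Bochner_Integration.integral_sum integrable_const_bound[of _ 2]) auto
  also have "\<dots> = (\<Sum>i\<in>generation n. \<integral>w. m * alive (X i w) \<partial>M)"
    using expectation_triple[OF measurable_daughters[OF measurable_alive] b] by (simp add: kernel_op_alive)
  also have "\<dots> = (\<integral>w. (\<Sum>i\<in>generation n. m * alive (X i w)) \<partial>M)"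
    using alive_bounds
    by (intro Bochner_Integration.integral_sum[symmetric] integrable_mult_right integrable_const_bound[of _ 1]) auto
  also have "\<dots> = m * m ^ n"
    using Suc by (simp add: sum_distrib_left[symmetric] total_def)
  finally show ?case by simp
qed

lemma sqrt_m: "sqrt m < m" "1 < sqrt m"
  using super_critical real_sqrt_less_iff[of m "m^2"] by (auto simp: power2_eq_square real_sqrt_mult)

text \<open>The transition operator Q of the auxiliary chain, expressed through \<open>P\<close> on
  \<open>'a option\<close> so that it applies directly to generation sums. The identification with
  \<open>auxiliary_kernel\<close> is \<open>integral_auxiliary_kernel\<close>.\<close>

definition offspring_op :: "('a option \<Rightarrow> real) \<Rightarrow> 'a option \<Rightarrow> real"
  where "offspring_op h x = kernel_op P (daughters h) x / m"

lemma measurable_offspring_op [measurable]: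
  "h \<in> borel_measurable borel \<Longrightarrow> offspring_op h \<in> borel_measurable borel"
  unfolding offspring_op_def[abs_def]
  by (intro borel_measurable_divide measurable_kernel_op measurable_daughters borel_measurable_const)

text \<open>The triangle inequality gives
  \<open>\<bar>daughters h u\<bar> \<le> b * daughters alive u\<close>, and the kernel multiplies
  \<open>alive\<close> by \<open>m\<close>, which the normalisation cancels.\<close>

lemma abs_offspring_op_le:
  assumes [measurable]: "h \<in> borel_measurable borel" and h: "\<And>x. \<bar>h x\<bar> \<le> b * alive x"
  shows "\<bar>offspring_op h x\<bar> \<le> b * alive x"
proof -
  have bd: "\<bar>daughters h u\<bar> \<le> 2 * b" for u
    by (rule abs_daughters_le[OF bounded_of_alive_bound(2)[OF h]])
  have "\<bar>daughters alive u\<bar> \<le> 2" for u :: "'a family"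
    by (auto simp: daughters_def alive_def split: prod.split)
  then have int: "integrable (P x) (\<lambda>v. b * daughters alive (x, v))"
    using integrable_kernel[of "daughters alive" 2] by simp
  have "\<bar>kernel_op P (daughters h) x\<bar> \<le> (\<integral>v. \<bar>daughters h (x, v)\<bar> \<partial>P x)"
    unfolding kernel_op_def by (rule integral_abs_bound)
  also have "\<dots> \<le> (\<integral>v. b * daughters alive (x, v) \<partial>P x)"
  proof (rule integral_mono)
    show "integrable (P x) (\<lambda>v. \<bar>daughters h (x, v)\<bar>)"
      using integrable_kernel[of "daughters h" "2 * b"] bd by simp
    show "\<bar>daughters h (x, v)\<bar> \<le> b * daughters alive (x, v)" for v
      using h[of "fst v"] h[of "snd v"]
      by (auto simp: daughters_def distrib_left split: prod.split intro: order_trans[OF abs_triangle_ineq])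
  qed (rule int)
  also have "\<dots> = b * kernel_op P (daughters alive) x" by (simp add: kernel_op_def)
  also have "\<dots> = m * (b * alive x)" by (simp add: kernel_op_alive)
  finally show ?thesis
    using super_critical by (simp add: offspring_op_def field_simps)
qed

lemma offspring_op_iterate:
  assumes h: "h \<in> borel_measurable borel" "\<And>x. \<bar>h x\<bar> \<le> b * alive x"
  shows "(offspring_op ^^ r) h \<in> borel_measurable borel" "\<bar>(offspring_op ^^ r) h x\<bar> \<le> b * alive x"
proof -
  have "(offspring_op ^^ r) h \<in> borel_measurable borel \<and> (\<forall>x. \<bar>(offspring_op ^^ r) h x\<bar> \<le> b * alive x)"
    by (induction r) (auto simp: h measurable_offspring_op abs_offspring_op_le)
  then show "(offspring_op ^^ r) h \<in> borel_measurable borel" "\<bar>(offspring_op ^^ r) h x\<bar> \<le> b * alive x"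
    by auto
qed

text \<open>Since \<open>kernel_op P (daughters h)\<close> is \<open>m\<close> times
  \<open>offspring_op h\<close>, the difference is a sum of centred triples.
  \<open>daughters h\<close> is bounded by \<open>2 * b\<close>, its centred version by
  \<open>4 * b\<close>, and the second moment is at most
  \<open>(4 * b)\<^sup>2 * m ^ n\<close>.\<close>

lemma expectation_step_le:
  assumes h [measurable]: "h \<in> borel_measurable borel" and hb: "\<And>x. \<bar>h x\<bar> \<le> b * alive x"
  shows "(\<integral>w. \<bar>total h (Suc n) w - m * total (offspring_op h) n w\<bar> \<partial>M) \<le> 4 * b * sqrt m ^ n"
proof -
  note b = bounded_of_alive_bound(1)[OF hb]
  have bd: "\<bar>daughters h u\<bar> \<le> 2 * b" for u
    by (rule abs_daughters_le[OF bounded_of_alive_bound(2)[OF hb]])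
  define D where "D w = (\<Sum>i\<in>generation n. daughters h (triple X i w) - kernel_op P (daughters h) (X i w))" for w
  have D: "total h (Suc n) w - m * total (offspring_op h) n w = D w" for w
    unfolding total_Suc D_def
    unfolding total_def offspring_op_def using super_critical by (simp add: sum_subtractf sum_divide_distrib[symmetric])
  have [measurable]: "D \<in> borel_measurable M" unfolding D_def[abs_def] by measurable
  have "\<bar>D w\<bar> \<le> (\<Sum>i\<in>generation n. 2 * b + 2 * b)" for w
    unfolding D_def using bd abs_kernel_op_le[OF _ bd]
    by (intro order_trans[OF sum_abs] sum_mono order_trans[OF abs_triangle_ineq4] add_mono) auto
  note D_bd = this
  have int: "integrable M (\<lambda>w. \<bar>D w\<bar>)"
    using D_bd by (intro integrable_const_bound) auto
  have int2: "integrable M (\<lambda>w. \<bar>D w\<bar>\<^sup>2)"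
    using power_mono[OF D_bd abs_ge_zero, of _ 2] by (intro integrable_const_bound) auto
  \<comment> \<open>Nonnegativity of the variance of \<open>\<bar>D w\<bar>\<close> serves as the
    Cauchy-Schwarz inequality.\<close>
  have "(\<integral>w. \<bar>D w\<bar> \<partial>M)\<^sup>2 \<le> (\<integral>w. \<bar>D w\<bar>\<^sup>2 \<partial>M)"
    using variance_positive[of "\<lambda>w. \<bar>D w\<bar>"] variance_eq[OF int int2] by simp
  also have "\<dots> \<le> (2 * (2 * b))\<^sup>2 * m ^ n"
    using second_moment_le[OF measurable_daughters[OF h] bd, of n] by (simp add: D_def expectation_total_alive)
  also have "\<dots> = (4 * b * sqrt m ^ n)\<^sup>2"
    using super_critical by (simp add: power_mult_distrib power2_eq_square flip: real_sqrt_power)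
  finally have "(\<integral>w. \<bar>D w\<bar> \<partial>M) \<le> 4 * b * sqrt m ^ n"
    by (rule power2_le_imp_le) (use b super_critical in simp)
  then show ?thesis by (simp add: D)
qed

text \<open>A telescoping sum: the one-step error in generation \<open>j\<close> is of order \<open>sqrt m ^ j\<close>, and it is
  inflated only by the mean growth afterwards.\<close>

lemma expectation_steps_le:
  assumes "h \<in> borel_measurable borel" "\<And>x. \<bar>h x\<bar> \<le> b * alive x"
  shows "(\<integral>w. \<bar>total h (k + r) w - m ^ r * total ((offspring_op ^^ r) h) k w\<bar> \<partial>M)
    \<le> 4 * b / (m - sqrt m) * (m ^ r - sqrt m ^ r) * sqrt m ^ k"
  using assms
proof (induction r arbitrary: h)
  case 0
  then show ?case by simp
next
  case (Suc r)
  note b = bounded_of_alive_bound(1)[OF Suc(3)]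
  have m: "sqrt m < m" "m > 0"
    using sqrt_m super_critical by auto
  note [measurable] = Suc(2)
  define h' where "h' = offspring_op h"
  let ?A = "\<lambda>w. total h (Suc (k + r)) w - m * total h' (k + r) w"
  let ?B = "\<lambda>w. total h' (k + r) w - m ^ r * total ((offspring_op ^^ r) h') k w"
  have [measurable]: "h' \<in> borel_measurable borel" by (simp add: h'_def)
  have h': "\<bar>h' x\<bar> \<le> b * alive x" for x
    unfolding h'_def by (rule abs_offspring_op_le) (use Suc in auto)
  have [measurable]: "(offspring_op ^^ r) h' \<in> borel_measurable borel"
    by (rule offspring_op_iterate[OF _ h']) simp
  have iterate: "(offspring_op ^^ Suc r) h = (offspring_op ^^ r) h'"
    by (simp add: h'_def funpow_swap1)
  have bd: "\<bar>h x\<bar> \<le> b" "\<bar>h' x\<bar> \<le> b" "\<bar>(offspring_op ^^ r) h' x\<bar> \<le> b" for x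
    using bounded_of_alive_bound(2)[OF Suc(3)] bounded_of_alive_bound(2)[OF h']
      bounded_of_alive_bound(2)[OF offspring_op_iterate(2)[OF _ h']] by auto
  have int: "integrable M (total h n)" "integrable M (total h' n)"
    "integrable M (total ((offspring_op ^^ r) h') n)" for n
    by (rule integrable_total[OF _ bd(1)] integrable_total[OF _ bd(2)] integrable_total[OF _ bd(3)], simp)+
  have "(\<integral>w. \<bar>total h (k + Suc r) w - m ^ Suc r * total ((offspring_op ^^ Suc r) h) k w\<bar> \<partial>M)
      \<le> (\<integral>w. \<bar>?A w\<bar> +
        m * \<bar>?B w\<bar> \<partial>M)"
    unfolding iterate
  proof (rule integral_mono)
    fix w
    have "total h (k + Suc r) w - m ^ Suc r * total ((offspring_op ^^ r) h') k w =
       (?A w) +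
       m * (?B w)"
      by (simp add: algebra_simps)
    also have "\<bar>\<dots>\<bar> \<le> \<bar>?A w\<bar> +
        \<bar>m * (?B w)\<bar>"
      by (rule abs_triangle_ineq)
    finally show "\<bar>total h (k + Suc r) w - m ^ Suc r * total ((offspring_op ^^ r) h') k w\<bar> \<le>
        \<bar>?A w\<bar> +
        m * \<bar>?B w\<bar>"
      using m by (simp add: abs_mult)
  qed (use int in auto)
  also have "\<dots> = (\<integral>w. \<bar>?A w\<bar> \<partial>M) +
      m * (\<integral>w. \<bar>?B w\<bar> \<partial>M)"
    using int by simp
  also have "\<dots> \<le> 4 * b * sqrt m ^ (k + r) + m * (4 * b / (m - sqrt m) * (m ^ r - sqrt m ^ r) * sqrt m ^ k)"
    using m Suc.IH[of h'] h' expectation_step_le[OF Suc(2) Suc(3), of "k + r"]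
    by (intro add_mono mult_left_mono) (auto simp: h'_def)
  \<comment> \<open>The newest error is put over the common constant.
    \<open>(m ^ r - sqrt m ^ r) / (m - sqrt m)\<close> is the geometric sum of
    \<open>m ^ (r - 1 - j) * sqrt m ^ j\<close> over \<open>j < r\<close>.\<close>
  also have "4 * b * sqrt m ^ (k + r) = 4 * b / (m - sqrt m) * ((m - sqrt m) * sqrt m ^ r) * sqrt m ^ k"
    using m by (simp add: power_add)
  also have "\<dots> + m * (4 * b / (m - sqrt m) * (m ^ r - sqrt m ^ r) * sqrt m ^ k) =
      4 * b / (m - sqrt m) * ((m - sqrt m) * sqrt m ^ r + m * (m ^ r - sqrt m ^ r)) * sqrt m ^ k"
    by (simp only: distrib_left distrib_right mult_ac)
  also have "(m - sqrt m) * sqrt m ^ r + m * (m ^ r - sqrt m ^ r) = m ^ Suc r - sqrt m ^ Suc r"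
    by (simp add: algebra_simps)
  finally show ?case .
qed

text \<open>Divided by \<open>m ^ (k + r)\<close>, the error of \<open>expectation_steps_le\<close>
  is at most \<open>K * (1 / sqrt m) ^ k\<close>, uniformly in \<open>r\<close>. So \<open>k\<close>
  is fixed first to make it small; then \<open>r\<close> grows, and dominated convergence over the
  finite generation \<open>k\<close> asks only for the pointwise limit.\<close>

lemma law_of_large_numbers:
  assumes h [measurable]: "h \<in> borel_measurable borel" and hb: "\<And>x. \<bar>h x\<bar> \<le> b * alive x"
    and lim: "\<And>x. (\<lambda>r. (offspring_op ^^ r) h x) \<longlonglongrightarrow> 0"
  shows "(\<lambda>n. \<integral>w. \<bar>total h n w\<bar> / m ^ n \<partial>M) \<longlonglongrightarrow> 0"
proof (rule LIMSEQ_I)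
  fix \<epsilon> :: real assume \<epsilon>: "\<epsilon> > 0"
  note b = bounded_of_alive_bound(1)[OF hb]
  have m: "sqrt m < m" "m > 0" "sqrt m > 1"
    using sqrt_m super_critical by auto
  define K where "K = 4 * b / (m - sqrt m)"
  have K: "K \<ge> 0" using b m by (simp add: K_def)
  have hb': "\<bar>(offspring_op ^^ r) h x\<bar> \<le> b" for r x
    by (rule bounded_of_alive_bound(2)[OF offspring_op_iterate(2)[OF h hb]])
  note it [measurable] = offspring_op_iterate(1)[OF h hb]
  have "(\<lambda>k. K * (1 / sqrt m) ^ k) \<longlonglongrightarrow> 0"
    using m by (intro tendsto_mult_right_zero LIMSEQ_power_zero) auto
  then have "\<forall>\<^sub>F k in sequentially. K * (1 / sqrt m) ^ k < \<epsilon> / 2"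
    using \<epsilon> by (intro order_tendstoD) auto
  then obtain k where k: "K * (1 / sqrt m) ^ k < \<epsilon> / 2"
    using eventually_happens'[OF sequentially_bot] by auto
  let ?T = "\<lambda>r w. total ((offspring_op ^^ r) h) k w"
  let ?D = "\<lambda>r w. total h (k + r) w - m ^ r * ?T r w"
  have "(\<lambda>r. \<integral>w. \<bar>?T r w\<bar> / m ^ k \<partial>M) \<longlonglongrightarrow> (\<integral>w. 0 \<partial>M)"
  proof (rule integral_dominated_convergence[where w="\<lambda>_. card (generation k) * b / m ^ k"])
    have "(\<lambda>r. \<bar>?T r w\<bar> / m ^ k) \<longlonglongrightarrow> \<bar>\<Sum>i\<in>generation k. 0\<bar> / m ^ k" for w
      unfolding total_def by (intro tendsto_intros lim) (use m in auto)
    then show "AE w in M. (\<lambda>r. \<bar>?T r w\<bar> / m ^ k) \<longlonglongrightarrow> 0" by simp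
    show "AE w in M. norm (\<bar>?T r w\<bar> / m ^ k) \<le> card (generation k) * b / m ^ k" for r
      using abs_total_le[of "(offspring_op ^^ r) h" b k, OF hb'] m by (auto simp: divide_right_mono)
  qed auto
  then have "\<forall>\<^sub>F r in sequentially. (\<integral>w. \<bar>?T r w\<bar> / m ^ k \<partial>M) < \<epsilon> / 2"
    using \<epsilon> by (intro order_tendstoD) auto
  then obtain R where R: "\<And>r. r \<ge> R \<Longrightarrow> (\<integral>w. \<bar>?T r w\<bar> / m ^ k \<partial>M) < \<epsilon> / 2"
    by (auto simp: eventually_sequentially)
  have "(\<integral>w. \<bar>total h n w\<bar> / m ^ n \<partial>M) < \<epsilon>" if n: "n \<ge> k + R" for n
  proof -
    define r where "r = n - k"
    have nr: "n = k + r" "r \<ge> R" using n by (auto simp: r_def)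
    have int: "integrable M (total ((offspring_op ^^ r) h) n)" "integrable M (total h n)" for r n
      using integrable_total[OF it hb'] integrable_total[OF h hb'[of 0, simplified]] by auto
    have "(\<integral>w. \<bar>total h n w\<bar> / m ^ n \<partial>M) \<le>
      (\<integral>w. \<bar>?D r w\<bar> / m ^ (k + r) +
        \<bar>?T r w\<bar> / m ^ k \<partial>M)"
    proof (rule integral_mono)
      fix w
      have "\<bar>total h n w\<bar> \<le> \<bar>?D r w\<bar> +
          m ^ r * \<bar>?T r w\<bar>"
        using abs_triangle_ineq[of "?D r w"
            "m ^ r * ?T r w"] m by (simp add: nr abs_mult)
      then have "\<bar>total h n w\<bar> / m ^ n \<le> (\<bar>?D r w\<bar> +
          m ^ r * \<bar>?T r w\<bar>) / m ^ n"
        using m by (intro divide_right_mono) auto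
      then show "\<bar>total h n w\<bar> / m ^ n \<le> \<bar>?D r w\<bar> / m ^ (k + r) +
          \<bar>?T r w\<bar> / m ^ k"
        using m by (simp add: nr add_divide_distrib power_add)
    qed (use int in auto)
    also have "\<dots> = (\<integral>w. \<bar>?D r w\<bar> \<partial>M) / m ^ (k + r) +
        (\<integral>w. \<bar>?T r w\<bar> / m ^ k \<partial>M)"
      using int by simp
    also have "(\<integral>w. \<bar>?D r w\<bar> \<partial>M) / m ^ (k + r)
        \<le> (K * m ^ r * sqrt m ^ k) / m ^ (k + r)"
    proof (rule divide_right_mono)
      have "(\<integral>w. \<bar>?D r w\<bar> \<partial>M)
          \<le> K * (m ^ r - sqrt m ^ r) * sqrt m ^ k"
        unfolding K_def by (rule expectation_steps_le[OF h hb])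
      also have "\<dots> \<le> K * m ^ r * sqrt m ^ k"
        using K m by (intro mult_right_mono mult_left_mono) auto
      finally show "(\<integral>w. \<bar>?D r w\<bar> \<partial>M) \<le> K * m ^ r * sqrt m ^ k" .
    qed (use m in auto)
    also have "(K * m ^ r * sqrt m ^ k) / m ^ (k + r) = K * (1 / sqrt m) ^ k"
    proof -
      have "m ^ k = sqrt m ^ k * sqrt m ^ k" using m by (simp flip: power_mult_distrib)
      then show ?thesis using m by (simp add: power_add power_divide)
    qed
    finally show ?thesis using k R[OF nr(2)] by linarith
  qed
  moreover have "(\<integral>w. \<bar>total h n w\<bar> / m ^ n \<partial>M) \<ge> 0" for n
    using m by (intro integral_nonneg_AE) auto
  ultimately show "\<exists>N. \<forall>n\<ge>N. norm ((\<integral>w. \<bar>total h n w\<bar> / m ^ n \<partial>M) - 0) < \<epsilon>"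
    using m by (intro exI[of _ "k + R"]) (auto simp: abs_of_pos)
qed

end

section \<open>The auxiliary Markov chain\<close>

lemma measurable_case_option_borel:
  fixes u :: "'a::topological_space \<Rightarrow> 'b::topological_space"
  assumes u: "u \<in> borel_measurable borel"
  shows "case_option c u \<in> borel_measurable borel"
proof (rule measurableI)
  fix A :: "'b set" assume A: "A \<in> sets borel"
  have "case_option c u -` A = Some ` (u -` A) \<union> (if c \<in> A then {None} else {})"
  proof (intro set_eqI)
    show "x \<in> case_option c u -` A \<longleftrightarrow> x \<in> Some ` (u -` A) \<union> (if c \<in> A then {None} else {})" for x
      by (cases x) auto
  qed
  moreover have "Some ` (u -` A) \<in> sets borel"
    using measurable_sets[OF u A] by (intro Some_image_borel) simp
  ultimately show "case_option c u -` A \<inter> space borel \<in> sets borel"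
    using sets.insert_in_sets[OF sets_None] by auto
qed simp

declare sets_auxiliary_kernel [measurable_cong]

context supercritical_BMC
begin

text \<open>\<open>case_option 0 u\<close> extends \<open>u\<close> by 0 at the cemetery, matching
  the marginals, in which images under \<open>Some\<close> avoid \<open>None\<close>. The formula
  passes from sets to functions by monotone approximation.\<close>

lemma nn_integral_auxiliary_kernel:
  fixes u :: "'a \<Rightarrow> ennreal"
  assumes "u \<in> borel_measurable borel"
  shows "(\<integral>\<^sup>+y. u y \<partial>auxiliary_kernel m P x) = ennreal (1 / m) *
    ((\<integral>\<^sup>+v. case_option 0 u (fst v) \<partial>P (Some x)) + (\<integral>\<^sup>+v. case_option 0 u (snd v) \<partial>P (Some x)))"
  using assms
proof (induction rule: borel_measurable_induct)
  case (cong f g)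
  then have fg: "f = g" by auto
  show ?case unfolding fg by fact
next
  case (set A)
  have [measurable]: "Some ` A \<in> sets borel" by (rule Some_image_borel[OF set])
  have ext: "case_option 0 (indicator A) y = (indicator (Some ` A) y :: ennreal)" for y
    by (cases y) (auto simp: indicator_def)
  have "(\<integral>\<^sup>+v. indicator (Some ` A) (fst v) \<partial>P (Some x)) = (\<integral>\<^sup>+v. indicator (Some ` A \<times> UNIV) v \<partial>P (Some x))"
    "(\<integral>\<^sup>+v. indicator (Some ` A) (snd v) \<partial>P (Some x)) = (\<integral>\<^sup>+v. indicator (UNIV \<times> Some ` A) v \<partial>P (Some x))"
    by (auto intro!: nn_integral_cong simp: indicator_def)
  moreover have "Some ` A \<times> UNIV \<in> sets (P (Some x))" "UNIV \<times> Some ` A \<in> sets (P (Some x))"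
    by auto
  ultimately show ?case
    using set unfolding ext
    by (simp add: emeasure_auxiliary_kernel[OF kernel] first_marginal_def second_marginal_def)
next
  case (mult u c)
  have [measurable]: "case_option 0 u \<in> borel_measurable borel"
    by (rule measurable_case_option_borel[OF mult(2)])
  have ext: "case_option 0 (\<lambda>y. c * u y) y = c * case_option 0 u y" for y
    by (cases y) auto
  show ?case
    unfolding ext using mult by (simp add: nn_integral_cmult distrib_left mult_ac)
next
  case (add u v)
  have [measurable]: "case_option 0 u \<in> borel_measurable borel" "case_option 0 v \<in> borel_measurable borel"
    using add measurable_case_option_borel by blast+
  have ext: "case_option 0 (\<lambda>y. v y + u y) y = case_option 0 v y + case_option 0 u y" for y
    by (cases y) auto
  show ?case
    unfolding ext using add by (simp add: nn_integral_add distrib_left add_ac)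
next
  case (seq U)
  have [measurable]: "case_option 0 (U i) \<in> borel_measurable borel" for i
    using seq measurable_case_option_borel by blast
  have ext: "case_option 0 (\<lambda>y. (SUP i. U i) y) y = (SUP i. case_option 0 (U i) y)" for y
    by (cases y) (auto simp: image_comp)
  have inc: "incseq (\<lambda>i. case_option 0 (U i) y)" for y
    using seq(3) by (cases y) (auto simp: incseq_def le_fun_def)
  have inc_int: "incseq (\<lambda>i. \<integral>\<^sup>+v. case_option 0 (U i) (p v) \<partial>P (Some x))" for p
    using inc by (auto simp: incseq_def intro!: nn_integral_mono)
  have "(\<integral>\<^sup>+y. (SUP i. U i) y \<partial>auxiliary_kernel m P x) = (SUP i. \<integral>\<^sup>+y. U i y \<partial>auxiliary_kernel m P x)"
    using seq by (simp add: nn_integral_monotone_convergence_SUP image_comp)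
  also have "\<dots> = (SUP i. ennreal (1 / m) * ((\<integral>\<^sup>+v. case_option 0 (U i) (fst v) \<partial>P (Some x)) +
      (\<integral>\<^sup>+v. case_option 0 (U i) (snd v) \<partial>P (Some x))))"
    using seq by simp
  also have "\<dots> = ennreal (1 / m) * ((SUP i. \<integral>\<^sup>+v. case_option 0 (U i) (fst v) \<partial>P (Some x)) +
      (SUP i. \<integral>\<^sup>+v. case_option 0 (U i) (snd v) \<partial>P (Some x)))"
    by (simp add: SUP_mult_left_ennreal[symmetric] ennreal_SUP_add inc_int)
  also have "(SUP i. \<integral>\<^sup>+v. case_option 0 (U i) (fst v) \<partial>P (Some x)) = (\<integral>\<^sup>+v. case_option 0 (SUP i. U i) (fst v) \<partial>P (Some x))"
    unfolding ext using inc by (intro nn_integral_monotone_convergence_SUP[symmetric]) (auto simp: incseq_def le_fun_def)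
  also have "(SUP i. \<integral>\<^sup>+v. case_option 0 (U i) (snd v) \<partial>P (Some x)) = (\<integral>\<^sup>+v. case_option 0 (SUP i. U i) (snd v) \<partial>P (Some x))"
    unfolding ext using inc by (intro nn_integral_monotone_convergence_SUP[symmetric]) (auto simp: incseq_def le_fun_def)
  finally show ?case .
qed

lemma finite_measure_auxiliary_kernel: "finite_measure (auxiliary_kernel m P x)"
proof (rule finite_measureI)
  interpret Px: prob_space "P (Some x)" by (rule prob_space_kernel)
  have "space (auxiliary_kernel m P x) = UNIV"
    using sets_eq_imp_space_eq[OF sets_auxiliary_kernel] by simp
  then show "emeasure (auxiliary_kernel m P x) (space (auxiliary_kernel m P x)) \<noteq> \<infinity>"
    by (simp add: emeasure_auxiliary_kernel[OF kernel] first_marginal_def second_marginal_def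
        ennreal_mult_eq_top_iff)
qed

lemma integral_auxiliary_kernel_nonneg:
  assumes h: "h \<in> borel_measurable borel" "\<And>x. 0 \<le> h x" "\<And>x. \<bar>h x\<bar> \<le> b * alive x"
  shows "(\<integral>y. h (Some y) \<partial>auxiliary_kernel m P x) = offspring_op h (Some x)"
proof -
  note [measurable] = h(1)
  interpret Px: prob_space "P (Some x)" by (rule prob_space_kernel)
  have b: "b \<ge> 0" "\<And>x. \<bar>h x\<bar> \<le> b" "h None = 0"
    using bounded_of_alive_bound[OF h(3)] by blast+
  have int: "integrable (P (Some x)) (\<lambda>v. h (fst v))" "integrable (P (Some x)) (\<lambda>v. h (snd v))"
    using b by (intro Px.integrable_const_bound[of _ b]; simp)+
  have ext: "case_option 0 (\<lambda>y. ennreal (h (Some y))) y = ennreal (h y)" for y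
    using b by (cases y) auto
  have "(\<integral>y. h (Some y) \<partial>auxiliary_kernel m P x) = enn2real (\<integral>\<^sup>+y. ennreal (h (Some y)) \<partial>auxiliary_kernel m P x)"
    using h by (intro integral_eq_nn_integral) (auto intro: measurable_compose[OF measurable_Some_borel])
  also have "\<dots> = enn2real (ennreal (1 / m) *
      ((\<integral>\<^sup>+v. ennreal (h (fst v)) \<partial>P (Some x)) + (\<integral>\<^sup>+v. ennreal (h (snd v)) \<partial>P (Some x))))"
    by (subst nn_integral_auxiliary_kernel) (auto simp: ext)
  also have "\<dots> = 1 / m * ((\<integral>v. h (fst v) \<partial>P (Some x)) + (\<integral>v. h (snd v) \<partial>P (Some x)))"
    using int h(2) super_critical
    by (simp add: nn_integral_eq_integral ennreal_plus[symmetric] ennreal_mult[symmetric] del: ennreal_plus)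
  also have "\<dots> = offspring_op h (Some x)"
    using int by (simp add: offspring_op_def kernel_op_def daughters_def case_prod_beta')
  finally show ?thesis .
qed

lemma offspring_op_diff:
  assumes h: "h \<in> borel_measurable borel" "\<And>x. \<bar>h x\<bar> \<le> b"
    and h': "h' \<in> borel_measurable borel" "\<And>x. \<bar>h' x\<bar> \<le> b"
  shows "offspring_op (\<lambda>x. h x - h' x) x = offspring_op h x - offspring_op h' x"
proof -
  note [measurable] = h(1) h'(1)
  have "integrable (P x) (\<lambda>v. daughters h (x, v))" "integrable (P x) (\<lambda>v. daughters h' (x, v))"
    using abs_daughters_le[OF h(2)] abs_daughters_le[OF h'(2)] by (auto intro!: integrable_kernel)
  moreover have "daughters (\<lambda>x. h x - h' x) u = daughters h u - daughters h' u" for u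
    by (auto simp: daughters_def split: prod.split)
  ultimately show ?thesis
    by (simp add: offspring_op_def kernel_op_def diff_divide_distrib)
qed

text \<open>Both sides are linear in \<open>h\<close>, so positive and negative parts reduce the
  claim to \<open>integral_auxiliary_kernel_nonneg\<close>. This is the bridge from the chain
  \<open>Y\<close> to \<open>offspring_op\<close>.\<close>

lemma integral_auxiliary_kernel:
  assumes h: "h \<in> borel_measurable borel" "\<And>x. \<bar>h x\<bar> \<le> b * alive x"
  shows "(\<integral>y. h (Some y) \<partial>auxiliary_kernel m P x) = offspring_op h (Some x)"
proof -
  note [measurable] = h(1)
  interpret Q: finite_measure "auxiliary_kernel m P x" by (rule finite_measure_auxiliary_kernel)
  have b: "b \<ge> 0" "\<And>x. \<bar>h x\<bar> \<le> b" "h None = 0"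
    using bounded_of_alive_bound[OF h(2)] by blast+
  define hp where "hp x = max (h x) 0" for x
  define hn where "hn x = max (- h x) 0" for x
  have [measurable]: "hp \<in> borel_measurable borel" "hn \<in> borel_measurable borel"
    unfolding hp_def[abs_def] hn_def[abs_def] by measurable
  have bd: "0 \<le> hp x" "0 \<le> hn x" "\<bar>hp x\<bar> \<le> b * alive x" "\<bar>hn x\<bar> \<le> b * alive x" "\<bar>hp x\<bar> \<le> b" "\<bar>hn x\<bar> \<le> b" for x
    using h(2)[of x] b(2)[of x] by (auto simp: hp_def hn_def)
  have eq: "h = (\<lambda>x. hp x - hn x)" by (auto simp: hp_def hn_def)
  have "integrable (auxiliary_kernel m P x) (\<lambda>y. hp (Some y))" "integrable (auxiliary_kernel m P x) (\<lambda>y. hn (Some y))"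
    using bd by (auto intro!: Q.integrable_const_bound[of _ b] measurable_compose[OF measurable_Some_borel]
        simp: measurable_cong_sets[OF sets_auxiliary_kernel refl])
  then have "(\<integral>y. h (Some y) \<partial>auxiliary_kernel m P x) =
      (\<integral>y. hp (Some y) \<partial>auxiliary_kernel m P x) - (\<integral>y. hn (Some y) \<partial>auxiliary_kernel m P x)"
    by (simp add: eq)
  also have "\<dots> = offspring_op hp (Some x) - offspring_op hn (Some x)"
    using bd by (simp add: integral_auxiliary_kernel_nonneg[of _ b])
  also have "\<dots> = offspring_op h (Some x)"
    unfolding eq using bd by (simp add: offspring_op_diff[of _ b])
  finally show ?thesis .
qed

text \<open>One step of the chain replaces \<open>h\<close> at time \<open>r + 1\<close> by
  \<open>offspring_op h\<close> at time \<open>r\<close>; hence the induction is over all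
  \<open>h\<close>.\<close>

lemma offspring_op_iterate_chain:
  assumes Y: "Markov_chain N (return borel x) (auxiliary_kernel m P) Y"
    and h: "h \<in> borel_measurable borel" "\<And>x. \<bar>h x\<bar> \<le> b * alive x"
  shows "(\<integral>w. h (Some (Y r w)) \<partial>N) = (offspring_op ^^ r) h (Some x)"
  using h
proof (induction r arbitrary: h)
  case 0
  note [measurable] = 0(1)
  have Y0: "Y 0 \<in> N \<rightarrow>\<^sub>M borel" "distr N borel (Y 0) = return borel x"
    using Y by (auto simp: Markov_chain_def)
  have "(\<integral>w. h (Some (Y 0 w)) \<partial>N) = (\<integral>y. h (Some y) \<partial>distr N borel (Y 0))"
    using Y0(1) by (subst integral_distr) auto
  also have "\<dots> = h (Some x)"
    unfolding Y0(2) by (subst integral_return) auto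
  finally show ?case by simp
next
  case (Suc r)
  note [measurable] = Suc(2)
  interpret N: prob_space N using Y by (simp add: Markov_chain_def)
  have [measurable]: "Y n \<in> N \<rightarrow>\<^sub>M borel" for n
    using Y by (auto simp: Markov_chain_def)
  interpret finite_measure_subalgebra N "generated_algebra N Y {..r}"
    by unfold_locales (rule subalgebra_generated_algebra, simp)
  have b: "b \<ge> 0" "\<And>x. \<bar>h x\<bar> \<le> b" "h None = 0"
    using bounded_of_alive_bound[OF Suc(3)] by blast+
  have "(\<lambda>y. h (Some y)) \<in> borel_measurable borel" "bounded (range (\<lambda>y. h (Some y)))"
    using b by (auto simp: bounded_iff)
  then have AE: "AE w in N. real_cond_exp N (generated_algebra N Y {..r}) (\<lambda>w. h (Some (Y (Suc r) w))) w =
      (\<integral>y. h (Some y) \<partial>auxiliary_kernel m P (Y r w))"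
    by (rule Y[unfolded Markov_chain_def, THEN conjunct2, THEN conjunct2, THEN conjunct2,
        THEN bspec[of _ _ "\<lambda>y. h (Some y)"], THEN mp, THEN spec])
  have "integrable N (\<lambda>w. h (Some (Y (Suc r) w)))"
    using b by (intro N.integrable_const_bound[of _ b]) auto
  from real_cond_exp_int(2)[OF this]
  have "(\<integral>w. h (Some (Y (Suc r) w)) \<partial>N) =
      (\<integral>w. real_cond_exp N (generated_algebra N Y {..r}) (\<lambda>w. h (Some (Y (Suc r) w))) w \<partial>N)" ..
  also have "\<dots> = (\<integral>w. offspring_op h (Some (Y r w)) \<partial>N)"
    using AE by (intro integral_cong_AE) (auto simp: integral_auxiliary_kernel[OF Suc(2,3)])
  also have "\<dots> = (offspring_op ^^ r) (offspring_op h) (Some x)"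
    using Suc.prems by (intro Suc.IH) (auto intro: abs_offspring_op_le)
  finally show ?case by (simp add: funpow_swap1)
qed

end

section \<open>Extinction\<close>

locale supercritical_limit = supercritical_BMC M \<nu> P X p10 p0 p1 m
  for M :: "'w measure" and \<nu> :: "'a::topological_space option measure" and P X p10 p0 p1 m +
  fixes W :: "'w \<Rightarrow> real"
  assumes W_measurable [measurable]: "W \<in> borel_measurable M"
    and W_AE: "AE w in M. (\<lambda>q. total alive q w / m ^ q) \<longlonglongrightarrow> W w"
    and W_L2: "(\<lambda>q. \<integral>\<^sup>+w. ennreal ((total alive q w / m ^ q - W w)\<^sup>2) \<partial>M) \<longlonglongrightarrow> 0"
begin

abbreviation survives :: "nat \<Rightarrow> 'w \<Rightarrow> real"
  where "survives k w \<equiv> of_bool (total alive k w > 0)"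

abbreviation W_nonzero :: "'w \<Rightarrow> real"
  where "W_nonzero w \<equiv> of_bool (W w \<noteq> 0)"

definition pgf :: "real \<Rightarrow> real"
  where "pgf s = p10 * s\<^sup>2 + (p0 + p1) * s + (1 - p10 - p0 - p1)"

lemma total_alive_nonneg: "0 \<le> total alive k w"
  by (simp add: total_alive)

lemma W_nonneg: "AE w in M. 0 \<le> W w"
  using W_AE
proof eventually_elim
  case (elim w)
  then show ?case
    using super_critical total_alive_nonneg by (intro LIMSEQ_le_const[OF elim]) auto
qed

text \<open>The normalised sizes have mean 1, hence second moment at least 1. If \<open>W\<close>
  were 0 almost surely, this would contradict the convergence in mean square.\<close>

lemma W_not_AE_0: "\<not> (AE w in M. W w = 0)"
proof
  assume W0: "AE w in M. W w = 0"
  have "1 \<le> (\<integral>\<^sup>+w. ennreal ((total alive q w / m ^ q - W w)\<^sup>2) \<partial>M)" for q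
  proof -
    define v where "v w = total alive q w / m ^ q" for w
    define B where "B = real (card (generation q)) * 1 / m ^ q"
    have v: "\<bar>v w\<bar> \<le> B" for w
      using abs_total_le[of alive 1 q] super_critical
      by (auto simp: v_def B_def abs_divide intro!: divide_right_mono)
    have [measurable]: "v \<in> borel_measurable M" unfolding v_def[abs_def] by measurable
    have int: "integrable M v" using v by (intro integrable_const_bound[of _ B]) auto
    have int2: "integrable M (\<lambda>w. (v w)\<^sup>2)"
      using power_mono[OF v abs_ge_zero, of _ 2] by (intro integrable_const_bound[of _ "B\<^sup>2"]) auto
    have "(\<integral>w. v w \<partial>M) = 1"
      using super_critical by (simp add: v_def expectation_total_alive)
    moreover have "0 \<le> (\<integral>w. (v w)\<^sup>2 \<partial>M) - (\<integral>w. v w \<partial>M)\<^sup>2"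
      unfolding variance_eq[OF int int2, symmetric] by (rule variance_positive)
    ultimately have "1 \<le> (\<integral>w. (v w)\<^sup>2 \<partial>M)" by simp
    then have "1 \<le> ennreal (\<integral>w. (v w)\<^sup>2 \<partial>M)"
      by (metis ennreal_1 ennreal_leI)
    also have "\<dots> = (\<integral>\<^sup>+w. ennreal ((v w)\<^sup>2) \<partial>M)"
      using int2 by (simp add: nn_integral_eq_integral)
    also have "\<dots> = (\<integral>\<^sup>+w. ennreal ((v w - W w)\<^sup>2) \<partial>M)"
      using W0 by (intro nn_integral_cong_AE) auto
    finally show ?thesis by (simp add: v_def)
  qed
  then have "1 \<le> (0::ennreal)"
    by (intro LIMSEQ_le_const[OF W_L2]) auto
  then show False by simp
qed

text \<open>Weight 1 for the dead and \<open>s\<close> for the living turns the power into a product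
  over the generation. The kernel sends the weight with parameter \<open>s\<close> to that with
  parameter \<open>pgf s\<close>, so removing the last generation applies \<open>pgf\<close> once to
  the argument.\<close>

lemma expectation_power_alive:
  "(\<integral>w. s ^ card (living_generation X k w) \<partial>M) = (pgf ^^ k) s"
proof -
  define wt where "wt s x = (if x = None then 1 else s)" for s :: real and x :: "'a option"
  have wt_m [measurable]: "wt s \<in> borel_measurable borel" for s
  proof -
    have "wt s = (\<lambda>x. 1 + (s - 1) * alive x)" by (auto simp: wt_def alive_def)
    then show ?thesis by simp
  qed
  have wt_b: "\<bar>wt s x\<bar> \<le> max 1 \<bar>s\<bar>" for s x by (auto simp: wt_def)
  have prod_wt: "(\<Prod>i\<in>generation k. wt s (X i w)) = s ^ card (living_generation X k w)" for s k w
  proof -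
    have "(\<Prod>i\<in>generation k. wt s (X i w)) = (\<Prod>i\<in>generation k. if X i w \<noteq> None then s else 1)"
      by (auto simp: wt_def intro!: prod.cong)
    also have "\<dots> = (\<Prod>i\<in>{i\<in>generation k. X i w \<noteq> None}. s)"
      by (rule prod.inter_filter[symmetric]) simp
    also have "{i\<in>generation k. X i w \<noteq> None} = living_generation X k w"
      by (auto simp: living_generation_def living_def)
    finally show ?thesis by simp
  qed
  define g where "g s = (\<lambda>(x :: 'a option, y, z). wt s y * wt s z)" for s
  have g: "g s \<in> borel_measurable triple_borel" "bounded (range (g s))" for s
  proof -
    show "g s \<in> borel_measurable triple_borel" unfolding g_def by measurable
    have "\<bar>g s u\<bar> \<le> max 1 \<bar>s\<bar> * max 1 \<bar>s\<bar>" for u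
      unfolding g_def by (auto simp: abs_mult split: prod.split intro!: mult_mono wt_b)
    then show "bounded (range (g s))" by (auto simp: bounded_iff)
  qed
  have op: "kernel_op P (g s) x = wt (pgf s) x" for s x
  proof (cases x)
    case None
    then show ?thesis using kernel_op_None[OF g(1)] by (simp add: g_def wt_def)
  next
    case (Some y)
    have "g s = (\<lambda>(x, y, z). (\<lambda>u v. (if u then s else 1) * (if v then s else 1)) (y \<noteq> None) (z \<noteq> None))"
      by (auto simp: g_def wt_def)
    then show ?thesis
      using Some kernel_op_status[of "\<lambda>u v. (if u then s else 1) * (if v then s else 1)" y]
      by (simp add: wt_def pgf_def power2_eq_square algebra_simps)
  qed
  have "(\<integral>w. (\<Prod>i\<in>generation k. wt s (X i w)) \<partial>M) = (pgf ^^ k) s"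
  proof (induction k arbitrary: s)
    case 0
    have "(\<integral>w. (\<Prod>i\<in>generation 0. wt s (X i w)) \<partial>M) = (\<integral>w. s \<partial>M)"
    proof (rule integral_cong_AE)
      show "AE w in M. (\<Prod>i\<in>generation 0. wt s (X i w)) = s"
        using AE_root_alive by eventually_elim (simp add: generation_0 wt_def del: not_None_eq)
    qed simp_all
    then show ?case by (simp add: prob_space)
  next
    case (Suc k)
    have gen: "(\<Prod>i\<in>generation (Suc k). wt s (X i w)) = (\<Prod>i\<in>generation k. g s (triple X i w))" for w
      unfolding prod_generation_Suc by (simp add: g_def triple_def)
    have "(\<integral>w. (\<Prod>i\<in>generation (Suc k). wt s (X i w)) \<partial>M) = (\<integral>w. (\<Prod>i\<in>generation k. wt (pgf s) (X i w)) \<partial>M)"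
      unfolding gen using Markov_product[of "\<lambda>_. 1" k 1 "\<lambda>_. g s"] g by (simp add: op)
    then show ?case using Suc by (simp add: funpow_swap1)
  qed
  then show ?thesis by (simp add: prod_wt)
qed

lemma probabilities: "0 \<le> p10" "0 \<le> p0" "0 \<le> p1" "p10 + p0 + p1 \<le> 1" "1 - p10 - p0 - p1 < p10"
proof -
  fix x :: 'a
  interpret Px: prob_space "P (Some x)" by (rule prob_space_kernel)
  show "0 \<le> p10" "0 \<le> p0" "0 \<le> p1"
    using homogeneous by (auto simp: spatially_homogeneous_def)
  have "kernel_op P (\<lambda>(x, y, z). of_bool (y = None \<and> z = None)) (Some x) \<ge> 0"
    unfolding kernel_op_def by (rule integral_nonneg_AE) auto
  then show "p10 + p0 + p1 \<le> 1"
    using kernel_op_status[of "\<lambda>u v. of_bool (\<not> u \<and> \<not> v)" x] by simp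
  \<comment> \<open>This is \<open>m > 1\<close> rearranged; with the other bounds it gives
    \<open>p10 > 0\<close> and an extinction probability below 1.\<close>
  show "1 - p10 - p0 - p1 < p10" using super_critical m_def by simp
qed

text \<open>The root of \<open>pgf s = s\<close> other than 1: the difference
  \<open>pgf s - s\<close> factors as
  \<open>(1 - s) * (1 - p10 - p0 - p1 - p10 * s)\<close>.\<close>

definition extinction_probability :: real
  where "extinction_probability = (1 - p10 - p0 - p1) / p10"

text \<open>With \<open>q\<close> the limit,
  \<open>pgf u - q = (u - q) * (1 - p10 * (1 - u))\<close>. The interval from 0 to
  \<open>s0 = max s q\<close> is mapped into itself, and there the distance to \<open>q\<close>
  shrinks by the factor \<open>\<rho> < 1\<close>.\<close>

lemma pgf_iterates_tendsto:
  assumes s: "0 \<le> s" "s < 1"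
  shows "(\<lambda>k. (pgf ^^ k) s) \<longlonglongrightarrow> extinction_probability"
proof -
  define q where "q = extinction_probability"
  define a where "a = 1 - p10 - p0 - p1"
  have p: "0 \<le> a" "a < p10" "p10 > 0" "p0 + p1 = 1 - a - p10" "0 \<le> p0 + p1" using probabilities by (auto simp: a_def)
  have q: "0 \<le> q" "q < 1" "p10 * q = a" using p by (auto simp: q_def extinction_probability_def a_def)
  define s0 where "s0 = max s q"
  have s0: "0 \<le> s0" "s0 < 1" "s \<le> s0" "q \<le> s0" using s q by (auto simp: s0_def)
  define \<rho> where "\<rho> = 1 - p10 * (1 - s0)"
  have pgf: "pgf u = p10 * u\<^sup>2 + (1 - a - p10) * u + a" for u by (simp add: pgf_def a_def p(4)[symmetric])
  have p10_le: "p10 \<le> 1" using probabilities by linarith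
  have \<rho>: "0 \<le> \<rho>" "\<rho> < 1"
  proof -
    have "p10 * (1 - s0) \<le> 1 * 1" using p p10_le s0 by (intro mult_mono) auto
    moreover have "p10 * (1 - s0) > 0" using p s0 by simp
    ultimately show "0 \<le> \<rho>" "\<rho> < 1" by (auto simp: \<rho>_def)
  qed
  have step: "0 \<le> pgf u \<and> pgf u \<le> s0 \<and> \<bar>pgf u - q\<bar> \<le> \<rho> * \<bar>u - q\<bar>" if u: "0 \<le> u" "u \<le> s0" for u
  proof (intro conjI)
    have nn: "0 \<le> 1 - a - p10" using p by simp
    show "0 \<le> pgf u" unfolding pgf using u p nn by simp
    have "pgf u \<le> pgf s0"
      unfolding pgf using u p nn by (intro add_mono mult_left_mono power_mono) auto
    also have "pgf s0 - s0 = (1 - s0) * (a - p10 * s0)"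
      by (simp add: pgf power2_eq_square algebra_simps)
    then have "pgf s0 \<le> s0"
      using s0 p q mult_left_mono[OF s0(4), of p10] mult_nonneg_nonpos[of "1 - s0" "a - p10 * s0"] by linarith
    finally show "pgf u \<le> s0" .
    have "pgf u - q = (u - q) * (1 - p10 * (1 - u))"
      unfolding pgf q(3)[symmetric] by (simp add: power2_eq_square algebra_simps)
    moreover have "\<bar>1 - p10 * (1 - u)\<bar> \<le> \<rho>"
    proof -
      have "p10 * (1 - u) \<le> 1 * 1" using p p10_le u s0 by (intro mult_mono) auto
      moreover have "p10 * (1 - s0) \<le> p10 * (1 - u)" using p u by (intro mult_left_mono) auto
      ultimately show ?thesis by (auto simp: \<rho>_def)
    qed
    ultimately show "\<bar>pgf u - q\<bar> \<le> \<rho> * \<bar>u - q\<bar>"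
      by (simp add: abs_mult mult.commute[of \<rho>] mult_left_mono)
  qed
  have it: "0 \<le> (pgf ^^ k) s \<and> (pgf ^^ k) s \<le> s0 \<and> \<bar>(pgf ^^ k) s - q\<bar> \<le> \<rho> ^ k * \<bar>s - q\<bar>" for k
  proof (induction k)
    case (Suc k)
    then have "\<rho> * \<bar>(pgf ^^ k) s - q\<bar> \<le> \<rho> * (\<rho> ^ k * \<bar>s - q\<bar>)"
      using \<rho> by (intro mult_left_mono) auto
    then show ?case using step[of "(pgf ^^ k) s"] Suc by auto
  qed (use s s0 in auto)
  have "(\<lambda>k. \<rho> ^ k * \<bar>s - q\<bar>) \<longlonglongrightarrow> 0"
    using \<rho> by (intro tendsto_mult_left_zero LIMSEQ_power_zero) auto
  then have "(\<lambda>k. (pgf ^^ k) s - q) \<longlonglongrightarrow> 0"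
    by (rule Lim_null_comparison[rotated]) (use it in auto)
  then show ?thesis by (simp add: q_def LIM_zero_iff)
qed

lemma laplace_tendsto:
  assumes "l \<ge> 0"
  shows "(\<lambda>n. \<integral>w. exp (- l * (total alive n w / m ^ n)) \<partial>M) \<longlonglongrightarrow> (\<integral>w. exp (- l * W w) \<partial>M)"
proof (rule integral_dominated_convergence[where w="\<lambda>_. 1"])
  show "AE w in M. (\<lambda>n. exp (- l * (total alive n w / m ^ n))) \<longlonglongrightarrow> exp (- l * W w)"
    using W_AE by eventually_elim (intro tendsto_intros)
  show "AE w in M. norm (exp (- l * (total alive n w / m ^ n))) \<le> 1" for n
    using assms super_critical total_alive_nonneg by auto
qed auto

text \<open>The Laplace transform of \<open>W\<close> satisfies Poincare's equation; iterating it identifies the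
  atom of \<open>W\<close> at \<open>0\<close> with the extinction probability.\<close>

lemma laplace_functional_equation:
  assumes "l \<ge> 0"
  shows "(\<integral>w. exp (- (m * l) * W w) \<partial>M) = pgf (\<integral>w. exp (- l * W w) \<partial>M)"
proof (rule LIMSEQ_unique)
  let ?\<phi> = "\<lambda>n. (\<integral>w. exp (- l * (total alive n w / m ^ n)) \<partial>M)"
  have eq: "(\<integral>w. exp (- l' * (total alive n w / m ^ n)) \<partial>M) = (pgf ^^ n) (exp (- (l' / m ^ n)))" for n l'
    unfolding expectation_power_alive[symmetric]
    by (simp add: total_alive exp_of_nat_mult[symmetric] mult_ac)
  \<comment> \<open>Passing from generation \<open>n\<close> to \<open>n + 1\<close> while
    \<open>l\<close> becomes \<open>m * l\<close> leaves the argument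
    \<open>exp (- (l / m ^ n))\<close> unchanged and adds one application of
    \<open>pgf\<close>.\<close>
  have "(\<integral>w. exp (- (m * l) * (total alive (Suc n) w / m ^ Suc n)) \<partial>M) =
      pgf (?\<phi> n)" for n
    unfolding eq using super_critical by simp
  then have *: "(\<lambda>n. pgf (?\<phi> n)) \<longlonglongrightarrow> (\<integral>w. exp (- (m * l) * W w) \<partial>M)"
    using LIMSEQ_Suc[OF laplace_tendsto[of "m * l"]] assms super_critical by simp
  show "(\<lambda>n. pgf (?\<phi> n)) \<longlonglongrightarrow> (\<integral>w. exp (- (m * l) * W w) \<partial>M)"
    by (rule *)
  show "(\<lambda>n. pgf (?\<phi> n)) \<longlonglongrightarrow> pgf (\<integral>w. exp (- l * W w) \<partial>M)"
    unfolding pgf_def by (intro tendsto_intros laplace_tendsto assms)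
qed

text \<open>The Laplace transform along \<open>m ^ k\<close> has two descriptions: by the functional
  equation it is an iterate of \<open>pgf\<close> started below 1, and by dominated convergence it
  tends to the mass at 0.\<close>

lemma prob_W_eq_0: "(\<integral>w. of_bool (W w = 0) \<partial>M) = extinction_probability"
proof (rule LIMSEQ_unique)
  define \<phi> where "\<phi> l = (\<integral>w. exp (- l * W w) \<partial>M)" for l
  have int: "integrable M (\<lambda>w. exp (- W w))"
    using W_nonneg by (intro integrable_const_bound[of _ 1]) auto
  have "0 \<le> \<phi> 1" unfolding \<phi>_def by (intro integral_nonneg_AE) auto
  moreover have "\<phi> 1 < 1"
  proof (rule ccontr)
    assume "\<not> \<phi> 1 < 1"
    moreover have "(\<integral>w. 1 - exp (- W w) \<partial>M) = 1 - \<phi> 1"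
      using int by (simp add: \<phi>_def prob_space)
    moreover have nn: "AE w in M. 0 \<le> 1 - exp (- W w)"
      using W_nonneg by eventually_elim simp
    ultimately have "(\<integral>w. 1 - exp (- W w) \<partial>M) = 0"
      using integral_nonneg_AE[OF nn] by linarith
    then have "AE w in M. 1 - exp (- W w) = 0"
      using int by (subst (asm) integral_nonneg_eq_0_iff_AE[OF _ nn]) auto
    then have "AE w in M. W w = 0" by eventually_elim simp
    then show False using W_not_AE_0 by simp
  qed
  moreover have "\<phi> (m ^ k) = (pgf ^^ k) (\<phi> 1)" for k
  proof (induction k)
    case (Suc k)
    then show ?case
      using laplace_functional_equation[of "m ^ k"] super_critical by (simp add: \<phi>_def)
  qed simp
  ultimately show "(\<lambda>k. \<phi> (m ^ k)) \<longlonglongrightarrow> extinction_probability"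
    using pgf_iterates_tendsto by simp
  show "(\<lambda>k. \<phi> (m ^ k)) \<longlonglongrightarrow> (\<integral>w. of_bool (W w = 0) \<partial>M)"
    unfolding \<phi>_def
  proof (rule integral_dominated_convergence[where w="\<lambda>_. 1"])
    show "AE w in M. (\<lambda>k. exp (- (m ^ k) * W w)) \<longlonglongrightarrow> of_bool (W w = 0)"
      using W_nonneg
    proof eventually_elim
      case (elim w)
      show ?case
      proof (cases "W w = 0")
        case False
        with elim have "0 < W w" by simp
        then have "filterlim (\<lambda>k. W w * m ^ k) at_top sequentially"
          using super_critical
          by (intro filterlim_tendsto_pos_mult_at_top[OF tendsto_const]
              filterlim_at_infinity_imp_filterlim_at_top filterlim_realpow_sequentially_gt1 always_eventually) auto
        then have "(\<lambda>k. exp (- (W w * m ^ k))) \<longlonglongrightarrow> 0"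
          by (intro filterlim_compose[OF exp_at_bot] filterlim_compose[OF filterlim_uminus_at_bot_at_top])
        then show ?thesis using False by (simp add: mult.commute)
      qed simp
    qed
    show "AE w in M. norm (exp (- (m ^ k) * W w)) \<le> 1" for k
      using W_nonneg by eventually_elim (use super_critical in auto)
  qed auto
qed

text \<open>Where \<open>W\<close> is nonzero the population is eventually never empty, so one half
  of the symmetric difference is negligible. The other half follows by comparing probabilities:
  extinction up to generation \<open>k\<close> has a probability tending to that of
  \<open>W = 0\<close>.\<close>

lemma survival_tendsto:
  "(\<lambda>k. \<integral>w. \<bar>survives k w - W_nonzero w\<bar> \<partial>M) \<longlonglongrightarrow> (0::real)"
proof -
  let ?a = "\<lambda>k. (\<integral>w. of_bool (total alive k w = 0) \<partial>M) :: real"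
  let ?b = "\<lambda>k. (\<integral>w. of_bool (W w \<noteq> 0 \<and> total alive k w = 0) \<partial>M) :: real"
  let ?d = "\<lambda>k w. \<bar>survives k w - W_nonzero w\<bar>"
  have "(\<lambda>k. \<integral>w. of_bool (total alive k w = 0) \<partial>M) \<longlonglongrightarrow> extinction_probability"
  proof -
    have "?a k = (pgf ^^ k) 0" for k
      unfolding expectation_power_alive[symmetric]
      by (intro Bochner_Integration.integral_cong) (auto simp: total_alive of_bool_def power_0_left)
    then show ?thesis using pgf_iterates_tendsto[of 0] by simp
  qed
  moreover have "(\<lambda>k. \<integral>w. of_bool (W w \<noteq> 0 \<and> total alive k w = 0) \<partial>M) \<longlonglongrightarrow> (\<integral>w. 0 \<partial>M :: real)"
  proof (rule integral_dominated_convergence[where w="\<lambda>_. 1"])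
    show "AE w in M. (\<lambda>k. of_bool (W w \<noteq> 0 \<and> total alive k w = 0)) \<longlonglongrightarrow> (0::real)"
      using W_AE
    proof eventually_elim
      case (elim w)
      show ?case
      proof (cases "W w = 0")
        case False
        have "\<forall>\<^sub>F k in sequentially. total alive k w / m ^ k \<noteq> 0"
          by (rule tendsto_imp_eventually_ne[OF elim False])
        then have "\<forall>\<^sub>F k in sequentially. of_bool (W w \<noteq> 0 \<and> total alive k w = 0) = (0::real)"
          by eventually_elim auto
        then show ?thesis by (rule tendsto_eventually)
      qed simp
    qed
  qed auto
  ultimately have "(\<lambda>k. extinction_probability - ?a k +
      2 * ?b k) \<longlonglongrightarrow>
      extinction_probability - extinction_probability + 2 * (\<integral>w. 0 \<partial>M)"
    by (intro tendsto_intros)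
  moreover have "extinction_probability - ?a k +
      2 * ?b k =
      (\<integral>w. ?d k w \<partial>M)" for k
  proof -
    \<comment> \<open>A pointwise identity, by the four cases: the symmetric difference is the
      difference of the complementary indicators, corrected twice where \<open>W\<close> is nonzero
      and the population is empty.\<close>
    have "extinction_probability - ?a k +
        2 * ?b k =
        (\<integral>w. of_bool (W w = 0) - of_bool (total alive k w = 0) +
        2 * of_bool (W w \<noteq> 0 \<and> total alive k w = 0) \<partial>M)"
      unfolding prob_W_eq_0[symmetric] by (simp del: of_bool_conj)
    also have "\<dots> = (\<integral>w. ?d k w \<partial>M)"
      using total_alive_nonneg[of k] by (intro Bochner_Integration.integral_cong) (auto simp: order_less_le)
    finally show ?thesis .
  qed
  ultimately show ?thesis by simp
qed

end

section \<open>Conditional characteristic functions\<close>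

lemma abs_one_minus_exp_le:
  fixes u :: real
  assumes "0 \<le> u"
  shows "\<bar>(1 - u) - exp (- u)\<bar> \<le> u\<^sup>2"
proof -
  have "exp (- u) \<le> 1 / (1 + u)"
    using exp_ge_add_one_self[of u] assms by (simp add: exp_minus field_simps)
  also have "\<dots> \<le> 1 - u + u\<^sup>2"
  proof -
    have "(1 - u + u\<^sup>2) * (1 + u) = 1 + u ^ 3" by (simp add: algebra_simps power2_eq_square power3_eq_cube)
    then have "1 \<le> (1 - u + u\<^sup>2) * (1 + u)" using assms by simp
    then show ?thesis using assms by (simp add: divide_le_eq)
  qed
  finally show ?thesis using exp_ge_add_one_self[of "- u"] by simp
qed

lemma abs_exp_minus_diff_le:
  fixes x y :: real
  assumes "0 \<le> x" "0 \<le> y"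
  shows "\<bar>exp (- x) - exp (- y)\<bar> \<le> \<bar>x - y\<bar>"
proof -
  have *: "\<bar>exp (- x) - exp (- y)\<bar> \<le> y - x" if "0 \<le> x" "x \<le> y" for x y :: real
  proof -
    have "exp (- x) - exp (- y) = exp (- x) * (1 - exp (x - y))"
      by (simp add: algebra_simps flip: exp_add)
    moreover have "1 - exp (x - y) \<le> y - x"
      using exp_ge_add_one_self[of "x - y"] by linarith
    then have "exp (- x) * (1 - exp (x - y)) \<le> 1 * (y - x)"
      using that by (intro mult_mono) auto
    ultimately have "exp (- x) - exp (- y) \<le> y - x" by simp
    then show ?thesis using that by simp
  qed
  show ?thesis using *[of x y] *[of y x] assms by (cases "x \<le> y") auto
qed

section \<open>Taylor expansion for one triple and for a whole generation\<close>

context BMC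
begin

definition centred :: "('a family \<Rightarrow> real) \<Rightarrow> 'a family \<Rightarrow> real"
  where "centred f = (\<lambda>(x, y). f (x, y) - kernel_op P f x)"

definition kernel_variance :: "('a family \<Rightarrow> real) \<Rightarrow> 'a option \<Rightarrow> real"
  where "kernel_variance f x = kernel_op P (\<lambda>u. (f u)\<^sup>2) x - (kernel_op P f x)\<^sup>2"

text \<open>The value 1 at a dead mother makes her factor neutral in products over the whole
  generation.\<close>

definition kernel_char :: "('a family \<Rightarrow> real) \<Rightarrow> real \<Rightarrow> 'a family \<Rightarrow> complex"
  where "kernel_char f \<theta> = (\<lambda>(x, y). if x = None then 1 else iexp (\<theta> * centred f (x, y)))"

lemma measurable_centred [measurable]:
  assumes [measurable]: "f \<in> borel_measurable triple_borel"
  shows "centred f \<in> borel_measurable triple_borel"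
  unfolding centred_def by measurable

lemma measurable_kernel_variance [measurable]:
  assumes [measurable]: "f \<in> borel_measurable triple_borel"
  shows "kernel_variance f \<in> borel_measurable borel"
  unfolding kernel_variance_def[abs_def] by measurable

lemma measurable_kernel_char [measurable]:
  assumes [measurable]: "f \<in> borel_measurable triple_borel"
  shows "kernel_char f \<theta> \<in> borel_measurable triple_borel"
proof -
  have *: "kernel_char f \<theta> = (\<lambda>u. iexp (\<theta> * (alive (fst u) * centred f u)))"
    by (auto simp: kernel_char_def alive_def fun_eq_iff)
  show ?thesis unfolding * by measurable
qed

lemma norm_kernel_char: "norm (kernel_char f \<theta> u) = 1"
  by (auto simp: kernel_char_def split: prod.split)

context
  fixes f :: "'a family \<Rightarrow> real" and b :: real
  assumes f [measurable]: "f \<in> borel_measurable triple_borel" and b: "\<And>u. \<bar>f u\<bar> \<le> b"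
begin

lemma bound_nonneg: "0 \<le> b"
  using b abs_ge_zero order_trans by blast

lemma abs_centred_le: "\<bar>centred f u\<bar> \<le> 2 * b"
  using b[of u] abs_kernel_op_le[OF f b, of "fst u"] by (auto simp: centred_def split: prod.split)

lemma kernel_square_bound: "\<bar>(f u)\<^sup>2\<bar> \<le> b\<^sup>2"
  using power_mono[OF b[of u], of 2] by simp

lemma integrable_kernel_f: "integrable (P x) (\<lambda>y. f (x, y))" "integrable (P x) (\<lambda>y. (f (x, y))\<^sup>2)"
proof -
  show "integrable (P x) (\<lambda>y. f (x, y))"
    using integrable_kernel[OF f, of b] b by simp
  have "(\<lambda>u. (f u)\<^sup>2) \<in> borel_measurable triple_borel" by measurable
  from integrable_kernel[OF this, of "b\<^sup>2"] show "integrable (P x) (\<lambda>y. (f (x, y))\<^sup>2)"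
    using kernel_square_bound by simp
qed

lemma kernel_variance_eq: "kernel_variance f x = (\<integral>y. (centred f (x, y))\<^sup>2 \<partial>P x)"
proof -
  interpret Px: prob_space "P x" by (rule prob_space_kernel)
  show ?thesis
    using Px.variance_eq[OF integrable_kernel_f]
    by (simp add: kernel_variance_def centred_def kernel_op_def)
qed

lemma kernel_variance_bounds: "0 \<le> kernel_variance f x" "kernel_variance f x \<le> b\<^sup>2"
proof -
  show "0 \<le> kernel_variance f x"
    unfolding kernel_variance_eq by (rule integral_nonneg_AE) auto
  have "(\<lambda>u. (f u)\<^sup>2) \<in> borel_measurable triple_borel" by measurable
  from abs_kernel_op_le[OF this kernel_square_bound, of x] show "kernel_variance f x \<le> b\<^sup>2"
    by (simp add: kernel_variance_def abs_le_iff add_increasing2 diff_le_eq)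
qed

lemma kernel_variance_None: "kernel_variance f None = 0"
  by (simp add: kernel_variance_def kernel_op_None)

text \<open>Second-order Taylor expansion of the characteristic function of a centred variable
  bounded by \<open>2 * b\<close>. The third moment gives the constant
  \<open>(2 * b) ^ 3 / 6 = 4 / 3 * b ^ 3\<close>, rounded up to \<open>2 * b ^ 3\<close>.\<close>

lemma kernel_char_approx:
  assumes x: "x \<noteq> None"
  shows "norm (kernel_int (kernel_char f \<theta>) x - (1 - \<theta>\<^sup>2 * kernel_variance f x / 2)) \<le> 2 * b ^ 3 * \<bar>\<theta>\<bar> ^ 3"
proof -
  interpret Px: prob_space "P x" by (rule prob_space_kernel)
  define C where "C y = centred f (x, y)" for y
  have C_b: "\<bar>C y\<bar> \<le> 2 * b" for y by (simp add: C_def abs_centred_le)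
  have [measurable]: "C \<in> borel_measurable (P x)"
    unfolding C_def by measurable
  have int: "integrable (P x) C"
    using C_b by (intro Px.integrable_const_bound[of _ "2 * b"]) auto
  have int2: "integrable (P x) (\<lambda>y. (C y)\<^sup>2)"
    using power_mono[OF C_b abs_ge_zero, of _ 2] by (intro Px.integrable_const_bound[of _ "(2 * b)\<^sup>2"]) auto
  have E: "Px.expectation C = 0"
    using integrable_kernel_f(1)[of x] Px.prob_space by (simp add: C_def[abs_def] centred_def kernel_op_def)
  have V: "Px.variance C = kernel_variance f x"
    unfolding E by (simp add: kernel_variance_eq C_def)
  have "cmod (char (distr (P x) borel C) \<theta> - (1 - \<theta>\<^sup>2 * kernel_variance f x / 2)) \<le>
    \<theta>\<^sup>2 / 6 * (\<integral>y. min (6 * (C y)\<^sup>2) (\<bar>\<theta>\<bar> * \<bar>C y\<bar> ^ 3) \<partial>P x)"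
    by (rule Px.char_approx3'[OF _ int int2 E V refl]) simp
  also have "\<dots> \<le> \<theta>\<^sup>2 / 6 * (\<integral>y. \<bar>\<theta>\<bar> * (2 * b) ^ 3 \<partial>P x)"
  proof (intro mult_left_mono integral_mono')
    show "min (6 * (C y)\<^sup>2) (\<bar>\<theta>\<bar> * \<bar>C y\<bar> ^ 3) \<le> \<bar>\<theta>\<bar> * (2 * b) ^ 3" for y
      by (intro min.coboundedI2 mult_left_mono power_mono C_b) auto
  qed (use bound_nonneg in auto)
  also have "\<dots> = \<theta>\<^sup>2 / 6 * (\<bar>\<theta>\<bar> * (2 * b) ^ 3)"
    using Px.prob_space by simp
  also have "\<dots> \<le> 2 * b ^ 3 * \<bar>\<theta>\<bar> ^ 3"
  proof -
    have cube: "\<bar>\<theta>\<bar> ^ 3 = \<theta>\<^sup>2 * \<bar>\<theta>\<bar>" by (simp add: power3_eq_cube power2_eq_square)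
    have "\<theta>\<^sup>2 / 6 * (\<bar>\<theta>\<bar> * (2 * b) ^ 3) = 4 / 3 * (b ^ 3 * \<bar>\<theta>\<bar> ^ 3)"
      unfolding cube by (simp add: power_mult_distrib)
    moreover have "0 \<le> b ^ 3 * \<bar>\<theta>\<bar> ^ 3" using bound_nonneg by simp
    ultimately show ?thesis by linarith
  qed
  also have "char (distr (P x) borel C) \<theta> = kernel_int (kernel_char f \<theta>) x"
    using x by (simp add: char_def integral_distr kernel_char_def C_def del: not_None_eq)
  finally show ?thesis .
qed

text \<open>Here \<open>c\<close> stands for the number of the living, so an error of order
  \<open>1 / (c * sqrt c)\<close> survives a sum over \<open>c\<close> individuals. The quartic term
  is the price of replacing \<open>1 - u\<close> by \<open>exp (- u)\<close>, whose product over the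
  generation is explicit; \<open>c \<ge> 1\<close> absorbs its denominator
  \<open>c * c\<close>.\<close>

lemma kernel_char_exp_approx:
  assumes c: "c \<ge> 1" and \<theta>: "\<theta> = t / sqrt c"
  shows "norm (kernel_int (kernel_char f \<theta>) x - exp (- (\<theta>\<^sup>2 * kernel_variance f x / 2)))
    \<le> (2 * b ^ 3 * \<bar>t\<bar> ^ 3 + b ^ 4 * t ^ 4) / (c * sqrt c) * alive x"
proof (cases "x = None")
  case True
  interpret Px: prob_space "P x" by (rule prob_space_kernel)
  show ?thesis using True Px.prob_space by (simp add: kernel_char_def kernel_variance_None)
next
  case False
  define v where "v = kernel_variance f x"
  have v: "0 \<le> v" "v \<le> b\<^sup>2" using kernel_variance_bounds by (auto simp: v_def)
  have "kernel_int (kernel_char f \<theta>) x - complex_of_real (exp (- (\<theta>\<^sup>2 * v / 2))) =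
      (kernel_int (kernel_char f \<theta>) x - (1 - \<theta>\<^sup>2 * v / 2)) +
      complex_of_real ((1 - \<theta>\<^sup>2 * v / 2) - exp (- (\<theta>\<^sup>2 * v / 2)))"
    by simp
  also have "norm \<dots> \<le> norm (kernel_int (kernel_char f \<theta>) x - (1 - \<theta>\<^sup>2 * v / 2)) +
      norm (complex_of_real ((1 - \<theta>\<^sup>2 * v / 2) - exp (- (\<theta>\<^sup>2 * v / 2))))"
    by (rule norm_triangle_ineq)
  also have "\<dots> \<le> 2 * b ^ 3 * \<bar>\<theta>\<bar> ^ 3 + (\<theta>\<^sup>2 * v / 2)\<^sup>2"
    unfolding norm_of_real using kernel_char_approx[OF False] v
    by (intro add_mono abs_one_minus_exp_le) (auto simp: v_def)
  also have "(\<theta>\<^sup>2 * v / 2)\<^sup>2 \<le> \<theta> ^ 4 * b ^ 4"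
  proof -
    have "v\<^sup>2 \<le> (b\<^sup>2)\<^sup>2" using v by (intro power_mono)
    then have "\<theta> ^ 4 * v\<^sup>2 \<le> \<theta> ^ 4 * b ^ 4" by (intro mult_left_mono) auto
    moreover have "0 \<le> \<theta> ^ 4 * v\<^sup>2" by simp
    moreover have "(\<theta>\<^sup>2 * v / 2)\<^sup>2 = \<theta> ^ 4 * v\<^sup>2 / 4" by (simp add: power_mult_distrib power_divide)
    ultimately show ?thesis by linarith
  qed
  also have "\<bar>\<theta>\<bar> ^ 3 = \<bar>t\<bar> ^ 3 / (c * sqrt c)"
    using c by (simp add: \<theta> power_divide power3_eq_cube abs_divide)
  also have "\<theta> ^ 4 * b ^ 4 \<le> b ^ 4 * t ^ 4 / (c * sqrt c)"
  proof -
    have "sqrt c \<le> c" using c real_sqrt_le_mono[of c "c\<^sup>2"] by (simp add: power2_eq_square)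
    then have "t ^ 4 / (c * c) \<le> t ^ 4 / (c * sqrt c)"
      using c by (intro divide_left_mono mult_left_mono) auto
    moreover have "\<theta> ^ 4 = t ^ 4 / (c * c)"
      using c by (simp add: \<theta> power_divide power4_eq_xxxx)
    ultimately have "\<theta> ^ 4 * b ^ 4 \<le> t ^ 4 / (c * sqrt c) * b ^ 4"
      by (simp only: mult_right_mono zero_le_even_power even_numeral)
    then show ?thesis by (simp add: mult_ac)
  qed
  finally show ?thesis using False by (simp add: v_def alive_def add_divide_distrib)
qed

text \<open>All factors have norm at most 1, so the distance of the products is at most the sum of
  the distances of the factors; only the \<open>c\<close> living ones contribute.\<close>

lemma norm_prod_kernel_char_le:
  assumes c: "total alive k w = c" "c > 0" and \<theta>: "\<theta> = t / sqrt c"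
  shows "norm ((\<Prod>i\<in>generation k. kernel_int (kernel_char f \<theta>) (X i w)) -
      exp (- (t\<^sup>2 / 2 * (total (kernel_variance f) k w / c))))
    \<le> (2 * b ^ 3 * \<bar>t\<bar> ^ 3 + b ^ 4 * t ^ 4) / sqrt c"
proof -
  define C where "C = 2 * b ^ 3 * \<bar>t\<bar> ^ 3 + b ^ 4 * t ^ 4"
  define v where "v i = kernel_variance f (X i w)" for i
  have c1: "c \<ge> 1" using c by (auto simp: total_alive)
  have "exp (- (t\<^sup>2 / 2 * (total (kernel_variance f) k w / c))) = (\<Prod>i\<in>generation k. exp (- (\<theta>\<^sup>2 * v i / 2)))"
    using c by (simp add: exp_sum[symmetric] total_def v_def sum_negf sum_divide_distrib sum_distrib_left \<theta>
        power_divide mult_ac)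
  then have eq: "complex_of_real (exp (- (t\<^sup>2 / 2 * (total (kernel_variance f) k w / c)))) =
      (\<Prod>i\<in>generation k. complex_of_real (exp (- (\<theta>\<^sup>2 * v i / 2))))"
    by simp
  have "norm ((\<Prod>i\<in>generation k. kernel_int (kernel_char f \<theta>) (X i w)) -
      (\<Prod>i\<in>generation k. complex_of_real (exp (- (\<theta>\<^sup>2 * v i / 2)))))
    \<le> (\<Sum>i\<in>generation k. norm (kernel_int (kernel_char f \<theta>) (X i w) -
      complex_of_real (exp (- (\<theta>\<^sup>2 * v i / 2)))))"
    using norm_kernel_char[of f \<theta>] kernel_variance_bounds
    by (intro norm_prod_diff norm_kernel_integral_le) (auto simp: v_def)
  also have "\<dots> \<le> (\<Sum>i\<in>generation k. C / (c * sqrt c) * alive (X i w))"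
    unfolding C_def v_def by (intro sum_mono kernel_char_exp_approx[OF c1 \<theta>])
  also have "\<dots> = C / (c * sqrt c) * c"
    unfolding c(1)[symmetric] total_def by (simp only: sum_distrib_left)
  also have "\<dots> = C / sqrt c" using c by simp
  finally show ?thesis unfolding eq C_def .
qed

end

text \<open>A fixed index set with random weights replaces a random index set, which makes
  measurability and the product structure accessible.\<close>

lemma fluctuation_eq:
  "fluctuation P X k f w = 1 / sqrt (total alive k w) * (\<Sum>i\<in>generation k. alive (X i w) * centred f (triple X i w))"
proof -
  have "(\<Sum>i\<in>generation k. alive (X i w) * centred f (triple X i w)) =
      (\<Sum>i\<in>generation k. if X i w \<noteq> None then centred f (triple X i w) else 0)"
    by (intro sum.cong refl) (simp add: alive_def of_bool_def del: not_None_eq)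
  also have "\<dots> = (\<Sum>i\<in>{i\<in>generation k. X i w \<noteq> None}. centred f (triple X i w))"
    by (rule sum.inter_filter[symmetric]) simp
  also have "{i\<in>generation k. X i w \<noteq> None} = living_generation X k w"
    by (auto simp: living_generation_def living_def)
  finally show ?thesis
    by (simp add: fluctuation_def total_alive centred_def triple_def)
qed

text \<open>The inequality is strict because the triples of generation \<open>k\<close> reach into
  generation \<open>k + 1\<close>.\<close>

lemma measurable_fluctuation_\<F>:
  assumes [measurable]: "f \<in> borel_measurable triple_borel" and k: "k < n"
  shows "fluctuation P X k f \<in> borel_measurable (\<F> n)"
proof -
  have [measurable]: "X i \<in> \<F> n \<rightarrow>\<^sub>M borel" if "i \<in> generation k" for i
    using that k by (intro measurable_X_\<F>) (auto simp: generation_def)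
  have [measurable]: "triple X i \<in> \<F> n \<rightarrow>\<^sub>M triple_borel" if "i \<in> generation k" for i
    using that k by (intro measurable_triple_\<F>) (auto simp: generation_def)
  show ?thesis
    unfolding fluctuation_eq[abs_def] total_def
    by (intro borel_measurable_times borel_measurable_divide borel_measurable_const
        borel_measurable_sqrt borel_measurable_sum) measurable
qed

lemma measurable_fluctuation [measurable]:
  "f \<in> borel_measurable triple_borel \<Longrightarrow> fluctuation P X k f \<in> borel_measurable M"
  using measurable_from_\<F>[OF measurable_fluctuation_\<F>[of f k "Suc k"]] by simp

lemma iexp_fluctuation:
  assumes "total alive k w > 0"
  shows "iexp (t * fluctuation P X k f w) =
    (\<Prod>i\<in>generation k. kernel_char f (t / sqrt (total alive k w)) (triple X i w))"
proof -
  define \<theta> where "\<theta> = t / sqrt (total alive k w)"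
  have "(\<Prod>i\<in>generation k. kernel_char f \<theta> (triple X i w)) =
      (\<Prod>i\<in>generation k. iexp (\<theta> * (alive (X i w) * centred f (triple X i w))))"
    by (intro prod.cong) (auto simp: kernel_char_def triple_def alive_def)
  also have "\<dots> = iexp (\<theta> * (\<Sum>i\<in>generation k. alive (X i w) * centred f (triple X i w)))"
    by (simp add: exp_sum[symmetric] sum_distrib_left)
  also have "\<theta> * (\<Sum>i\<in>generation k. alive (X i w) * centred f (triple X i w)) = t * fluctuation P X k f w"
    by (simp add: fluctuation_eq \<theta>_def)
  finally show ?thesis by (simp add: \<theta>_def)
qed

lemma measurable_card_living_\<F>: "(\<lambda>w. card (living_generation X k w)) \<in> \<F> k \<rightarrow>\<^sub>M count_space UNIV"
proof -
  have "(\<lambda>w. nat \<lfloor>total alive k w\<rfloor>) \<in> \<F> k \<rightarrow>\<^sub>M count_space UNIV"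
    using measurable_total_\<F>[OF measurable_alive] by measurable
  then show ?thesis by (simp add: total_alive)
qed

lemma card_living_le: "card (living_generation X k w) \<le> card (generation k)"
  by (rule card_mono) (auto simp: living_generation_def)

text \<open>The generation size is \<open>\<F> k\<close>-measurable, so the product formula may be applied with
  functions depending on it.\<close>

lemma Markov_product_random:
  fixes g :: "nat \<Rightarrow> 'a family \<Rightarrow> complex"
  assumes \<Psi>: "\<Psi> \<in> borel_measurable (\<F> k)" "\<And>w. \<bar>\<Psi> w\<bar> \<le> B"
    and g: "\<And>c. g c \<in> borel_measurable triple_borel" "\<And>c u. norm (g c u) \<le> 1"
  defines "Z \<equiv> \<lambda>w. card (living_generation X k w)"
  shows "(\<lambda>w. \<Prod>i\<in>generation k. g (Z w) (triple X i w)) \<in> borel_measurable M"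
    "(\<lambda>w. \<Prod>i\<in>generation k. kernel_int (g (Z w)) (X i w)) \<in> borel_measurable M"
    "(\<integral>w. complex_of_real (\<Psi> w) * (\<Prod>i\<in>generation k. g (Z w) (triple X i w)) \<partial>M) =
    (\<integral>w. complex_of_real (\<Psi> w) * (\<Prod>i\<in>generation k. kernel_int (g (Z w)) (X i w)) \<partial>M)"
proof -
  note [measurable] = g(1)
  have Z\<F> [measurable]: "Z \<in> \<F> k \<rightarrow>\<^sub>M count_space UNIV"
    unfolding Z_def by (rule measurable_card_living_\<F>)
  have Z [measurable]: "Z \<in> M \<rightarrow>\<^sub>M count_space UNIV"
    by (rule measurable_from_\<F>[OF Z\<F>])
  have [measurable]: "\<Psi> \<in> borel_measurable M" by (rule measurable_from_\<F>[OF \<Psi>(1)])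
  have [measurable]: "(\<lambda>w. kernel_int (g c) (X i w)) \<in> borel_measurable M" for c i
    by (rule measurable_compose[OF measurable_X measurable_kernel_integral[OF g(1)]])
  define L where "L c w = (\<Prod>i\<in>generation k. g c (triple X i w))" for c w
  define R where "R c w = (\<Prod>i\<in>generation k. kernel_int (g c) (X i w))" for c w
  have [measurable]: "L c \<in> borel_measurable M" "R c \<in> borel_measurable M" for c
    unfolding L_def[abs_def] R_def[abs_def] by measurable
  have bd: "norm (L c w) \<le> 1" "norm (R c w) \<le> 1" for c w
    unfolding L_def R_def prod_norm[symmetric]
    by (intro prod_le_1 conjI norm_ge_zero g norm_kernel_integral_le)+
  show "(\<lambda>w. \<Prod>i\<in>generation k. g (Z w) (triple X i w)) \<in> borel_measurable M"
    using measurable_compose_countable[of L, OF _ Z] by (simp add: L_def)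
  show "(\<lambda>w. \<Prod>i\<in>generation k. kernel_int (g (Z w)) (X i w)) \<in> borel_measurable M"
    using measurable_compose_countable[of R, OF _ Z] by (simp add: R_def)
  \<comment> \<open>The integral is split by the finitely many values of \<open>Z\<close>. The
    indicator of \<open>Z w = c\<close> joins the weight, and \<open>c\<close> is then a constant in
    the product formula.\<close>
  have decomp: "(\<integral>w. complex_of_real (\<Psi> w) * F (Z w) w \<partial>M) =
      (\<Sum>c\<le>card (generation k). \<integral>w. complex_of_real (\<Psi> w * of_bool (Z w = c)) * F c w \<partial>M)"
    if [measurable]: "\<And>c. F c \<in> borel_measurable M" and F: "\<And>c w. norm (F c w) \<le> 1" for F
  proof -
    have "complex_of_real (\<Psi> w) * F (Z w) w =
        (\<Sum>c\<le>card (generation k). complex_of_real (\<Psi> w * of_bool (Z w = c)) * F c w)" for w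
    proof -
      have "(\<Sum>c\<le>card (generation k). complex_of_real (\<Psi> w * of_bool (Z w = c)) * F c w) =
          (\<Sum>c\<le>card (generation k). if Z w = c then complex_of_real (\<Psi> w) * F c w else 0)"
        by (intro sum.cong) auto
      also have "\<dots> = complex_of_real (\<Psi> w) * F (Z w) w"
        using card_living_le[of k w] by (simp add: sum.delta' Z_def)
      finally show ?thesis by simp
    qed
    moreover have "integrable M (\<lambda>w. complex_of_real (\<Psi> w * of_bool (Z w = c)) * F c w)" for c
    proof (rule integrable_const_bound[of _ B])
      have "norm (complex_of_real (\<Psi> w * of_bool (Z w = c)) * F c w) \<le> B * 1" for w
        unfolding norm_mult norm_of_real
        using \<Psi>(2)[of w] F[of c w] order_trans[OF abs_ge_zero \<Psi>(2)[of w]]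
        by (intro mult_mono) (auto simp: abs_mult of_bool_def)
      then show "AE w in M. norm (complex_of_real (\<Psi> w * of_bool (Z w = c)) * F c w) \<le> B" by simp
    qed measurable
    ultimately show ?thesis by (simp only: Bochner_Integration.integral_sum)
  qed
  have "(\<integral>w. complex_of_real (\<Psi> w * of_bool (Z w = c)) * L c w \<partial>M) =
      (\<integral>w. complex_of_real (\<Psi> w * of_bool (Z w = c)) * R c w \<partial>M)" for c
    unfolding L_def R_def
  proof (rule Markov_product_complex)
    show "(\<lambda>w. \<Psi> w * of_bool (Z w = c)) \<in> borel_measurable (\<F> k)"
      using \<Psi>(1) by measurable
    show "\<bar>\<Psi> w * of_bool (Z w = c)\<bar> \<le> B" for w
      using \<Psi>(2)[of w] order_trans[OF abs_ge_zero \<Psi>(2)[of w]] by (auto simp: of_bool_def)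
  qed (use g in auto)
  then have "(\<integral>w. complex_of_real (\<Psi> w) * L (Z w) w \<partial>M) = (\<integral>w. complex_of_real (\<Psi> w) * R (Z w) w \<partial>M)"
    using decomp[of L] decomp[of R] bd by simp
  then show "(\<integral>w. complex_of_real (\<Psi> w) * (\<Prod>i\<in>generation k. g (Z w) (triple X i w)) \<partial>M) =
    (\<integral>w. complex_of_real (\<Psi> w) * (\<Prod>i\<in>generation k. kernel_int (g (Z w)) (X i w)) \<partial>M)"
    by (simp add: L_def R_def)
qed

end

section \<open>Convergence in mean of the conditional characteristic functions\<close>

context supercritical_limit
begin

context
  fixes f :: "'a family \<Rightarrow> real" and b s2 :: real
  assumes f [measurable]: "f \<in> borel_measurable triple_borel" and b: "\<And>u. \<bar>f u\<bar> \<le> b"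
    and s2: "0 \<le> s2"
    and variance_limit: "\<And>x. (\<lambda>r. (offspring_op ^^ r) (\<lambda>x. kernel_variance f x - s2 * alive x) x) \<longlonglongrightarrow> 0"
begin

text \<open>The conditional variance minus its limit, as the law of large numbers requires; the
  factor \<open>alive\<close> keeps it zero at the cemetery.\<close>

definition excess :: "'a option \<Rightarrow> real"
  where "excess x = kernel_variance f x - s2 * alive x"

lemma measurable_excess [measurable]: "excess \<in> borel_measurable borel"
  unfolding excess_def[abs_def] by measurable

lemma abs_excess_le: "\<bar>excess x\<bar> \<le> (b\<^sup>2 + s2) * alive x"
proof (cases x)
  case None
  then show ?thesis by (simp add: excess_def kernel_variance_None[OF f b])
next
  case (Some y)
  then show ?thesis
    using kernel_variance_bounds[OF f b, of x] s2 by (auto simp: excess_def)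
qed

lemma excess_L1: "(\<lambda>k. \<integral>w. \<bar>total excess k w\<bar> / m ^ k \<partial>M) \<longlonglongrightarrow> 0"
  using variance_limit
  by (intro law_of_large_numbers[OF _ abs_excess_le]) (auto simp: excess_def[abs_def])

text \<open>On survival, a version of the conditional characteristic function of
  \<open>fluctuation P X k f\<close> given \<open>\<F> k\<close>;
  \<open>expectation_iexp_fluctuation\<close> says so in integrated form.\<close>

definition conditional_char :: "real \<Rightarrow> nat \<Rightarrow> 'w \<Rightarrow> complex"
  where "conditional_char t k w =
    (\<Prod>i\<in>generation k. kernel_int (kernel_char f (t / sqrt (total alive k w))) (X i w))"

abbreviation char_error :: "real \<Rightarrow> nat \<Rightarrow> 'w \<Rightarrow> real"
  where "char_error t k w \<equiv> norm (conditional_char t k w - exp (- (t\<^sup>2 / 2 * s2)))"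

lemma measurable_conditional_char [measurable]: "conditional_char t k \<in> borel_measurable M"
  unfolding conditional_char_def[abs_def] total_alive
  using Markov_product_random(2)[of "\<lambda>_. 0" k 0 "\<lambda>c. kernel_char f (t / sqrt (real c))"] norm_kernel_char[of f]
  by simp

lemma norm_conditional_char_le: "norm (conditional_char t k w) \<le> 1"
  unfolding conditional_char_def prod_norm[symmetric] using norm_kernel_char[of f]
  by (intro prod_le_1 conjI norm_ge_zero norm_kernel_integral_le) auto

lemma char_error_le: "char_error t k w \<le> 2"
proof -
  have "char_error t k w \<le> 1 + 1"
    using norm_conditional_char_le s2 by (intro order_trans[OF norm_triangle_ineq4] add_mono) auto
  then show ?thesis by simp
qed

lemma expectation_iexp_fluctuation:
  assumes \<Psi>: "\<Psi> \<in> borel_measurable (\<F> k)" "\<And>w. \<bar>\<Psi> w\<bar> \<le> B"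
  shows "(\<integral>w. complex_of_real (\<Psi> w * survives k w) * iexp (t * fluctuation P X k f w) \<partial>M) =
    (\<integral>w. complex_of_real (\<Psi> w * survives k w) * conditional_char t k w \<partial>M)"
proof -
  define \<Psi>' where "\<Psi>' w = \<Psi> w * survives k w" for w
  have B: "0 \<le> B" using \<Psi>(2) abs_ge_zero order_trans by blast
  have "\<Psi>' \<in> borel_measurable (\<F> k)"
    unfolding \<Psi>'_def[abs_def] using \<Psi>(1) measurable_total_\<F>[OF measurable_alive, of k] by measurable
  moreover have "\<bar>\<Psi>' w\<bar> \<le> B" for w
    using \<Psi>(2)[of w] B by (auto simp: \<Psi>'_def)
  ultimately have main: "(\<integral>w. complex_of_real (\<Psi>' w) * (\<Prod>i\<in>generation k. kernel_char f (t / sqrt (total alive k w)) (triple X i w)) \<partial>M) =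
      (\<integral>w. complex_of_real (\<Psi>' w) * conditional_char t k w \<partial>M)"
    using Markov_product_random(3)[of \<Psi>' k B "\<lambda>c. kernel_char f (t / sqrt (real c))"] norm_kernel_char[of f]
    by (simp add: conditional_char_def total_alive)
  have eq: "complex_of_real (\<Psi>' w) * (\<Prod>i\<in>generation k. kernel_char f (t / sqrt (total alive k w)) (triple X i w)) =
      complex_of_real (\<Psi>' w) * iexp (t * fluctuation P X k f w)" for w
    using iexp_fluctuation[of k w t f] by (cases "total alive k w > 0") (auto simp: \<Psi>'_def)
  show ?thesis using main unfolding eq unfolding \<Psi>'_def .
qed

text \<open>Two regimes for \<open>v = total alive k w / m ^ k\<close>. If
  \<open>v < \<delta>\<close>, the last term alone is at least the trivial bound 2. Otherwise the
  population is at least \<open>\<delta> * m ^ k\<close>, which bounds the Taylor error and the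
  deviation of the average variance. Unlike an indicator of \<open>v < \<delta>\<close>, the ratio
  in the last term is continuous in \<open>v\<close> and passes to the limit.\<close>

lemma norm_conditional_char_diff_le:
  fixes t :: real
  assumes Z: "total alive k w > 0" and \<delta>: "\<delta> > 0"
  defines "C \<equiv> 2 * b ^ 3 * \<bar>t\<bar> ^ 3 + b ^ 4 * t ^ 4"
  shows "char_error t k w \<le>
    C / (sqrt \<delta> * sqrt m ^ k) + t\<^sup>2 / (2 * \<delta>) * (\<bar>total excess k w\<bar> / m ^ k) +
    4 * \<delta> / (total alive k w / m ^ k + \<delta>)"
proof -
  define z where "z = total alive k w"
  define v where "v = z / m ^ k"
  have m: "m > 0" using super_critical by simp
  have z: "z > 0" using Z by (simp add: z_def)
  have v: "v > 0" "z = v * m ^ k" using z m by (auto simp: v_def)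
  have b0: "0 \<le> b" by (rule bound_nonneg[OF f b])
  have C: "C \<ge> 0" using b0 by (simp add: C_def)
  have nonneg: "0 \<le> C / (sqrt \<delta> * sqrt m ^ k)" "0 \<le> t\<^sup>2 / (2 * \<delta>) * (\<bar>total excess k w\<bar> / m ^ k)" "0 \<le> 4 * \<delta> / (v + \<delta>)"
    using C \<delta> m v by auto
  show ?thesis
  proof (cases "v < \<delta>")
    case True
    note char_error_le[of t k w]
    also have "2 \<le> 4 * \<delta> / (v + \<delta>)" using True v \<delta> by (simp add: le_divide_eq)
    finally show ?thesis using nonneg by (simp add: v_def z_def)
  next
    case False
    define V where "V = total (kernel_variance f) k w / z"
    have V0: "0 \<le> V"
      unfolding V_def total_def using z kernel_variance_bounds(1)[OF f b]
      by (intro divide_nonneg_nonneg sum_nonneg) auto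
    have "char_error t k w \<le>
        norm (conditional_char t k w - complex_of_real (exp (- (t\<^sup>2 / 2 * V)))) +
        norm (complex_of_real (exp (- (t\<^sup>2 / 2 * V)) - exp (- (t\<^sup>2 / 2 * s2))))"
      by (rule order_trans[OF _ norm_triangle_ineq]) simp
    also have "\<dots> \<le> C / sqrt z + \<bar>t\<^sup>2 / 2 * V - t\<^sup>2 / 2 * s2\<bar>"
    proof (rule add_mono)
      show "norm (conditional_char t k w - complex_of_real (exp (- (t\<^sup>2 / 2 * V)))) \<le> C / sqrt z"
        unfolding C_def V_def conditional_char_def z_def
        by (rule norm_prod_kernel_char_le[OF f b refl Z refl])
      show "norm (complex_of_real (exp (- (t\<^sup>2 / 2 * V)) - exp (- (t\<^sup>2 / 2 * s2)))) \<le> \<bar>t\<^sup>2 / 2 * V - t\<^sup>2 / 2 * s2\<bar>"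
        unfolding norm_of_real using V0 s2 by (intro abs_exp_minus_diff_le) auto
    qed
    also have "C / sqrt z \<le> C / (sqrt \<delta> * sqrt m ^ k)"
    proof -
      have "sqrt \<delta> * sqrt m ^ k \<le> sqrt v * sqrt m ^ k" using False m by (intro mult_right_mono) auto
      also have "\<dots> = sqrt z" by (simp add: v(2) real_sqrt_mult real_sqrt_power)
      finally show ?thesis using C z \<delta> m by (intro divide_left_mono) auto
    qed
    also have "\<bar>t\<^sup>2 / 2 * V - t\<^sup>2 / 2 * s2\<bar> \<le> t\<^sup>2 / (2 * \<delta>) * (\<bar>total excess k w\<bar> / m ^ k)"
    proof -
      have "total excess k w = total (kernel_variance f) k w - s2 * z"
        unfolding excess_def[abs_def] z_def by (simp add: total_diff total_cmult)
      then have "V - s2 = total excess k w / z" using z by (simp add: V_def diff_divide_distrib)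
      then have "t\<^sup>2 / 2 * V - t\<^sup>2 / 2 * s2 = t\<^sup>2 / 2 * (total excess k w / z)"
        by (metis right_diff_distrib)
      then have "\<bar>t\<^sup>2 / 2 * V - t\<^sup>2 / 2 * s2\<bar> = t\<^sup>2 / 2 * (\<bar>total excess k w\<bar> / z)"
        using z by (simp add: abs_mult)
      moreover have "\<bar>total excess k w\<bar> / z \<le> (\<bar>total excess k w\<bar> / m ^ k) / \<delta>"
      proof -
        have "\<bar>total excess k w\<bar> / z = (\<bar>total excess k w\<bar> / m ^ k) / v"
          using m by (simp add: v(2))
        also have "\<dots> \<le> (\<bar>total excess k w\<bar> / m ^ k) / \<delta>"
          using False \<delta> m v by (intro divide_left_mono) auto
        finally show ?thesis .
      qed
      then have "t\<^sup>2 / 2 * (\<bar>total excess k w\<bar> / z) \<le> t\<^sup>2 / 2 * ((\<bar>total excess k w\<bar> / m ^ k) / \<delta>)"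
        by (intro mult_left_mono) auto
      ultimately show ?thesis by (simp add: mult_ac)
    qed
    finally show ?thesis using nonneg(3) by (simp add: v_def z_def)
  qed
qed

lemma norm_of_bool_mult_le:
  fixes x c :: real
  assumes "0 \<le> x" "x \<le> c"
  shows "norm (of_bool Q * x) \<le> c"
  using assms by (cases Q) auto

text \<open>The level \<delta> runs through \<open>1 / real (Suc j)\<close>. The indicator is
  essential: where \<open>W\<close> is 0 the ratio is constantly 4.\<close>

lemma small_population_tendsto:
  "(\<lambda>j. \<integral>w. W_nonzero w * (4 * (1 / real (Suc j)) / (W w + 1 / real (Suc j))) \<partial>M) \<longlonglongrightarrow> 0"
proof -
  let ?g = "\<lambda>j w. W_nonzero w * (4 * (1 / real (Suc j)) / (W w + 1 / real (Suc j)))"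
  have "(\<lambda>j. \<integral>w. ?g j w \<partial>M) \<longlonglongrightarrow> (\<integral>w. 0 \<partial>M)"
  proof (rule integral_dominated_convergence[where w="\<lambda>_. 4"])
    show "AE w in M. (\<lambda>j. ?g j w) \<longlonglongrightarrow> 0"
    proof (rule AE_I2)
      fix w
      show "(\<lambda>j. ?g j w) \<longlonglongrightarrow> 0"
      proof (cases "W w = 0")
        case False
        have inv: "(\<lambda>j. 1 / real (Suc j)) \<longlonglongrightarrow> 0" by (rule LIMSEQ_Suc[OF lim_1_over_n])
        have "(\<lambda>j. ?g j w) \<longlonglongrightarrow>
            W_nonzero w * (4 * 0 / (W w + 0))"
          using False by (intro tendsto_intros inv) auto
        then show ?thesis by simp
      qed simp
    qed
    show "AE w in M. norm (?g j w) \<le> 4" for j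
      using W_nonneg
    proof eventually_elim
      case (elim w)
      define d where "d = 1 / real (Suc j)"
      have "d > 0" by (simp add: d_def)
      with elim have "0 \<le> 4 * d / (W w + d)" "4 * d / (W w + d) \<le> 4"
        by (auto simp: divide_le_eq)
      then have "norm (W_nonzero w * (4 * d / (W w + d))) \<le> 4"
        by (rule norm_of_bool_mult_le)
      then show ?case by (simp only: d_def)
    qed
  qed auto
  then show ?thesis by simp
qed

lemma population_ratio_tendsto:
  assumes \<delta>: "\<delta> > 0"
  shows "(\<lambda>k. \<integral>w. W_nonzero w * (4 * \<delta> / (total alive k w / m ^ k + \<delta>)) \<partial>M) \<longlonglongrightarrow>
    (\<integral>w. W_nonzero w * (4 * \<delta> / (W w + \<delta>)) \<partial>M)"
proof (rule integral_dominated_convergence[where w="\<lambda>_. 4"])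
  let ?g = "\<lambda>k w. W_nonzero w * (4 * \<delta> / (total alive k w / m ^ k + \<delta>))"
  show "AE w in M. (\<lambda>k. ?g k w) \<longlonglongrightarrow>
      W_nonzero w * (4 * \<delta> / (W w + \<delta>))"
    using W_AE W_nonneg
  proof eventually_elim
    case (elim w)
    then show ?case using \<delta> by (intro tendsto_intros) auto
  qed
  show "AE w in M. norm (?g k w) \<le> 4" for k
  proof (rule AE_I2)
    fix w
    have "0 \<le> total alive k w / m ^ k" using total_alive_nonneg super_critical by simp
    then have "0 \<le> 4 * \<delta> / (total alive k w / m ^ k + \<delta>)" "4 * \<delta> / (total alive k w / m ^ k + \<delta>) \<le> 4"
      using \<delta> by (auto simp: divide_le_eq)
    then show "norm (?g k w) \<le> 4"
      by (rule norm_of_bool_mult_le)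
  qed
qed auto

text \<open>The level \<delta> is fixed first, so that the limit of the population ratio is below
  \<epsilon>; the other terms then vanish as \<open>k\<close> grows, by
  \<open>survival_tendsto\<close>, \<open>excess_L1\<close> and \<open>sqrt m > 1\<close>.\<close>

lemma conditional_char_L1:
  "(\<lambda>k. \<integral>w. survives k w * char_error t k w \<partial>M) \<longlonglongrightarrow> 0"
proof (rule LIMSEQ_I)
  fix \<epsilon> :: real assume \<epsilon>: "\<epsilon> > 0"
  define a where "a k = (\<integral>w. survives k w * char_error t k w \<partial>M)" for k
  define C where "C = 2 * b ^ 3 * \<bar>t\<bar> ^ 3 + b ^ 4 * t ^ 4"
  have m: "m > 0" "sqrt m > 1" using super_critical by auto
  have "\<forall>\<^sub>F j in sequentially. (\<integral>w. W_nonzero w * (4 * (1 / real (Suc j)) / (W w + 1 / real (Suc j))) \<partial>M) < \<epsilon>"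
    using small_population_tendsto \<epsilon> by (intro order_tendstoD) auto
  then obtain j where j: "(\<integral>w. W_nonzero w * (4 * (1 / real (Suc j)) / (W w + 1 / real (Suc j))) \<partial>M) < \<epsilon>"
    using eventually_happens'[OF sequentially_bot] by auto
  define \<delta> where "\<delta> = 1 / real (Suc j)"
  have \<delta>: "\<delta> > 0" by (simp add: \<delta>_def)
  define D where "D k w = \<bar>survives k w - W_nonzero w :: real\<bar>" for k and w :: 'w
  define U where "U k w = \<bar>total excess k w\<bar> / m ^ k" for k w
  define E where "E k w = W_nonzero w * (4 * \<delta> / (total alive k w / m ^ k + \<delta>))" for k w
  have [measurable]: "D k \<in> borel_measurable M" "U k \<in> borel_measurable M" "E k \<in> borel_measurable M" for k
    unfolding D_def[abs_def] U_def[abs_def] E_def[abs_def] by measurable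
  have w0: "0 \<le> total alive k w / m ^ k" for k w using total_alive_nonneg m by simp
  have E_b: "0 \<le> E k w" "E k w \<le> 4" for k w
  proof -
    have "0 \<le> 4 * \<delta> / (total alive k w / m ^ k + \<delta>)" "4 * \<delta> / (total alive k w / m ^ k + \<delta>) \<le> 4"
      using \<delta> w0[of k w] by (auto simp: divide_le_eq)
    then show "0 \<le> E k w" "E k w \<le> 4" by (cases "W w = 0"; simp add: E_def)+
  qed
  have intD: "integrable M (D k)" for k
    by (rule integrable_const_bound[of _ 1]) (auto simp: D_def)
  have intE: "integrable M (E k)" for k
    using E_b by (intro integrable_const_bound[of _ 4]) auto
  have intU: "integrable M (U k)" for k
    unfolding U_def[abs_def]
    using integrable_total[OF measurable_excess bounded_of_alive_bound(2)[OF abs_excess_le], of k] by simp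
  \<comment> \<open>The term \<open>2 * D k w\<close> pays, by the trivial bound 2, for survival
    with \<open>W w = 0\<close>, where the population ratio is not controlled.\<close>
  have le: "survives k w * char_error t k w \<le>
      2 * D k w + C / (sqrt \<delta> * sqrt m ^ k) + t\<^sup>2 / (2 * \<delta>) * U k w + E k w" for k w
  proof -
    have nonneg: "0 \<le> C / (sqrt \<delta> * sqrt m ^ k)" "0 \<le> t\<^sup>2 / (2 * \<delta>) * U k w"
      using bound_nonneg[OF f b] \<delta> m by (auto simp: C_def U_def)
    show ?thesis
    proof (cases "total alive k w > 0")
      case True
      show ?thesis
      proof (cases "W w = 0")
        case W: True
        then show ?thesis using True char_error_le[of t k w] nonneg E_b(1)[of k w] by (simp add: D_def)
      next
        case W: False
        then show ?thesis
          using norm_conditional_char_diff_le[OF True \<delta>, of t] True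
          by (simp add: C_def D_def U_def E_def)
      qed
    next
      case False
      then show ?thesis using nonneg E_b(1)[of k w] by (simp add: D_def)
    qed
  qed
  let ?bound = "\<lambda>k. 2 * (\<integral>w. D k w \<partial>M) + C / (sqrt \<delta> * sqrt m ^ k) + t\<^sup>2 / (2 * \<delta>) * (\<integral>w. U k w \<partial>M) + (\<integral>w. E k w \<partial>M)"
  have a_le: "a k \<le> ?bound k" for k
  proof -
    have "a k \<le> (\<integral>w. 2 * D k w + C / (sqrt \<delta> * sqrt m ^ k) + t\<^sup>2 / (2 * \<delta>) * U k w + E k w \<partial>M)"
      unfolding a_def
    proof (rule integral_mono)
      show "integrable M (\<lambda>w. survives k w * char_error t k w)"
        using char_error_le[of t k] by (intro integrable_const_bound[of _ 2]) (auto simp: of_bool_def)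
    qed (use intD intE intU le in auto)
    also have "\<dots> = ?bound k"
      using intD[of k] intE[of k] intU[of k] by (simp add: prob_space)
    finally show ?thesis .
  qed
  have "(\<lambda>k. C / sqrt \<delta> * (1 / sqrt m) ^ k) \<longlonglongrightarrow> 0"
    using m by (intro tendsto_mult_right_zero LIMSEQ_power_zero) auto
  then have "(\<lambda>k. C / (sqrt \<delta> * sqrt m ^ k)) \<longlonglongrightarrow> 0"
    by (simp add: power_divide)
  then have "(\<lambda>k. ?bound k) \<longlonglongrightarrow>
      2 * 0 + 0 + t\<^sup>2 / (2 * \<delta>) * 0 + (\<integral>w. W_nonzero w * (4 * \<delta> / (W w + \<delta>)) \<partial>M)"
    unfolding D_def U_def E_def
    by (intro tendsto_intros survival_tendsto excess_L1 population_ratio_tendsto \<delta>)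
  then have "\<forall>\<^sub>F k in sequentially. ?bound k < \<epsilon>"
    by (rule order_tendstoD(2)) (use j in \<open>simp add: \<delta>_def\<close>)
  then have "\<forall>\<^sub>F k in sequentially. a k < \<epsilon>"
    by eventually_elim (use a_le in \<open>rule order_le_less_trans\<close>)
  moreover have "0 \<le> a k" for k
    unfolding a_def by (rule integral_nonneg_AE) auto
  ultimately show "\<exists>N. \<forall>k\<ge>N. norm (a k - 0) < \<epsilon>"
    by (simp add: eventually_sequentially)
qed

text \<open>Against an \<open>\<F> k\<close>-measurable weight the exponential may be replaced
  exactly by its conditional version; what remains is at most \<open>B\<close> times the integral in
  \<open>conditional_char_L1\<close>.\<close>

lemma weighted_char_tendsto:
  assumes \<Psi>: "\<And>k. \<Psi> k \<in> borel_measurable (\<F> k)" "\<And>k w. \<bar>\<Psi> k w\<bar> \<le> B"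
  shows "(\<lambda>k. \<integral>w. complex_of_real (\<Psi> k w * survives k w) *
    (iexp (t * fluctuation P X k f w) - exp (- (t\<^sup>2 / 2 * s2))) \<partial>M) \<longlonglongrightarrow> 0"
proof (rule Lim_null_comparison)
  let ?I = "\<lambda>k. \<integral>w. complex_of_real (\<Psi> k w * survives k w) * (iexp (t * fluctuation P X k f w) - exp (- (t\<^sup>2 / 2 * s2))) \<partial>M"
  let ?E = "\<lambda>k. \<integral>w. survives k w * char_error t k w \<partial>M"
  note [measurable] = measurable_from_\<F>[OF \<Psi>(1)]
  have B: "0 \<le> B" using \<Psi>(2) abs_ge_zero order_trans by blast
  show "(\<lambda>k. B * ?E k) \<longlonglongrightarrow> 0"
    by (rule tendsto_mult_right_zero[OF conditional_char_L1])
  show "\<forall>\<^sub>F k in sequentially. norm (?I k) \<le>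
      B * ?E k"
  proof (intro always_eventually allI)
    fix k
    define c where "c w = complex_of_real (\<Psi> k w * survives k w)" for w
    define e where "e = complex_of_real (exp (- (t\<^sup>2 / 2 * s2)))"
    have c: "norm (c w) \<le> B * survives k w" for w
      unfolding c_def norm_of_real using \<Psi>(2)[of k w] B by (auto simp: of_bool_def)
    have c': "norm (c w) \<le> B" for w using c[of w] B by (auto simp: of_bool_def split: if_splits)
    have [measurable]: "c \<in> borel_measurable M" unfolding c_def[abs_def] by measurable
    have int: "integrable M (\<lambda>w. c w * F w)"
      if [measurable]: "F \<in> borel_measurable M" and F: "\<And>w. norm (F w) \<le> 1" for F
    proof (rule integrable_const_bound[of _ B])
      have "norm (c w * F w) \<le> B * 1" for w
        unfolding norm_mult using c' F B by (intro mult_mono) auto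
      then show "AE w in M. norm (c w * F w) \<le> B" by simp
    qed measurable
    have e: "norm e \<le> 1" using s2 by (simp add: e_def)
    have i1: "integrable M (\<lambda>w. c w * iexp (t * fluctuation P X k f w))" by (rule int) auto
    have i2: "integrable M (\<lambda>w. c w * conditional_char t k w)" by (rule int) (auto intro: norm_conditional_char_le)
    have i3: "integrable M (\<lambda>w. c w * e)" by (rule int) (auto intro: e)
    have "(\<integral>w. c w * (iexp (t * fluctuation P X k f w) - e) \<partial>M) = (\<integral>w. c w * (conditional_char t k w - e) \<partial>M)"
      unfolding right_diff_distrib Bochner_Integration.integral_diff[OF i1 i3] Bochner_Integration.integral_diff[OF i2 i3]
      unfolding c_def by (simp only: expectation_iexp_fluctuation[OF \<Psi>])
    also have "norm \<dots> \<le> (\<integral>w. norm (c w * (conditional_char t k w - e)) \<partial>M)"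
      by (rule integral_norm_bound)
    also have "\<dots> \<le> (\<integral>w. B * (survives k w * norm (conditional_char t k w - e)) \<partial>M)"
    proof (rule integral_mono)
      show "integrable M (\<lambda>w. norm (c w * (conditional_char t k w - e)))"
        unfolding right_diff_distrib using i2 i3 by auto
      have "norm (conditional_char t k w - e) \<le> 1 + 1" for w
        using norm_conditional_char_le e by (intro order_trans[OF norm_triangle_ineq4] add_mono) auto
      then show "integrable M (\<lambda>w. B * (survives k w * norm (conditional_char t k w - e)))"
        by (intro integrable_mult_right integrable_const_bound[of _ 2]) (auto simp: of_bool_def)
      show "norm (c w * (conditional_char t k w - e)) \<le> B * (survives k w * norm (conditional_char t k w - e))" for w
        unfolding norm_mult using mult_right_mono[OF c norm_ge_zero] by (simp only: mult.assoc)
    qed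
    finally show "norm (?I k) \<le>
      B * ?E k"
      by (simp add: c_def e_def)
  qed
qed

end

end

section \<open>Weak limits of the fluctuations\<close>

context supercritical_limit
begin

text \<open>The size is bounded and has mean \<open>m ^ k > 0\<close>, so it cannot vanish almost
  surely. This keeps the normalising constants of the densities below positive.\<close>

lemma expectation_survival_pos: "0 < (\<integral>w. survives k w \<partial>M)"
proof (rule ccontr)
  assume neg: "\<not> ?thesis"
  define B where "B = real (card (generation k)) * 1"
  have le: "total alive k w \<le> B * survives k w" for w
    using abs_total_le[of alive 1 k w] total_alive_nonneg[of k w] by (auto simp: B_def)
  have "m ^ k = (\<integral>w. total alive k w \<partial>M)" by (simp add: expectation_total_alive)
  also have "\<dots> \<le> (\<integral>w. B * survives k w \<partial>M)"
    using le integrable_total[of alive 1 k] by (intro integral_mono) auto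
  also have "\<dots> = B * (\<integral>w. survives k w \<partial>M)" by simp
  also have "\<dots> \<le> 0" using neg by (simp add: B_def mult_nonneg_nonpos)
  finally show False using super_critical by (simp add: not_less[symmetric])
qed

lemma expectation_W_nonzero_pos: "0 < (\<integral>w. W_nonzero w \<partial>M)"
proof -
  have "(\<integral>w. W_nonzero w \<partial>M) \<noteq> 0"
  proof
    assume "(\<integral>w. W_nonzero w \<partial>M) = 0"
    then have "AE w in M. W_nonzero w = (0 :: real)"
      by (subst (asm) integral_nonneg_eq_0_iff_AE) auto
    then have "AE w in M. W w = 0" by eventually_elim simp
    then show False using W_not_AE_0 by simp
  qed
  moreover have "0 \<le> (\<integral>w. W_nonzero w \<partial>M)"
    by (rule integral_nonneg_AE) auto
  ultimately show ?thesis by linarith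
qed

text \<open>\<open>survives k\<close> is \<open>\<F> k\<close>-measurable and fits the conditional
  argument; \<open>W_nonzero\<close> is the same for all generations and is what the induction over
  coordinates carries. The exchange costs \<open>K\<close> times the integral in
  \<open>survival_tendsto\<close>.\<close>

lemma survival_swap:
  assumes F [measurable]: "\<And>n. F n \<in> borel_measurable M" and K: "\<And>n w. \<bar>F n w\<bar> \<le> K"
    and k: "filterlim k at_top sequentially"
  shows "(\<lambda>n. (\<integral>w. survives (k n) w * F n w \<partial>M) -
    (\<integral>w. W_nonzero w * F n w \<partial>M)) \<longlonglongrightarrow> (0::real)"
proof (rule Lim_null_comparison)
  let ?D = "\<lambda>n. (\<integral>w. survives (k n) w * F n w \<partial>M) - (\<integral>w. W_nonzero w * F n w \<partial>M)"
  let ?d = "\<lambda>n w. (survives (k n) w - W_nonzero w)"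
  have K0: "0 \<le> K" using K abs_ge_zero order_trans by blast
  show "(\<lambda>n. K * (\<integral>w. \<bar>?d n w\<bar> \<partial>M)) \<longlonglongrightarrow> 0"
    by (intro tendsto_mult_right_zero filterlim_compose[OF survival_tendsto k])
  have int: "integrable M (\<lambda>w. of_bool (Q w) * F n w)" if [measurable]: "Measurable.pred M Q" for Q n
    using K K0 by (intro integrable_const_bound[of _ K]) (auto simp: of_bool_def)
  show "\<forall>\<^sub>F n in sequentially. norm (?D n) \<le>
      K * (\<integral>w. \<bar>?d n w\<bar> \<partial>M)"
  proof (intro always_eventually allI)
    fix n
    have "norm (?D n) =
        \<bar>\<integral>w. ?d n w * F n w \<partial>M\<bar>"
      unfolding left_diff_distrib using int by (subst Bochner_Integration.integral_diff) auto
    also have "\<dots> \<le> (\<integral>w. \<bar>?d n w * F n w\<bar> \<partial>M)"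
      by (rule integral_abs_bound)
    also have "\<dots> \<le> (\<integral>w. K * \<bar>?d n w\<bar> \<partial>M)"
    proof (rule integral_mono)
      show "integrable M (\<lambda>w. \<bar>?d n w * F n w\<bar>)"
        unfolding left_diff_distrib using int by auto
      show "integrable M (\<lambda>w. K * \<bar>?d n w\<bar>)"
        by (intro integrable_mult_right integrable_const_bound[of _ 1]) auto
      show "\<bar>?d n w * F n w\<bar> \<le>
          K * \<bar>?d n w\<bar>" for w
        unfolding abs_mult using mult_right_mono[OF K[of n w] abs_ge_zero] by (subst mult.commute) simp
    qed
    finally show "norm (?D n) \<le>
      K * (\<integral>w. \<bar>?d n w\<bar> \<partial>M)" by simp
  qed
qed

text \<open>Under the density proportional to \<open>(2 + \<Psi> k) * 1\<close> on survival, \<open>weighted_char_tendsto\<close> is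
  convergence of the characteristic functions, so Levy's continuity theorem applies; the summand
  \<open>2\<close> keeps the density positive.\<close>

lemma density_clt:
  fixes f :: "'a family \<Rightarrow> real"
  assumes f [measurable]: "f \<in> borel_measurable triple_borel" and b: "\<And>u. \<bar>f u\<bar> \<le> b"
    and s2: "0 \<le> s2"
    and variance_limit: "\<And>x. (\<lambda>r. (offspring_op ^^ r) (\<lambda>x. kernel_variance f x - s2 * alive x) x) \<longlonglongrightarrow> 0"
    and \<Psi>: "\<And>k. \<Psi> k \<in> borel_measurable (\<F> k)" "\<And>k w. \<bar>\<Psi> k w\<bar> \<le> 1"
    and e: "continuous_on UNIV e" "\<And>x. \<bar>e x\<bar> \<le> K"
  shows "(\<lambda>k. \<integral>w. (2 + \<Psi> k w) * survives k w *
    (e (fluctuation P X k f w) - (\<integral>x. e (sqrt s2 * x) \<partial>std_normal_distribution)) \<partial>M) \<longlonglongrightarrow> (0::real)"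
proof -
  note [measurable] = measurable_from_\<F>[OF \<Psi>(1)]
  have [measurable]: "e \<in> borel_measurable borel" by (rule borel_measurable_continuous_onI[OF e(1)])
  interpret normal: real_distribution std_normal_distribution by (rule real_dist_normal_dist)
  define N where "N k w = fluctuation P X k f w" for k w
  have [measurable]: "N k \<in> borel_measurable M" for k unfolding N_def[abs_def] by measurable
  define wt where "wt k w = (2 + \<Psi> k w) * survives k w" for k w
  have [measurable]: "wt k \<in> borel_measurable M" for k unfolding wt_def[abs_def] by measurable
  have wt_b: "survives k w \<le> wt k w" "wt k w \<le> 3" "0 \<le> wt k w" for k w
    using \<Psi>(2)[of k w] by (auto simp: wt_def abs_le_iff)
  have int_w: "integrable M (wt k)" for k
    using wt_b by (intro integrable_const_bound[of _ 3]) auto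
  define p where "p k = (\<integral>w. survives k w \<partial>M)" for k
  define c where "c k = (\<integral>w. wt k w \<partial>M)" for k
  have p_pos: "0 < p k" for k unfolding p_def by (rule expectation_survival_pos)
  have c_ge: "p k \<le> c k" for k
    unfolding p_def c_def using int_w wt_b by (intro integral_mono) auto
  have c_le: "c k \<le> 3" for k
  proof -
    have "c k \<le> (\<integral>w. 3 \<partial>M)" unfolding c_def using int_w wt_b by (intro integral_mono) auto
    then show ?thesis by (simp add: prob_space)
  qed
  have c_pos: "0 < c k" for k using p_pos c_ge order_less_le_trans by blast
  \<comment> \<open>The normalising constants \<open>c k\<close> are at least \<open>p k\<close>,
    which tends to a positive limit; dividing by them therefore preserves null limits.\<close>
  have p_lim: "p \<longlonglongrightarrow> (\<integral>w. W_nonzero w \<partial>M)"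
    using survival_swap[of "\<lambda>_ _. 1" 1 "\<lambda>k. k"] by (simp add: p_def[abs_def] LIM_zero_iff filterlim_ident)
  define D where "D k = density M (\<lambda>w. ennreal (wt k w / c k))" for k
  have D_prob: "prob_space (D k)" for k
  proof (rule prob_spaceI)
    have "emeasure (D k) (space (D k)) = (\<integral>\<^sup>+w. ennreal (wt k w / c k) \<partial>M)"
      by (simp add: D_def emeasure_density cong: nn_integral_cong)
    also have "\<dots> = ennreal (\<integral>w. wt k w / c k \<partial>M)"
      using int_w wt_b c_pos[of k] by (intro nn_integral_eq_integral) auto
    also have "(\<integral>w. wt k w / c k \<partial>M) = 1"
      using c_pos[of k] by (simp add: c_def)
    finally show "emeasure (D k) (space (D k)) = 1" by simp
  qed
  have [measurable_cong]: "sets (D k) = sets M" for k by (simp add: D_def)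
  define \<mu> where "\<mu> k = distr (D k) borel (N k)" for k
  have \<mu>: "real_distribution (\<mu> k)" for k
  proof -
    interpret Dk: prob_space "D k" by (rule D_prob)
    show ?thesis unfolding \<mu>_def by simp
  qed
  have integral_\<mu>: "integral\<^sup>L (\<mu> k) F = (\<integral>w. (wt k w / c k) *\<^sub>R F (N k w) \<partial>M)"
    if [measurable]: "F \<in> borel_measurable borel" for k and F :: "real \<Rightarrow> 'z::{banach, second_countable_topology}"
  proof -
    have "integral\<^sup>L (\<mu> k) F = (\<integral>w. F (N k w) \<partial>D k)"
      unfolding \<mu>_def by (rule integral_distr) auto
    also have "\<dots> = (\<integral>w. (wt k w / c k) *\<^sub>R F (N k w) \<partial>M)"
      unfolding D_def using wt_b c_pos[of k] by (intro integral_density) auto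
    finally show ?thesis .
  qed
  \<comment> \<open>The image of the standard normal law, rather than a normal density of variance
    \<open>s2\<close>, so that \<open>s2 = 0\<close> is covered.\<close>
  define L where "L = distr std_normal_distribution borel (\<lambda>x. sqrt s2 * x)"
  have L: "real_distribution L" unfolding L_def by simp
  have char_L: "char L t = exp (- (t\<^sup>2 / 2 * s2))" for t
  proof -
    have "char L t = char std_normal_distribution (t * sqrt s2)"
      by (simp add: L_def char_def integral_distr mult.assoc)
    then show ?thesis
      using s2 by (simp add: char_std_normal_distribution power_mult_distrib exp_of_real mult_ac)
  qed
  have "(\<lambda>k. char (\<mu> k) t) \<longlonglongrightarrow> char L t" for t
  proof -
    define I where "I k = (\<integral>w. complex_of_real (wt k w) * (iexp (t * N k w) - exp (- (t\<^sup>2 / 2 * s2))) \<partial>M)" for k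
    let ?J = "\<lambda>k. \<integral>w. complex_of_real (wt k w) * iexp (t * N k w) \<partial>M"
    have I_eq: "char (\<mu> k) t - char L t = I k / c k" for k
    proof -
      have i1: "integrable M (\<lambda>w. complex_of_real (wt k w) * iexp (t * N k w))"
        using wt_b by (intro integrable_const_bound[of _ 3]) (auto simp: norm_mult)
      have i2: "integrable M (\<lambda>w. complex_of_real (wt k w))"
        using int_w by simp
      have "char (\<mu> k) t = (\<integral>w. (wt k w / c k) *\<^sub>R iexp (t * N k w) \<partial>M)"
        unfolding char_def by (rule integral_\<mu>) measurable
      also have "\<dots> = (\<integral>w. complex_of_real (wt k w) * iexp (t * N k w) / c k \<partial>M)"
        by (simp add: scaleR_conv_of_real)
      also have "\<dots> = ?J k / c k"
        by (rule integral_divide_zero)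
      finally have 1: "char (\<mu> k) t = ?J k / c k" .
      have "I k = ?J k -
          (\<integral>w. complex_of_real (wt k w) * exp (- (t\<^sup>2 / 2 * s2)) \<partial>M)"
        unfolding I_def right_diff_distrib using i1 i2
        by (intro Bochner_Integration.integral_diff integrable_mult_left) auto
      also have "(\<integral>w. complex_of_real (wt k w) * exp (- (t\<^sup>2 / 2 * s2)) \<partial>M) = c k * exp (- (t\<^sup>2 / 2 * s2))"
        by (simp add: c_def)
      finally show ?thesis using c_pos[of k] unfolding 1 char_L by (simp add: diff_divide_distrib)
    qed
    have "\<bar>2 + \<Psi> k w\<bar> \<le> 3" for k w using \<Psi>(2)[of k w] by (simp add: abs_le_iff)
    then have "I \<longlonglongrightarrow> 0"
      unfolding I_def[abs_def] wt_def N_def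
      using \<Psi>(1) by (intro weighted_char_tendsto[OF f b s2 variance_limit, where B=3]) auto
    then have "(\<lambda>k. norm (I k) * (1 / p k)) \<longlonglongrightarrow> 0 * (1 / (\<integral>w. W_nonzero w \<partial>M))"
      using expectation_W_nonzero_pos by (intro tendsto_intros p_lim tendsto_norm_zero) auto
    then have lim: "(\<lambda>k. norm (I k) * (1 / p k)) \<longlonglongrightarrow> 0" by simp
    have "(\<lambda>k. char (\<mu> k) t - char L t) \<longlonglongrightarrow> 0"
    proof (rule Lim_null_comparison[OF _ lim])
      have "norm (char (\<mu> k) t - char L t) \<le> norm (I k) * (1 / p k)" for k
        unfolding I_eq using c_ge[of k] p_pos[of k] c_pos[of k]
        by (simp add: norm_divide divide_left_mono)
      then show "\<forall>\<^sub>F k in sequentially. norm (char (\<mu> k) t - char L t) \<le> norm (I k) * (1 / p k)"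
        by simp
    qed
    then show ?thesis by (simp add: LIM_zero_iff)
  qed
  then have weak: "weak_conv_m \<mu> L" by (intro levy_continuity \<mu> L)
  have "(\<lambda>k. integral\<^sup>L (\<mu> k) e) \<longlonglongrightarrow> integral\<^sup>L L e"
    using e by (intro weak_conv_imp_integral_bdd_continuous_conv[OF \<mu> L weak, where B=K])
      (auto simp: continuous_on_eq_continuous_at)
  then have lim: "(\<lambda>k. integral\<^sup>L (\<mu> k) e - integral\<^sup>L L e) \<longlonglongrightarrow> 0" by (simp add: LIM_zero_iff)
  have Le: "integral\<^sup>L L e = (\<integral>x. e (sqrt s2 * x) \<partial>std_normal_distribution)"
    unfolding L_def by (rule integral_distr) auto
  define l where "l = integral\<^sup>L L e"
  have eq: "(\<integral>w. wt k w * (e (N k w) - l) \<partial>M) = c k * (integral\<^sup>L (\<mu> k) e - l)" for k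
  proof -
    have i1: "integrable M (\<lambda>w. wt k w * e (N k w))"
    proof (rule integrable_const_bound[of _ "3 * K"])
      have "\<bar>wt k w * e (N k w)\<bar> \<le> 3 * K" for w
        unfolding abs_mult using wt_b(2,3)[of k w] e by (intro mult_mono) auto
      then show "AE w in M. norm (wt k w * e (N k w)) \<le> 3 * K" by simp
    qed measurable
    have "integral\<^sup>L (\<mu> k) e = (\<integral>w. wt k w * e (N k w) \<partial>M) / c k"
      by (simp add: integral_\<mu>)
    moreover have "(\<integral>w. wt k w * (e (N k w) - l) \<partial>M) = (\<integral>w. wt k w * e (N k w) \<partial>M) - c k * l"
      unfolding right_diff_distrib using i1 int_w[of k] by (simp add: c_def)
    ultimately show ?thesis using c_pos[of k] by (simp add: right_diff_distrib)
  qed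
  have "(\<lambda>k. \<integral>w. wt k w * (e (N k w) - l) \<partial>M) \<longlonglongrightarrow> 0"
  proof (rule Lim_null_comparison)
    show "(\<lambda>k. 3 * \<bar>integral\<^sup>L (\<mu> k) e - l\<bar>) \<longlonglongrightarrow> 0"
      using lim unfolding l_def by (intro tendsto_mult_right_zero tendsto_rabs_zero)
    have "norm (\<integral>w. wt k w * (e (N k w) - l) \<partial>M) \<le> 3 * \<bar>integral\<^sup>L (\<mu> k) e - l\<bar>" for k
      unfolding eq using c_pos[of k] c_le[of k] by (simp add: abs_mult mult_right_mono)
    then show "\<forall>\<^sub>F k in sequentially. norm (\<integral>w. wt k w * (e (N k w) - l) \<partial>M) \<le> 3 * \<bar>integral\<^sup>L (\<mu> k) e - l\<bar>"
      by simp
  qed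
  then show ?thesis unfolding l_def Le unfolding wt_def N_def .
qed

text \<open>By linearity: a signed weight \<Psi> is \<open>B'\<close> times the difference of the
  positive weights \<open>2 + \<Psi> / B'\<close> and \<open>2 + 0\<close>. Taking
  \<open>B' = max 1 B\<close> keeps the divisor positive.\<close>

lemma weighted_clt:
  fixes f :: "'a family \<Rightarrow> real"
  assumes f [measurable]: "f \<in> borel_measurable triple_borel" and b: "\<And>u. \<bar>f u\<bar> \<le> b"
    and s2: "0 \<le> s2"
    and variance_limit: "\<And>x. (\<lambda>r. (offspring_op ^^ r) (\<lambda>x. kernel_variance f x - s2 * alive x) x) \<longlonglongrightarrow> 0"
    and \<Psi>: "\<And>k. \<Psi> k \<in> borel_measurable (\<F> k)" "\<And>k w. \<bar>\<Psi> k w\<bar> \<le> B"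
    and e: "continuous_on UNIV e" "\<And>x. \<bar>e x\<bar> \<le> K"
  shows "(\<lambda>k. \<integral>w. survives k w * (\<Psi> k w *
    (e (fluctuation P X k f w) - (\<integral>x. e (sqrt s2 * x) \<partial>std_normal_distribution))) \<partial>M) \<longlonglongrightarrow> (0::real)"
proof -
  note [measurable] = measurable_from_\<F>[OF \<Psi>(1)]
  have [measurable]: "e \<in> borel_measurable borel" by (rule borel_measurable_continuous_onI[OF e(1)])
  define l where "l = (\<integral>x. e (sqrt s2 * x) \<partial>std_normal_distribution)"
  define g where "g k w = survives k w * (e (fluctuation P X k f w) - l)" for k w
  have [measurable]: "g k \<in> borel_measurable M" for k unfolding g_def[abs_def] by measurable
  define B' where "B' = max 1 B"
  have B': "B' > 0" "\<And>k w. \<bar>\<Psi> k w\<bar> \<le> B'" using \<Psi>(2) by (auto simp: B'_def le_max_iff_disj)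
  have K: "0 \<le> K" using e(2) abs_ge_zero order_trans by blast
  have g_b: "\<bar>g k w\<bar> \<le> K + \<bar>l\<bar>" for k w
  proof -
    have "\<bar>e (fluctuation P X k f w) - l\<bar> \<le> K + \<bar>l\<bar>"
      by (rule order_trans[OF abs_triangle_ineq4]) (simp add: e)
    then show ?thesis using K by (auto simp: g_def)
  qed
  have int: "integrable M (g k)" "integrable M (\<lambda>w. \<Psi> k w * g k w)" for k
  proof -
    show "integrable M (g k)" using g_b by (intro integrable_const_bound[of _ "K + \<bar>l\<bar>"]) auto
    have "\<bar>\<Psi> k w * g k w\<bar> \<le> B' * (K + \<bar>l\<bar>)" for w
      unfolding abs_mult using B' g_b by (intro mult_mono) auto
    then show "integrable M (\<lambda>w. \<Psi> k w * g k w)"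
      by (intro integrable_const_bound[of _ "B' * (K + \<bar>l\<bar>)"]) auto
  qed
  have "(\<lambda>k. \<integral>w. (2 + \<Psi>' k w) * g k w \<partial>M) \<longlonglongrightarrow> 0"
    if "\<And>k. \<Psi>' k \<in> borel_measurable (\<F> k)" "\<And>k w. \<bar>\<Psi>' k w\<bar> \<le> 1" for \<Psi>'
    using density_clt[OF f b s2 variance_limit that e] by (simp only: g_def l_def mult.assoc)
  from this[of "\<lambda>k w. \<Psi> k w / B'"] this[of "\<lambda>_ _. 0"]
  have "(\<lambda>k. B' * ((\<integral>w. (2 + \<Psi> k w / B') * g k w \<partial>M) - (\<integral>w. (2 + 0) * g k w \<partial>M))) \<longlonglongrightarrow> B' * (0 - 0)"
    using \<Psi>(1) B' by (intro tendsto_intros) (auto simp: divide_le_eq)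
  moreover have "B' * ((\<integral>w. (2 + \<Psi> k w / B') * g k w \<partial>M) - (\<integral>w. (2 + 0) * g k w \<partial>M)) = (\<integral>w. \<Psi> k w * g k w \<partial>M)" for k
  proof -
    have "(\<integral>w. (2 + \<Psi> k w / B') * g k w \<partial>M) = 2 * (\<integral>w. g k w \<partial>M) + (\<integral>w. \<Psi> k w * g k w \<partial>M) / B'"
      using int[of k] by (simp add: distrib_right)
    then show ?thesis using B' by simp
  qed
  ultimately show ?thesis by (simp add: g_def l_def mult.left_commute)
qed

text \<open>The index set \<open>{d - j<..d}\<close> starts with the oldest generation, and each
  step adds the next newer one, \<open>l = d - j\<close>. The product \<open>Q\<close> over the
  larger indices concerns generations before \<open>n + 1 - l\<close>, so it is an admissible
  weight; \<open>weighted_clt\<close> then replaces the new factor by its Gaussian mean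
  \<open>c l\<close>.\<close>

lemma joint_clt:
  fixes f :: "nat \<Rightarrow> 'a family \<Rightarrow> real" and e :: "nat \<Rightarrow> real \<Rightarrow> real"
  assumes f: "\<And>l. l \<in> {1..d} \<Longrightarrow> f l \<in> borel_measurable triple_borel"
    and b: "\<And>l u. l \<in> {1..d} \<Longrightarrow> \<bar>f l u\<bar> \<le> b l"
    and s2: "\<And>l. l \<in> {1..d} \<Longrightarrow> 0 \<le> s2 l"
    and variance_limit: "\<And>l x. l \<in> {1..d} \<Longrightarrow>
      (\<lambda>r. (offspring_op ^^ r) (\<lambda>x. kernel_variance (f l) x - s2 l * alive x) x) \<longlonglongrightarrow> 0"
    and e: "\<And>l. l \<in> {1..d} \<Longrightarrow> continuous_on UNIV (e l)" "\<And>l x. l \<in> {1..d} \<Longrightarrow> \<bar>e l x\<bar> \<le> K l"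
    and j: "j \<le> d"
  shows "(\<lambda>n. \<integral>w. W_nonzero w * (\<Prod>l\<in>{d - j<..d}. e l (fluctuation P X (n + 1 - l) (f l) w)) \<partial>M) \<longlonglongrightarrow>
    (\<integral>w. W_nonzero w \<partial>M) * (\<Prod>l\<in>{d - j<..d}. \<integral>x. e l (sqrt (s2 l) * x) \<partial>std_normal_distribution)"
  using j
proof (induction j)
  case 0
  then show ?case by simp
next
  case (Suc j)
  define l where "l = d - j"
  have l: "l \<in> {1..d}" "1 \<le> l" "l \<le> d" using Suc(2) by (auto simp: l_def)
  have ivl: "{d - Suc j<..d} = insert l {l<..d}" "{d - j<..d} = {l<..d}" "l \<notin> {l<..d}"
  proof -
    have "i \<in> {d - Suc j<..d} \<longleftrightarrow> i \<in> insert l {l<..d}" for i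
      unfolding l_def using Suc(2) by (simp only: greaterThanAtMost_iff insert_iff) arith
    then show "{d - Suc j<..d} = insert l {l<..d}" by (rule set_eqI)
  qed (simp_all add: l_def)
  have sub: "i \<in> {1..d}" if "i \<in> {l<..d}" for i using that l by auto
  define c where "c l = (\<integral>x. e l (sqrt (s2 l) * x) \<partial>std_normal_distribution)" for l
  define Q where "Q n w = (\<Prod>i\<in>{l<..d}. e i (fluctuation P X (n + 1 - i) (f i) w))" for n w
  let ?R = "\<lambda>n w. (Q n w * (e l (fluctuation P X (n + 1 - l) (f l) w) - c l))"
  define Kp where "Kp = (\<Prod>i\<in>{l<..d}. K i)"
  have e_m: "e i \<in> borel_measurable borel" if "i \<in> {1..d}" for i
    by (rule borel_measurable_continuous_onI[OF e(1)[OF that]])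
  have K0: "0 \<le> K i" if "i \<in> {1..d}" for i
    using e(2)[OF that, of 0] by linarith
  have Kp: "0 \<le> Kp" unfolding Kp_def using sub K0 by (intro prod_nonneg) auto
  have Q_b: "\<bar>Q n w\<bar> \<le> Kp" for n w
    unfolding Q_def Kp_def abs_prod using e(2) sub by (intro prod_mono) auto
  have Q_meas: "Q n \<in> borel_measurable (\<F> (n + 1 - l))" if "n \<ge> d" for n
    unfolding Q_def[abs_def]
  proof (rule borel_measurable_prod)
    fix i assume i: "i \<in> {l<..d}"
    show "(\<lambda>w. e i (fluctuation P X (n + 1 - i) (f i) w)) \<in> borel_measurable (\<F> (n + 1 - l))"
      by (rule measurable_compose[OF measurable_fluctuation_\<F>[OF f] e_m])
        (use i sub that l in auto)
  qed
  have Q_M [measurable]: "Q n \<in> borel_measurable M" for n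
    unfolding Q_def[abs_def]
    using sub f e_m by (intro borel_measurable_prod measurable_compose[OF measurable_fluctuation]) auto
  have [measurable]: "(\<lambda>w. e l (fluctuation P X n (f l) w)) \<in> borel_measurable M" for n
    by (rule measurable_compose[OF measurable_fluctuation[OF f[OF l(1)]] e_m[OF l(1)]])
  \<comment> \<open>Reindexed by the generation \<open>k = n + 1 - l\<close>, that is
    \<open>n = k + l - 1\<close>. For the finitely many \<open>k\<close> with \<open>n < d\<close>
    the subtractions may truncate and \<open>Q_meas\<close> does not apply; the weight is 0
    there.\<close>
  define \<Psi> where "\<Psi> k = (if d < k + l then Q (k + l - 1) else (\<lambda>_. 0))" for k
  have "\<Psi> k \<in> borel_measurable (\<F> k)" for k
    using Q_meas[of "k + l - 1"] l by (auto simp: \<Psi>_def)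
  moreover have "\<bar>\<Psi> k w\<bar> \<le> Kp" for k w using Q_b Kp by (auto simp: \<Psi>_def)
  ultimately have lim: "(\<lambda>k. \<integral>w. survives k w * (\<Psi> k w *
      (e l (fluctuation P X k (f l) w) - c l)) \<partial>M) \<longlonglongrightarrow> 0"
    unfolding c_def
    by (rule weighted_clt[OF f[OF l(1)] b[OF l(1)] s2[OF l(1)] variance_limit[OF l(1)] _ _
        e(1)[OF l(1)] e(2)[OF l(1)]])
  have flim: "filterlim (\<lambda>n. n + 1 - l) at_top sequentially"
    unfolding filterlim_at_top
  proof
    show "\<forall>\<^sub>F n in sequentially. z \<le> n + 1 - l" for z
      by (rule eventually_sequentiallyI[of "z + l"]) arith
  qed
  have "(\<lambda>n. \<integral>w. survives (n + 1 - l) w * (\<Psi> (n + 1 - l) w *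
      (e l (fluctuation P X (n + 1 - l) (f l) w) - c l)) \<partial>M) \<longlonglongrightarrow> 0"
    by (rule filterlim_compose[OF lim flim])
  then have 1: "(\<lambda>n. \<integral>w. survives (n + 1 - l) w * ?R n w \<partial>M) \<longlonglongrightarrow> 0"
  proof (rule Lim_transform_eventually)
    have "\<Psi> (n + 1 - l) = Q n" if "n \<ge> d" for n using that l by (auto simp: \<Psi>_def)
    then show "\<forall>\<^sub>F n in sequentially. (\<integral>w. survives (n + 1 - l) w * (\<Psi> (n + 1 - l) w *
      (e l (fluctuation P X (n + 1 - l) (f l) w) - c l)) \<partial>M) = (\<integral>w. survives (n + 1 - l) w * ?R n w \<partial>M)"
      by (intro eventually_sequentiallyI[of d]) simp
  qed
  have F_b: "\<bar>?R n w\<bar> \<le> Kp * (K l + \<bar>c l\<bar>)" for n w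
    unfolding abs_mult using Q_b Kp e(2)[OF l(1)]
    by (intro mult_mono order_trans[OF abs_triangle_ineq4]) auto
  have 2: "(\<lambda>n. (\<integral>w. survives (n + 1 - l) w * ?R n w \<partial>M) - (\<integral>w. W_nonzero w * ?R n w \<partial>M)) \<longlonglongrightarrow> 0"
    by (rule survival_swap[OF _ F_b flim]) measurable
  have 3: "(\<lambda>n. (\<integral>w. W_nonzero w * Q n w \<partial>M) * c l) \<longlonglongrightarrow>
      (\<integral>w. W_nonzero w \<partial>M) * (\<Prod>i\<in>{l<..d}. c i) * c l"
    using Suc unfolding ivl by (intro tendsto_intros) (auto simp: Q_def c_def)
  have eq: "(\<integral>w. W_nonzero w * (\<Prod>i\<in>{d - Suc j<..d}. e i (fluctuation P X (n + 1 - i) (f i) w)) \<partial>M) =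
      (\<integral>w. W_nonzero w * ?R n w \<partial>M) +
      (\<integral>w. W_nonzero w * Q n w \<partial>M) * c l" for n
  proof -
    have i1: "integrable M (\<lambda>w. W_nonzero w * ?R n w)"
    proof (rule integrable_const_bound[of _ "Kp * (K l + \<bar>c l\<bar>)"])
      show "AE w in M. norm (W_nonzero w * ?R n w)
          \<le> Kp * (K l + \<bar>c l\<bar>)"
        using F_b[of n] Kp K0[OF l(1)] by (intro AE_I2) (auto simp: of_bool_def)
    qed measurable
    have i2: "integrable M (\<lambda>w. W_nonzero w * Q n w)"
      using Q_b[of n] Kp by (intro integrable_const_bound[of _ Kp]) (auto simp: of_bool_def)
    have "(\<integral>w. W_nonzero w * (\<Prod>i\<in>{d - Suc j<..d}. e i (fluctuation P X (n + 1 - i) (f i) w)) \<partial>M) =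
        (\<integral>w. W_nonzero w * ?R n w +
        W_nonzero w * Q n w * c l \<partial>M)"
      unfolding ivl by (intro Bochner_Integration.integral_cong) (auto simp: Q_def algebra_simps)
    also have "\<dots> = (\<integral>w. W_nonzero w * ?R n w \<partial>M) +
        (\<integral>w. W_nonzero w * Q n w * c l \<partial>M)"
      by (intro Bochner_Integration.integral_add i1 integrable_mult_left i2)
    finally show ?thesis by simp
  qed
  have eq_lim: "(\<integral>w. W_nonzero w \<partial>M) * (\<Prod>i\<in>{d - Suc j<..d}. c i) =
      (0 - 0) + (\<integral>w. W_nonzero w \<partial>M) * (\<Prod>i\<in>{l<..d}. c i) * c l"
    unfolding ivl by (simp add: mult_ac)
  then show ?case
    unfolding eq c_def[symmetric] eq_lim using tendsto_add[OF tendsto_diff[OF 1 2] 3] by simp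
qed

end

section \<open>The limit law and the conclusion\<close>

lemma bcontfun_bounded:
  fixes f :: "'b::topological_space \<Rightarrow> real"
  assumes "f \<in> bcontfun"
  obtains b where "\<And>u. \<bar>f u\<bar> \<le> b"
  using assms by (auto simp: bcontfun_def bounded_iff)

lemma bcontfun_mult_real:
  fixes f g :: "'b::topological_space \<Rightarrow> real"
  assumes "f \<in> bcontfun" "g \<in> bcontfun"
  shows "(\<lambda>x. f x * g x) \<in> bcontfun"
proof -
  obtain b c where b: "\<And>u. \<bar>f u\<bar> \<le> b" and c: "\<And>u. \<bar>g u\<bar> \<le> c"
    using assms bcontfun_bounded by metis
  show ?thesis
  proof (rule bcontfun_normI)
    show "norm (f x * g x) \<le> b * c" for x
      using mult_mono[OF b[of x] c[of x]] order_trans[OF abs_ge_zero b[of x]] by (simp add: abs_mult)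
  qed (use assms in \<open>auto simp: bcontfun_def intro: continuous_on_mult\<close>)
qed

text \<open>The preimages of measurable sets form a family closed under intersection, so
  independence of the given events extends to the generated sigma-algebras.\<close>

lemma (in prob_space) indep_set_imp_indep_var:
  assumes X: "X \<in> M \<rightarrow>\<^sub>M S" and Y: "Y \<in> M \<rightarrow>\<^sub>M T" and indep: "indep_set A B"
    and A: "\<And>C. C \<in> sets S \<Longrightarrow> X -` C \<inter> space M \<in> A"
    and B: "\<And>C. C \<in> sets T \<Longrightarrow> Y -` C \<inter> space M \<in> B"
  shows "indep_var S X T Y"
proof -
  have stable: "Int_stable {Z -` C \<inter> space M | C. C \<in> sets N}" for Z and N :: "'z measure"
  proof (rule Int_stableI)
    fix C D assume "C \<in> {Z -` C \<inter> space M | C. C \<in> sets N}" "D \<in> {Z -` C \<inter> space M | C. C \<in> sets N}"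
    then obtain C' D' where "C' \<in> sets N" "D' \<in> sets N" "C = Z -` C' \<inter> space M" "D = Z -` D' \<inter> space M"
      by blast
    then show "C \<inter> D \<in> {Z -` C \<inter> space M | C. C \<in> sets N}"
      by (auto intro!: exI[of _ "C' \<inter> D'"])
  qed
  show ?thesis
    unfolding indep_var_eq
    by (intro conjI X Y indep_set_sigma_sets indep_setI stable)
      (use measurable_sets[OF X] measurable_sets[OF Y] indep_setD[OF indep] A B in auto)
qed

text \<open>The event \<open>U w \<noteq> 0\<close> is first split off from the whole vector, then
  the coordinates from each other.\<close>

lemma (in prob_space) expectation_mixed_gaussian:
  fixes I :: "'i set" and G :: "'i \<Rightarrow> 'a \<Rightarrow> real" and U :: "'a \<Rightarrow> real"
  assumes I: "finite I"
    and U [measurable]: "U \<in> borel_measurable M"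
    and G: "\<And>i. i \<in> I \<Longrightarrow> distributed M lborel (G i) std_normal_density"
    and indep: "indep_vars (\<lambda>_. borel) G I"
    and indep_U: "indep_set {U -` A \<inter> space M | A. A \<in> sets borel}
      {(\<lambda>w. \<lambda>i\<in>I. G i w) -` B \<inter> space M | B. B \<in> sets (PiM I (\<lambda>_. borel))}"
    and e: "\<And>i. i \<in> I \<Longrightarrow> continuous_on UNIV (e i :: real \<Rightarrow> real)" "\<And>i x. i \<in> I \<Longrightarrow> \<bar>e i x\<bar> \<le> K i"
  shows "(\<integral>w. of_bool (U w \<noteq> 0) * (\<Prod>i\<in>I. e i (\<sigma> i * G i w)) \<partial>M) =
    (\<integral>w. of_bool (U w \<noteq> 0) \<partial>M) * (\<Prod>i\<in>I. \<integral>x. e i (\<sigma> i * x) \<partial>std_normal_distribution)"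
proof -
  let ?H = "\<lambda>w. \<Prod>i\<in>I. e i (\<sigma> i * G i w)"
  have G_m: "G i \<in> borel_measurable M" if "i \<in> I" for i
    using distributed_measurable[OF G[OF that]] by simp
  have e_m: "e i \<in> borel_measurable borel" if "i \<in> I" for i
    by (rule borel_measurable_continuous_onI[OF e(1)[OF that]])
  have es_m: "(\<lambda>x. e i (\<sigma> i * x)) \<in> borel_measurable borel" if "i \<in> I" for i
    by (rule measurable_compose[OF _ e_m[OF that]]) simp
  have Grest: "(\<lambda>w. \<lambda>i\<in>I. G i w) \<in> M \<rightarrow>\<^sub>M PiM I (\<lambda>_. borel)"
    by (rule measurable_restrict[OF G_m])
  define H where "H x = (\<Prod>i\<in>I. e i (\<sigma> i * x i))" for x
  have H_m: "H \<in> borel_measurable (PiM I (\<lambda>_. borel))"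
    unfolding H_def[abs_def]
  proof (rule borel_measurable_prod)
    fix i assume i: "i \<in> I"
    have "(\<lambda>x. x i) \<in> PiM I (\<lambda>_. borel) \<rightarrow>\<^sub>M (borel :: real measure)"
      using i by simp
    then show "(\<lambda>x. e i (\<sigma> i * x i)) \<in> borel_measurable (PiM I (\<lambda>_. borel))"
      by (rule measurable_compose[OF _ es_m[OF i]])
  qed
  have H_rest: "H (\<lambda>i\<in>I. G i w) = ?H w" for w
    by (auto simp: H_def intro!: prod.cong)
  have "indep_var borel (\<lambda>w. of_bool (U w \<noteq> 0) :: real) borel (\<lambda>w. H (\<lambda>i\<in>I. G i w))"
  proof (rule indep_set_imp_indep_var[OF _ _ indep_U])
    show "(\<lambda>w. H (\<lambda>i\<in>I. G i w)) \<in> borel_measurable M"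
      by (rule measurable_compose[OF Grest H_m])
    fix C :: "real set" assume C: "C \<in> sets borel"
    have "(\<lambda>u. of_bool (u \<noteq> 0) :: real) \<in> borel_measurable (borel :: real measure)" by measurable
    from measurable_sets[OF this C]
    show "(\<lambda>w. of_bool (U w \<noteq> 0) :: real) -` C \<inter> space M \<in> {U -` A \<inter> space M | A. A \<in> sets borel}"
      by (auto intro!: exI[of _ "(\<lambda>u. of_bool (u \<noteq> 0)) -` C"])
    show "(\<lambda>w. H (\<lambda>i\<in>I. G i w)) -` C \<inter> space M \<in>
        {(\<lambda>w. \<lambda>i\<in>I. G i w) -` B \<inter> space M | B. B \<in> sets (PiM I (\<lambda>_. borel))}"
      using measurable_sets[OF H_m C] measurable_space[OF Grest]
      by (auto intro!: exI[of _ "H -` C \<inter> space (PiM I (\<lambda>_. borel))"])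
  qed simp
  then have iv: "indep_var borel (\<lambda>w. of_bool (U w \<noteq> 0) :: real) borel (\<lambda>w. ?H w)"
    unfolding H_rest .
  have int: "integrable M (\<lambda>w. e i (\<sigma> i * G i w))" if "i \<in> I" for i
    using e(2)[OF that] measurable_compose[OF G_m es_m, OF that that]
    by (intro integrable_const_bound[of _ "K i"]) auto
  have indep_e: "indep_vars (\<lambda>_. borel) (\<lambda>i w. e i (\<sigma> i * G i w)) I"
    by (rule indep_vars_compose2[OF indep es_m])
  have "(\<integral>w. of_bool (U w \<noteq> 0) * ?H w \<partial>M) =
      (\<integral>w. of_bool (U w \<noteq> 0) \<partial>M) * (\<integral>w. ?H w \<partial>M)"
  proof (rule indep_var_lebesgue_integral[OF iv])
    show "integrable M (\<lambda>w. ?H w)"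
      by (rule indep_vars_integrable[OF I indep_e int])
  qed simp
  also have "(\<integral>w. ?H w \<partial>M) = (\<Prod>i\<in>I. \<integral>w. e i (\<sigma> i * G i w) \<partial>M)"
    by (rule indep_vars_lebesgue_integral[OF I indep_e int])
  also have "\<dots> = (\<Prod>i\<in>I. \<integral>x. e i (\<sigma> i * x) \<partial>std_normal_distribution)"
  proof (rule prod.cong[OF refl])
    fix i assume i: "i \<in> I"
    have "(\<integral>x. e i (\<sigma> i * x) \<partial>std_normal_distribution) = (\<integral>x. e i (\<sigma> i * x) \<partial>distr M lborel (G i))"
      by (simp add: distributed_distr_eq_density[OF G[OF i]])
    also have "\<dots> = (\<integral>w. e i (\<sigma> i * G i w) \<partial>M)"
      using es_m[OF i] distributed_measurable[OF G[OF i]] by (intro integral_distr) auto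
    finally show "(\<integral>w. e i (\<sigma> i * G i w) \<partial>M) = (\<integral>x. e i (\<sigma> i * x) \<partial>std_normal_distribution)" ..
  qed
  finally show ?thesis .
qed

text \<open>Continuity on the triple space is paired with measurability for the product
  sigma-algebra, which a continuous function may lack when the space is not separable. The
  subtraction \<open>n + 1 - l\<close> truncates for finitely many \<open>n\<close> only, which does
  not affect the limit.\<close>

theorem theorem1p4:
  fixes M :: "'w measure"
    and \<nu> :: "'a::metric_space option measure"
    and P :: "'a option \<Rightarrow> ('a option \<times> 'a option) measure"
    and X :: "bool list \<Rightarrow> 'w \<Rightarrow> 'a option"
    and p10 p0 p1 m :: real
    and W :: "'w \<Rightarrow> real"
    and MY :: "'a \<Rightarrow> 'y measure"
    and Y :: "'a \<Rightarrow> nat \<Rightarrow> 'y \<Rightarrow> 'a"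
    and \<mu> :: "'a measure"
    and d :: nat
    and f :: "nat \<Rightarrow> 'a option \<times> 'a option \<times> 'a option \<Rightarrow> real"
    and \<sigma> :: "nat \<Rightarrow> real"
    and M' :: "'v measure"
    and W' :: "'v \<Rightarrow> real"
    and G :: "nat \<Rightarrow> 'v \<Rightarrow> real"
  assumes kernel: "bifurcating_kernel P"
    and initial_law: "emeasure \<nu> {None} = 0"
    and BMC: "bifurcating_Markov_chain M \<nu> P X"
    and homogeneous: "spatially_homogeneous P p10 p0 p1"
    and m_def: "m = 2 * p10 + p0 + p1"
    and super_critical: "m > 1"
    and W_measurable: "W \<in> borel_measurable M"
    and W_AE: "AE \<omega> in M. (\<lambda>q. real (card (living_generation X q \<omega>)) / m ^ q) \<longlonglongrightarrow> W \<omega>"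
    and W_L2: "(\<lambda>q. \<integral>\<^sup>+\<omega>. ennreal ((real (card (living_generation X q \<omega>)) / m ^ q - W \<omega>)\<^sup>2) \<partial>M)
                 \<longlonglongrightarrow> 0"
    and Y_chain: "\<And>x. Markov_chain (MY x) (return borel x) (auxiliary_kernel m P) (Y x)"
    and \<mu>_prob: "prob_space \<mu>" "sets \<mu> = sets borel"
    and ergodic: "\<And>h x. h \<in> bcontfun \<Longrightarrow>
                   (\<lambda>k. \<integral>\<omega>. h (Y x k \<omega>) \<partial>MY x) \<longlonglongrightarrow> (\<integral>y. (h y :: real) \<partial>\<mu>)"
    and Feller: "\<And>g. g \<in> bcontfun \<Longrightarrow> g \<in> borel_measurable triple_borel \<Longrightarrow>
                   kernel_op P g \<in> bcontfun"
    and d: "d \<ge> 1"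
    and f: "\<And>l. l \<in> {1..d} \<Longrightarrow> f l \<in> bcontfun"
           "\<And>l. l \<in> {1..d} \<Longrightarrow> f l \<in> borel_measurable triple_borel"
    and \<sigma>: "\<And>l. l \<in> {1..d} \<Longrightarrow> \<sigma> l = sqrt (limit_variance P \<mu> (f l))"
    and M'_prob: "prob_space M'"
    and W'_measurable: "W' \<in> borel_measurable M'"
    and W'_law: "distr M' borel W' = distr M borel W"
    and G_normal: "\<And>l. l \<in> {1..d} \<Longrightarrow> distributed M' lborel (G l) std_normal_density"
    and G_indep: "prob_space.indep_vars M' (\<lambda>_. borel) G {1..d}"
    and G_indep_W': "prob_space.indep_set M'
           {W' -` A \<inter> space M' | A. A \<in> sets borel}
           {(\<lambda>\<omega>. \<lambda>l\<in>{1..d}. G l \<omega>) -` B \<inter> space M' | B. B \<in> sets (PiM {1..d} (\<lambda>_. borel))}"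
  shows "converges_in_distribution (Rn d)
           M (\<lambda>n \<omega>. \<lambda>l\<in>{1..d}. fluctuation P X (n + 1 - l) (f l) \<omega>
                                  * of_bool (card (living_generation X n \<omega>) > 0))
           M' (\<lambda>\<omega>. \<lambda>l\<in>{1..d}. of_bool (W' \<omega> \<noteq> 0) * (\<sigma> l * G l \<omega>))"
proof -
  let ?V = "\<lambda>n w. (\<lambda>l\<in>{1..d}. fluctuation P X (n + 1 - l) (f l) w *
        of_bool (card (living_generation X n w) > 0))"
  let ?Z = "\<lambda>w. (\<lambda>l\<in>{1..d}. of_bool (W' w \<noteq> 0) * (\<sigma> l * G l w))"
  interpret BMC M \<nu> P X
    by unfold_locales (rule kernel, rule BMC)
  interpret supercritical_limit M \<nu> P X p10 p0 p1 m W
    by unfold_locales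
      (use initial_law homogeneous m_def super_critical W_measurable W_AE W_L2 in \<open>simp_all add: total_alive\<close>)
  interpret M': prob_space M' by fact
  interpret \<mu>: prob_space \<mu> by fact
  have "\<exists>b. \<forall>u. \<bar>f l u\<bar> \<le> b" if "l \<in> {1..d}" for l
    using bcontfun_bounded[OF f(1)[OF that]] by metis
  then obtain b where b: "\<And>l u. l \<in> {1..d} \<Longrightarrow> \<bar>f l u\<bar> \<le> b l" by metis
  define s2 where "s2 l = limit_variance P \<mu> (f l)" for l
  have s2_eq: "s2 l = (\<integral>x. kernel_variance (f l) (Some x) \<partial>\<mu>)" for l
    by (simp add: s2_def limit_variance_def kernel_variance_def)
  have s2: "0 \<le> s2 l" if "l \<in> {1..d}" for l
    unfolding s2_eq using kernel_variance_bounds(1)[OF f(2)[OF that] b[OF that]]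
    by (intro integral_nonneg_AE) auto
  \<comment> \<open>Ergodicity and the Feller property enter here: the conditional variance is
    bounded and continuous on S, so its expectation along the chain tends to its
    \<open>\<mu>\<close>-mean \<open>s2 l\<close>. At the cemetery the iterates vanish.\<close>
  have variance_limit: "(\<lambda>r. (offspring_op ^^ r) (\<lambda>x. kernel_variance (f l) x - s2 l * alive x) x) \<longlonglongrightarrow> 0"
    if l: "l \<in> {1..d}" for l x
  proof -
    note bounds = kernel_variance_bounds[OF f(2)[OF l] b[OF l]]
    define h where "h x = kernel_variance (f l) x - s2 l * alive x" for x
    have h_m: "h \<in> borel_measurable borel"
      unfolding h_def[abs_def] using f(2)[OF l] by measurable
    have h_b: "\<bar>h x\<bar> \<le> ((b l)\<^sup>2 + s2 l) * alive x" for x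
      using bounds[of x] s2[OF l] kernel_variance_None[OF f(2)[OF l] b[OF l]]
      by (cases x) (auto simp: h_def)
    show ?thesis
    proof (cases x)
      case None
      then have "(offspring_op ^^ r) h x = 0" for r
        using offspring_op_iterate(2)[OF h_m h_b, of r None] by simp
      then show ?thesis by (simp add: h_def[abs_def])
    next
      case (Some y)
      have "kernel_op P (\<lambda>u. f l u * f l u) \<in> bcontfun"
        using f l by (intro Feller bcontfun_mult_real borel_measurable_times) auto
      moreover have "kernel_op P (f l) \<in> bcontfun" using f l by (intro Feller) auto
      ultimately have "kernel_variance (f l) \<in> bcontfun"
        unfolding kernel_variance_def[abs_def] power2_eq_square by (intro minus_cont bcontfun_mult_real)
      then have "continuous_on UNIV (\<lambda>y. kernel_variance (f l) (Some y))"
        by (intro continuous_on_compose2[OF _ continuous_on_Some]) (auto simp: bcontfun_def)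
      then have "(\<lambda>y. kernel_variance (f l) (Some y) - s2 l) \<in> bcontfun"
        using bounds s2[OF l]
        by (intro bcontfun_normI[of _ "(b l)\<^sup>2 + s2 l"] continuous_intros) (auto simp: abs_le_iff add_increasing2 add_increasing)
      from ergodic[OF this, of y]
      have "(\<lambda>r. \<integral>w. h (Some (Y y r w)) \<partial>MY y) \<longlonglongrightarrow> (\<integral>y. kernel_variance (f l) (Some y) - s2 l \<partial>\<mu>)"
        by (simp add: h_def)
      moreover have "(\<integral>y. kernel_variance (f l) (Some y) - s2 l \<partial>\<mu>) = 0"
      proof -
        have "(\<lambda>y. kernel_variance (f l) (Some y)) \<in> borel_measurable \<mu>"
          unfolding measurable_cong_sets[OF \<mu>_prob(2) refl]
          by (rule measurable_compose[OF measurable_Some_borel measurable_kernel_variance[OF f(2)[OF l]]])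
        then have "integrable \<mu> (\<lambda>y. kernel_variance (f l) (Some y))"
          using bounds by (intro \<mu>.integrable_const_bound[of _ "(b l)\<^sup>2"]) auto
        then show ?thesis using \<mu>.prob_space by (simp add: s2_eq)
      qed
      ultimately show ?thesis
        using offspring_op_iterate_chain[OF Y_chain h_m h_b] by (simp add: Some h_def[abs_def])
    qed
  qed
  have fl_m [measurable]: "fluctuation P X n (f l) \<in> borel_measurable M" if "l \<in> {1..d}" for n l
    by (rule measurable_fluctuation[OF f(2)[OF that]])
  have G_m: "G l \<in> borel_measurable M'" if "l \<in> {1..d}" for l
    using distributed_measurable[OF G_normal[OF that]] by simp
  note [measurable] = W'_measurable
  have alive_pos: "card (living_generation X n w) > 0 \<longleftrightarrow> total alive n w > 0" for n w
    by (simp add: total_alive)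
  show ?thesis
  proof (rule converges_in_distribution_products[OF prob_space_axioms M'_prob])
    show "(\<lambda>w. ?V n w l) \<in> borel_measurable M" if "l \<in> {1..d}" for n l
      unfolding alive_pos using fl_m[OF that] that by simp
    show "(\<lambda>w. ?Z w l) \<in> borel_measurable M'" if "l \<in> {1..d}" for l
      using G_m[OF that] that by simp
  next
    fix e :: "nat \<Rightarrow> real \<Rightarrow> real"
    assume e: "\<And>l. l \<in> {1..d} \<Longrightarrow> continuous_on UNIV (e l)" "\<And>l. l \<in> {1..d} \<Longrightarrow> bounded (range (e l))"
    have "\<exists>K. \<forall>x. \<bar>e l x\<bar> \<le> K" if "l \<in> {1..d}" for l
      using e(2)[OF that] by (auto simp: bounded_iff)
    then obtain K where K: "\<And>l x. l \<in> {1..d} \<Longrightarrow> \<bar>e l x\<bar> \<le> K l" by metis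
    let ?K = "\<Prod>l\<in>{1..d}. K l"
    have e_m: "e l \<in> borel_measurable borel" if "l \<in> {1..d}" for l
      by (rule borel_measurable_continuous_onI[OF e(1)[OF that]])
    \<comment> \<open>The value of the test function on extinction, where every coordinate is 0. The
      rest, \<open>F n w - E0\<close>, appears multiplied by the survival indicator and is handled
      by \<open>survival_swap\<close>.\<close>
    define E0 where "E0 = (\<Prod>l\<in>{1..d}. e l 0)"
    define c where "c = (\<Prod>l\<in>{1..d}. \<integral>x. e l (sqrt (s2 l) * x) \<partial>std_normal_distribution)"
    define F where "F n w = (\<Prod>l\<in>{1..d}. e l (fluctuation P X (n + 1 - l) (f l) w))" for n w
    define pw where "pw = (\<integral>w. W_nonzero w \<partial>M)"
    have prod_b: "\<bar>\<Prod>l\<in>{1..d}. e l (x l)\<bar> \<le> ?K" for x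
      unfolding abs_prod by (intro prod_mono conjI abs_ge_zero K)
    have F_m [measurable]: "F n \<in> borel_measurable M" for n
      unfolding F_def[abs_def] by (intro borel_measurable_prod measurable_compose[OF fl_m e_m])
    have F_b: "\<bar>F n w\<bar> \<le> ?K" for n w unfolding F_def by (rule prod_b)
    have E0_b: "\<bar>E0\<bar> \<le> ?K" unfolding E0_def by (rule prod_b)
    have "(\<lambda>n. \<integral>w. W_nonzero w * F n w \<partial>M) \<longlonglongrightarrow> pw * c"
      using joint_clt[OF f(2) b s2 variance_limit e(1) K order_refl]
      by (simp add: F_def pw_def c_def atLeastSucAtMost_greaterThanAtMost[symmetric])
    moreover have "(\<lambda>n. (\<integral>w. survives n w * (F n w - E0) \<partial>M) -
        (\<integral>w. W_nonzero w * (F n w - E0) \<partial>M)) \<longlonglongrightarrow> 0"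
      using order_trans[OF abs_triangle_ineq4 add_mono[OF F_b E0_b]]
      by (intro survival_swap[of _ "?K + ?K"] filterlim_ident) auto
    ultimately have "(\<lambda>n. ((\<integral>w. survives n w * (F n w - E0) \<partial>M) -
        (\<integral>w. W_nonzero w * (F n w - E0) \<partial>M)) +
        ((\<integral>w. W_nonzero w * F n w \<partial>M) - pw * E0 + E0)) \<longlonglongrightarrow> 0 + (pw * c - pw * E0 + E0)"
      by (intro tendsto_intros)
    moreover have "(\<integral>w. W_nonzero w * (F n w - E0) \<partial>M) =
        (\<integral>w. W_nonzero w * F n w \<partial>M) - pw * E0" for n
    proof -
      have "integrable M (\<lambda>w. W_nonzero w * F n w)"
        using F_b[of n] order_trans[OF abs_ge_zero F_b[of n]]
        by (intro integrable_const_bound[of _ ?K]) (auto simp: of_bool_def)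
      then show ?thesis unfolding right_diff_distrib by (simp add: pw_def)
    qed
    moreover have "(\<integral>w. (\<Prod>l\<in>{1..d}. e l (?V n w l)) \<partial>M) =
        (\<integral>w. survives n w * (F n w - E0) \<partial>M) + E0" for n
    proof -
      have "(\<Prod>l\<in>{1..d}. e l (?V n w l)) =
          survives n w * (F n w - E0) + E0" for w
        unfolding alive_pos by (cases "total alive n w > 0") (auto simp: F_def E0_def)
      moreover have "integrable M (\<lambda>w. survives n w * (F n w - E0))"
      proof (rule integrable_const_bound[of _ "?K + ?K"])
        have "\<bar>F n w - E0\<bar> \<le> ?K + ?K" for w
          by (rule order_trans[OF abs_triangle_ineq4 add_mono[OF F_b E0_b]])
        then show "AE w in M. norm (survives n w * (F n w - E0)) \<le>
            ?K + ?K"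
          using order_trans[OF abs_ge_zero E0_b] by (intro AE_I2) (auto simp: of_bool_def)
      qed measurable
      ultimately show ?thesis by (simp add: prob_space)
    qed
    moreover have "(\<integral>w. (\<Prod>l\<in>{1..d}. e l (?Z w l)) \<partial>M') =
        pw * c - pw * E0 + E0"
    proof -
      define H where "H w = (\<Prod>l\<in>{1..d}. e l (\<sigma> l * G l w))" for w
      have [measurable]: "H \<in> borel_measurable M'"
        unfolding H_def[abs_def] using G_m
        by (intro borel_measurable_prod measurable_compose[OF _ e_m] borel_measurable_times) auto
      have H_b: "\<bar>H w\<bar> \<le> ?K" for w unfolding H_def by (rule prod_b)
      have "(\<Prod>l\<in>{1..d}. e l (?Z w l)) =
          of_bool (W' w \<noteq> 0) * H w - of_bool (W' w \<noteq> 0) * E0 + E0" for w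
        by (cases "W' w = 0") (auto simp: H_def E0_def)
      moreover have "integrable M' (\<lambda>w. of_bool (W' w \<noteq> 0) * H w)"
        using H_b order_trans[OF abs_ge_zero H_b]
        by (intro M'.integrable_const_bound[of _ ?K]) (auto simp: of_bool_def)
      moreover have "(\<integral>w. of_bool (W' w \<noteq> 0) \<partial>M') = pw"
      proof -
        have "(\<integral>w. of_bool (W' w \<noteq> 0) \<partial>M') = (\<integral>u. of_bool (u \<noteq> 0) \<partial>distr M' borel W' :: real)"
          by (subst integral_distr) auto
        also have "\<dots> = pw" unfolding W'_law pw_def by (subst integral_distr) auto
        finally show ?thesis .
      qed
      moreover have "(\<integral>w. of_bool (W' w \<noteq> 0) * H w \<partial>M') = (\<integral>w. of_bool (W' w \<noteq> 0) \<partial>M') * c"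
        using M'.expectation_mixed_gaussian[OF _ W'_measurable G_normal G_indep G_indep_W' e(1) K, where \<sigma>=\<sigma>]
        by (simp add: H_def c_def \<sigma> s2_def)
      ultimately show ?thesis by (simp add: M'.prob_space)
    qed
    ultimately show "(\<lambda>n. \<integral>w. (\<Prod>l\<in>{1..d}. e l (?V n w l)) \<partial>M) \<longlonglongrightarrow>
        (\<integral>w. (\<Prod>l\<in>{1..d}. e l (?Z w l)) \<partial>M')"
      by simp
  qed auto
qed

end
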